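(* Let $0<\beta<\frac{\pi}{2}$, let $n\ge1$ be an integer and let $M$ be an integer with $0\le M\le 2n$. Then $$-(2n)!\,a_n(-\sec\beta) = \left(\frac{2\cot\beta}{\pi(\tan\beta-\beta)}\right)^{\frac12}\frac{(-1)^n\Gamma\left(2n+\frac12\right)}{(\tan\beta-\beta)^{2n}}\left(\sum_{m=0}^{M-1}\big(i(\tan\beta-\beta)\big)^m U_m(i\cot\beta)\frac{\Gamma\left(2n-m+\frac12\right)}{\Gamma\left(2n+\frac12\right)} + A_M(n,\beta)\right),$$ where the remainder $A_M(n,\beta)$ satisfies $$|A_M(n,\beta)|\le(\tan\beta-\beta)^M\,|U_M(i\cot\beta)|\,\frac{\Gamma\left(2n-M+\frac12\right)}{\Gamma\left(2n+\frac12\right)}.$$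
   Context: The coefficients $a_n(-\sec\beta)$ (those of the large-$\nu$ asymptotic expansion of the Anger--Weber function $\mathbf{A}_{-\nu}(\nu\sec\beta)=\frac1\pi\int_0^{+\infty}e^{-\nu(\sec\beta\sinh t-t)}dt$) are $$a_n(-\sec\beta) = -\frac{1}{(2n)!}\left[\frac{d^{2n}}{dt^{2n}}\left(\frac{t}{\sec\beta\,\sinh t - t}\right)^{2n+1}\right]_{t=0}.$$ The coefficients $U_m$ are $$U_m(i\cot\beta) = (-1)^m\frac{(i\cot\beta)^m}{2^m m!}\left[\frac{d^{2m}}{dt^{2m}}\left(\frac12\frac{t^2}{i\cot\beta\,(t-\sinh t)+\cosh t-1}\right)^{m+\frac12}\right]_{t=0}$$ (the expression in the large parentheses has value $1$ at $t=0$ and the power is the principal one there). Equivalently $U_m(x)$ are the polynomials with $U_0(x)=1$ and $U_m(x)=\frac12x^2(1-x^2)U_{m-1}'(x)+\frac18\int_0^x(1-5t^2)U_{m-1}(t)\,dt$ for $m\ge1$. Empty sums are zero. *)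

theory Defs
  imports "HOL-Complex_Analysis.Complex_Analysis"
begin

text \<open>
  Both coefficient families are given by Taylor coefficients at \<open>t = 0\<close> of powers of a quotient
  that reads \<open>0 / 0\<close> there. Since \<open>0 / 0 = 0\<close> in HOL, the quotient is first continued
  analytically by \<^const>\<open>remove_sings\<close>. All derivatives are complex derivatives in \<open>t\<close>.
\<close>

text \<open>
  The Anger--Weber coefficient \<open>a\<^sub>n(l)\<close>, written so that \<open>l = - sec \<beta>\<close> gives the base
  \<open>t / (sec \<beta> sinh t - t)\<close>. For this \<open>l\<close> the base takes the value \<open>1 / (sec \<beta> - 1)\<close> at \<open>t = 0\<close>.
\<close>

definition anger_weber_coeff :: "nat \<Rightarrow> complex \<Rightarrow> complex" where
  "anger_weber_coeff n l =
     - (1 / fact (2 * n)) *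
       (deriv ^^ (2 * n))
         (\<lambda>t. (remove_sings (\<lambda>s. s / ((- l) * sinh s - s)) t) ^ (2 * n + 1)) 0"

text \<open>
  The coefficient \<open>U\<^sub>m(x)\<close>. The base has value \<open>1\<close> at \<open>t = 0\<close>, and \<open>powr\<close> on the complex
  numbers is the principal power.
\<close>

definition debye_U :: "nat \<Rightarrow> complex \<Rightarrow> complex" where
  "debye_U m x =
     (-1) ^ m * (x ^ m / (2 ^ m * fact m)) *
       (deriv ^^ (2 * m))
         (\<lambda>t. (remove_sings
                 (\<lambda>s. (1 / 2) * (s ^ 2 / (x * (s - sinh s) + cosh s - 1))) t)
               powr (of_nat m + 1 / 2)) 0"

end

theory Submission
  imports Defs
begin

text \<open>
  Write \<open>f(w) = sec \<beta> sinh w - w\<close>, \<open>\<sigma> = tan \<beta> - \<beta>\<close> and \<open>S = - i f - \<sigma>\<close>, so that \<open>S\<close> has a double zero at the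
  saddle point \<open>i \<beta>\<close> of \<open>f\<close>. The coefficient \<open>a\<^sub>n\<close> is the residue at \<open>0\<close> of a multiple of
  \<open>(\<sigma> + S)\<^bsup>-(2n+1)\<^esup>\<close>, and \<open>U\<^sub>m(i cot \<beta>)\<close> is the residue at \<open>i \<beta>\<close> of a multiple of \<open>Z\<^bsup>-(2m+1)\<^esup>\<close>, where
  \<open>Z = \<surd>S\<close> is single-valued between the two curves \<open>Im w = - q(Re w)\<close> and \<open>Im w = 2 \<pi> - q(Re w)\<close> with
  \<open>cos q(p) = cos \<beta> p / sinh p\<close>. On these curves \<open>Z = - i y\<^sub>1\<close> and \<open>Z = i y\<^sub>2\<close> with \<open>y\<^sub>1, y\<^sub>2 > 0\<close>.

  Moving the contour of the second residue to the curves shows that \<open>i\<^sup>m U\<^sub>m(i cot \<beta>)\<close> is, up to sign and a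
  positive factor, the integral of the positive function \<open>y\<^sub>1\<^bsup>-(2m+1)\<^esup> + y\<^sub>2\<^bsup>-(2m+1)\<^esup>\<close>. For \<open>a\<^sub>n\<close>, write
  \<open>1 / (\<sigma> + Z\<^sup>2)\<^bsup>2n+1\<^esup> = \<Psi>(Z) + \<Psi>(-Z)\<close> with \<open>\<Psi>\<close> having its pole at \<open>- i \<surd>\<sigma>\<close> only: the residue of \<open>\<Psi>(Z)\<close>
  at \<open>0\<close>, moved to the curves, is the integral of \<open>T(y\<^sub>1) + T(y\<^sub>2)\<close> with \<open>T(y) = \<Psi>(iy)\<close>. Since \<open>T(y)\<close> is
  \<open>y / \<pi>\<close> times the integral of \<open>1 / ((\<sigma> + \<zeta>\<^sup>2)\<^bsup>2n+1\<^esup> (\<zeta>\<^sup>2 + y\<^sup>2))\<close> over \<open>\<zeta> > 0\<close>, it is enveloped by its expansion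
  in odd powers of \<open>1/y\<close>, and integrating over the curves gives the claim.
\<close>

subsection \<open>Residues in a strip bounded by two graphs\<close>

definition diff_quot :: "complex \<Rightarrow> (complex \<Rightarrow> complex) \<Rightarrow> complex \<Rightarrow> complex" where
  "diff_quot c g = (\<lambda>z. if z = c then deriv g c else (g z - g c) / (z - c))"

lemma diff_quot_eq: "g z = g c + (z - c) * diff_quot c g z"
  by (simp add: diff_quot_def)

text \<open>The singularity of the quotient at \<open>c\<close> is removable, and
  \<open>deriv g c\<close> is the value that removes it. So the operation preserves analyticity and
  can be iterated.\<close>

lemma analytic_on_diff_quot [analytic_intros]:
  assumes "g analytic_on S"
  shows "diff_quot c g analytic_on S"
proof -
  have "(\<lambda>z. g z - g c) analytic_on S"
    using assms by (intro analytic_intros)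
  moreover have "(\<lambda>z. g z - g c) z = (z - c) * diff_quot c g z" for z
    by (simp add: diff_quot_def)
  moreover have "deriv (\<lambda>z. g z - g c) c = diff_quot c g c"
  proof -
    \<comment> \<open>The point \<open>c\<close> may lie outside \<open>S\<close>, so no derivative
      of \<open>g\<close> there is at hand. The two values of \<open>deriv\<close> agree because
      both functions have the same derivatives, if any.\<close>
    have "((\<lambda>z. g z - g c) has_field_derivative D) (at c) \<longleftrightarrow> (g has_field_derivative D) (at c)" for D
      using DERIV_diff[of g D c UNIV "\<lambda>_. g c" 0] DERIV_add[of "\<lambda>z. g z - g c" D c UNIV "\<lambda>_. g c" 0] by auto
    thus ?thesis by (simp add: diff_quot_def deriv_def)
  qed
  moreover have "\<exists>d. 0 < d \<and> (\<forall>w\<in>ball z d - {c}. g w - g c = (w - c) * diff_quot c g w)" for z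
    by (rule exI[of _ 1]) (simp add: diff_quot_def)
  ultimately show ?thesis
    using pole_theorem_analytic_0[where g = "\<lambda>z. g z - g c" and a = c and f = "diff_quot c g" and S = S] by simp
qed

lemma analytic_on_diff_quot_funpow [analytic_intros]:
  "g analytic_on S \<Longrightarrow> (diff_quot c ^^ k) g analytic_on S"
  by (induction k) (auto intro: analytic_on_diff_quot)

text \<open>Iterating \<open>diff_quot_eq\<close> gives Taylor's formula with an exact remainder, as
  a purely algebraic identity.\<close>

lemma taylor_diff_quot:
  "B z = (\<Sum>k<N. (diff_quot c ^^ k) B c * (z - c) ^ k) + (z - c) ^ N * (diff_quot c ^^ N) B z"
proof (induction N)
  case (Suc N)
  have "(diff_quot c ^^ N) B z = (diff_quot c ^^ N) B c + (z - c) * (diff_quot c ^^ Suc N) B z"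
    by (simp add: diff_quot_eq[symmetric])
  with Suc show ?case
    by (simp add: algebra_simps)
qed simp

text \<open>Splitting off \<open>B c\<close> leaves a pole of order one less, with numerator
  \<open>diff_quot c B\<close>. The term split off is a pure power of order at least two and has
  residue zero.\<close>

lemma residue_over_power:
  assumes "B analytic_on {c}"
  shows "residue (\<lambda>w. B w / (w - c) ^ Suc k) c = (diff_quot c ^^ k) B c"
  using assms
proof (induction k arbitrary: B)
  case 0
  from 0 obtain A where "open A" "c \<in> A" "B holomorphic_on A"
    by (auto simp: analytic_on_holomorphic)
  from residue_holomorphic_over_power[OF this, of 0] show ?case by simp
next
  case (Suc k)
  let ?D = "diff_quot c B"
  have D: "?D analytic_on {c}" by (intro analytic_intros Suc.prems)
  then obtain A where A: "open A" "c \<in> A" "?D holomorphic_on A"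
    by (auto simp: analytic_on_holomorphic)
  have 1: "residue (\<lambda>w. B c / (w - c) ^ Suc (Suc k)) c = 0"
    using residue_holomorphic_over_power[of UNIV c "\<lambda>_. B c" "Suc k"]
    by (simp add: deriv_const del: funpow.simps)
  have "residue (\<lambda>w. B w / (w - c) ^ Suc (Suc k)) c =
        residue (\<lambda>w. B c / (w - c) ^ Suc (Suc k) + ?D w / (w - c) ^ Suc k) c"
  proof (rule residue_cong)
    have "B w / (w - c) ^ Suc (Suc k) = B c / (w - c) ^ Suc (Suc k) + ?D w / (w - c) ^ Suc k" if "w \<noteq> c" for w
    proof -
      have "B w / (w - c) ^ Suc (Suc k) = (B c + (w - c) * ?D w) / (w - c) ^ Suc (Suc k)"
        by (subst diff_quot_eq[of B w c]) (rule refl)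
      thus ?thesis using that by (simp add: add_divide_distrib)
    qed
    thus "\<forall>\<^sub>F w in at c. B w / (w - c) ^ Suc (Suc k) = B c / (w - c) ^ Suc (Suc k) + ?D w / (w - c) ^ Suc k"
      by (simp add: eventually_at_filter)
  qed simp
  also have "\<dots> = residue (\<lambda>w. B c / (w - c) ^ Suc (Suc k)) c + residue (\<lambda>w. ?D w / (w - c) ^ Suc k) c"
    by (rule residue_add[of A]) (use A in \<open>auto intro!: holomorphic_intros intro: holomorphic_on_subset\<close>)
  also have "\<dots> = (diff_quot c ^^ Suc k) B c"
    using 1 Suc.IH[OF D] by (simp add: funpow_Suc_right del: funpow.simps power_Suc)
  finally show ?case .
qed

text \<open>Derivatives are asked for only off \<open>p = 0\<close>, since the curves used below
  contain the quotient \<open>p / sinh p\<close>, continued by its limit. Continuity suffices at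
  that one point. The strict inequalities keep the pole off both curves.\<close>

locale strip =
  fixes y0 y1 d0 d1 :: "real \<Rightarrow> real" and c :: real
  assumes le: "\<And>p. y0 p \<le> y1 p"
    and cont: "continuous_on UNIV y0" "continuous_on UNIV y1"
    and deriv: "\<And>p. p \<noteq> 0 \<Longrightarrow> (y0 has_real_derivative d0 p) (at p)"
      "\<And>p. p \<noteq> 0 \<Longrightarrow> (y1 has_real_derivative d1 p) (at p)"
    and c_between: "y0 0 < c" "c < y1 0"
begin

definition g0 :: "real \<Rightarrow> complex" where "g0 p = Complex p (y0 p)"
definition g1 :: "real \<Rightarrow> complex" where "g1 p = Complex p (y1 p)"
definition K :: "complex set" where "K = {w. y0 (Re w) \<le> Im w \<and> Im w \<le> y1 (Re w)}"
abbreviation "pole \<equiv> Complex 0 c"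

lemma g0_cont: "continuous_on UNIV g0" and g1_cont: "continuous_on UNIV g1"
  unfolding g0_def g1_def Complex_eq by (intro continuous_intros cont)+

lemma g0_deriv: "p \<noteq> 0 \<Longrightarrow> (g0 has_vector_derivative Complex 1 (d0 p)) (at p)"
  and g1_deriv: "p \<noteq> 0 \<Longrightarrow> (g1 has_vector_derivative Complex 1 (d1 p)) (at p)"
  unfolding g0_def g1_def has_vector_derivative_complex_iff
  using deriv by (auto simp: has_real_derivative_iff_has_vector_derivative[symmetric])

lemma segment_subset_K: "closed_segment (g0 p) (g1 p) \<subseteq> K \<inter> {w. Re w = p}"
  unfolding K_def g0_def g1_def using le[of p]
  by (auto simp: closed_segment_same_Re closed_segment_eq_real_ivl)

lemma g0_in_K: "g0 p \<in> K" and g1_in_K: "g1 p \<in> K"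
  using segment_subset_K[of p] by auto

lemma g_ne_pole: "g0 p \<noteq> pole" "g1 p \<noteq> pole"
  using c_between by (auto simp: g0_def g1_def)

text \<open>The conclusion of the residue theorem for the part of the strip with
  \<open>\<bar>Re w\<bar> \<le> R\<close>, bounded by two arcs and two vertical segments, with
  \<open>r\<close> in the role of the residue. Being linear in \<open>F\<close> and
  \<open>r\<close>, it can be checked on partial fractions, without winding numbers.\<close>

definition strip_residue :: "(complex \<Rightarrow> complex) \<Rightarrow> complex \<Rightarrow> bool" where
  "strip_residue F r \<longleftrightarrow> (\<forall>R>0. \<exists>a b.
     (F has_contour_integral a) (linepath (g0 (-R)) (g1 (-R))) \<and>
     (F has_contour_integral b) (linepath (g0 R) (g1 R)) \<and>
     ((\<lambda>p. F (g0 p) * Complex 1 (d0 p) - F (g1 p) * Complex 1 (d1 p))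
        has_integral (a - b + 2 * of_real pi * \<i> * r)) {-R..R})"

lemma strip_residueE:
  assumes "strip_residue F r" "R > 0"
  obtains a b where
    "(F has_contour_integral a) (linepath (g0 (-R)) (g1 (-R)))"
    "(F has_contour_integral b) (linepath (g0 R) (g1 R))"
    "((\<lambda>p. F (g0 p) * Complex 1 (d0 p) - F (g1 p) * Complex 1 (d1 p))
        has_integral (a - b + 2 * of_real pi * \<i> * r)) {-R..R}"
  using assms unfolding strip_residue_def by blast

lemma strip_residue_add:
  assumes "strip_residue F r" "strip_residue G s"
  shows "strip_residue (\<lambda>w. F w + G w) (r + s)"
  unfolding strip_residue_def
proof (intro allI impI)
  fix R :: real assume "R > 0"
  obtain a b where F:
    "(F has_contour_integral a) (linepath (g0 (-R)) (g1 (-R)))"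
    "(F has_contour_integral b) (linepath (g0 R) (g1 R))"
    "((\<lambda>p. F (g0 p) * Complex 1 (d0 p) - F (g1 p) * Complex 1 (d1 p))
        has_integral (a - b + 2 * of_real pi * \<i> * r)) {-R..R}"
    using assms(1) \<open>R > 0\<close> by (rule strip_residueE)
  obtain a' b' where G:
    "(G has_contour_integral a') (linepath (g0 (-R)) (g1 (-R)))"
    "(G has_contour_integral b') (linepath (g0 R) (g1 R))"
    "((\<lambda>p. G (g0 p) * Complex 1 (d0 p) - G (g1 p) * Complex 1 (d1 p))
        has_integral (a' - b' + 2 * of_real pi * \<i> * s)) {-R..R}"
    using assms(2) \<open>R > 0\<close> by (rule strip_residueE)
  have "(F (g0 p) + G (g0 p)) * Complex 1 (d0 p) - (F (g1 p) + G (g1 p)) * Complex 1 (d1 p) =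
    (F (g0 p) * Complex 1 (d0 p) - F (g1 p) * Complex 1 (d1 p)) +
    (G (g0 p) * Complex 1 (d0 p) - G (g1 p) * Complex 1 (d1 p))" for p
    by (simp add: algebra_simps)
  moreover have "(a + a') - (b + b') + 2 * of_real pi * \<i> * (r + s) =
    (a - b + 2 * of_real pi * \<i> * r) + (a' - b' + 2 * of_real pi * \<i> * s)"
    by (simp add: algebra_simps)
  ultimately have "((\<lambda>p. (F (g0 p) + G (g0 p)) * Complex 1 (d0 p) - (F (g1 p) + G (g1 p)) * Complex 1 (d1 p))
        has_integral ((a + a') - (b + b') + 2 * of_real pi * \<i> * (r + s))) {-R..R}"
    using has_integral_add[OF F(3) G(3)] by (simp only:)
  thus "\<exists>a b. ((\<lambda>w. F w + G w) has_contour_integral a) (linepath (g0 (-R)) (g1 (-R))) \<and>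
     ((\<lambda>w. F w + G w) has_contour_integral b) (linepath (g0 R) (g1 R)) \<and>
     ((\<lambda>p. (F (g0 p) + G (g0 p)) * Complex 1 (d0 p) - (F (g1 p) + G (g1 p)) * Complex 1 (d1 p))
        has_integral (a - b + 2 * of_real pi * \<i> * (r + s))) {-R..R}"
    using has_contour_integral_add[OF F(1) G(1)] has_contour_integral_add[OF F(2) G(2)] by blast
qed

lemma strip_residue_cmult:
  assumes "strip_residue F r"
  shows "strip_residue (\<lambda>w. k * F w) (k * r)"
  unfolding strip_residue_def
proof (intro allI impI)
  fix R :: real assume "R > 0"
  obtain a b where
    *: "(F has_contour_integral a) (linepath (g0 (-R)) (g1 (-R)))"
     "(F has_contour_integral b) (linepath (g0 R) (g1 R))"
     "((\<lambda>p. F (g0 p) * Complex 1 (d0 p) - F (g1 p) * Complex 1 (d1 p))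
        has_integral (a - b + 2 * of_real pi * \<i> * r)) {-R..R}"
    using assms(1) \<open>R > 0\<close> by (rule strip_residueE)
  have "k * F (g0 p) * Complex 1 (d0 p) - k * F (g1 p) * Complex 1 (d1 p) =
    k * (F (g0 p) * Complex 1 (d0 p) - F (g1 p) * Complex 1 (d1 p))" for p
    by (simp add: algebra_simps)
  moreover have "k * a - k * b + 2 * of_real pi * \<i> * (k * r) = k * (a - b + 2 * of_real pi * \<i> * r)"
    by (simp add: algebra_simps)
  ultimately have "((\<lambda>p. k * F (g0 p) * Complex 1 (d0 p) - k * F (g1 p) * Complex 1 (d1 p))
        has_integral (k * a - k * b + 2 * of_real pi * \<i> * (k * r))) {-R..R}"
    using has_integral_mult_right[OF *(3), of k] by (simp only:)
  thus "\<exists>a b. ((\<lambda>w. k * F w) has_contour_integral a) (linepath (g0 (-R)) (g1 (-R))) \<and>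
     ((\<lambda>w. k * F w) has_contour_integral b) (linepath (g0 R) (g1 R)) \<and>
     ((\<lambda>p. k * F (g0 p) * Complex 1 (d0 p) - k * F (g1 p) * Complex 1 (d1 p))
        has_integral (a - b + 2 * of_real pi * \<i> * (k * r))) {-R..R}"
    using has_contour_integral_lmul[OF *(1), of k] has_contour_integral_lmul[OF *(2), of k] by blast
qed

lemma strip_residue_0: "strip_residue (\<lambda>w. 0) 0"
  unfolding strip_residue_def using has_contour_integral_0 by fastforce

lemma strip_residue_sum:
  assumes "\<And>i. i \<in> I \<Longrightarrow> strip_residue (F i) (r i)" "finite I"
  shows "strip_residue (\<lambda>w. \<Sum>i\<in>I. F i w) (\<Sum>i\<in>I. r i)"
  using assms(2,1)
  by (induction I rule: finite_induct) (auto intro: strip_residue_0 strip_residue_add)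

lemma strip_residue_cong:
  assumes "strip_residue F r" and eq: "\<And>w. w \<in> K \<Longrightarrow> w \<noteq> pole \<Longrightarrow> F w = G w"
  shows "strip_residue G r"
  unfolding strip_residue_def
proof (intro allI impI)
  fix R :: real assume R: "R > 0"
  obtain a b where
    *: "(F has_contour_integral a) (linepath (g0 (-R)) (g1 (-R)))"
     "(F has_contour_integral b) (linepath (g0 R) (g1 R))"
     "((\<lambda>p. F (g0 p) * Complex 1 (d0 p) - F (g1 p) * Complex 1 (d1 p))
        has_integral (a - b + 2 * of_real pi * \<i> * r)) {-R..R}"
    using assms(1) \<open>R > 0\<close> by (rule strip_residueE)
  have seg: "F w = G w" if "w \<in> closed_segment (g0 p) (g1 p)" "p \<noteq> 0" for w p
    using that segment_subset_K[of p] by (intro eq) auto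
  have "F (g0 p) = G (g0 p)" "F (g1 p) = G (g1 p)" for p
    using g_ne_pole g0_in_K g1_in_K eq by auto
  hence "((\<lambda>p. G (g0 p) * Complex 1 (d0 p) - G (g1 p) * Complex 1 (d1 p))
        has_integral (a - b + 2 * of_real pi * \<i> * r)) {-R..R}"
    using *(3) by simp
  moreover have "(G has_contour_integral a) (linepath (g0 (-R)) (g1 (-R)))"
    using R seg[of _ "-R"] by (intro has_contour_integral_eq[OF *(1)]) simp
  moreover have "(G has_contour_integral b) (linepath (g0 R) (g1 R))"
    using R seg[of _ R] by (intro has_contour_integral_eq[OF *(2)]) simp
  ultimately show "\<exists>a b. (G has_contour_integral a) (linepath (g0 (-R)) (g1 (-R))) \<and>
     (G has_contour_integral b) (linepath (g0 R) (g1 R)) \<and>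
     ((\<lambda>p. G (g0 p) * Complex 1 (d0 p) - G (g1 p) * Complex 1 (d1 p))
        has_integral (a - b + 2 * of_real pi * \<i> * r)) {-R..R}"
    by blast
qed

section \<open>Cauchy's theorem and the residue theorem between the graphs\<close>

lemma local_primitive:
  assumes "G analytic_on K"
  obtains V P where "open V" "convex V" "closed_segment (g0 p) (g1 p) \<subseteq> V"
    "\<And>w. w \<in> V \<Longrightarrow> (P has_field_derivative G w) (at w)"
proof -
  obtain E where E: "open E" "K \<subseteq> E" "G holomorphic_on E"
    using assms by (auto simp: analytic_on_holomorphic)
  let ?s = "closed_segment (g0 p) (g1 p)"
  have "?s \<subseteq> E" using segment_subset_K[of p] E by auto
  then obtain e where e: "e > 0" "(\<Union>x\<in>?s. ball x e) \<subseteq> E"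
    using compact_subset_open_imp_ball_epsilon_subset[OF compact_segment E(1)] by metis
  \<comment> \<open>The \<open>e\<close>-neighbourhood of a segment is a sum of two convex sets,
    hence convex, which is what provides a primitive.\<close>
  define V where "V = (\<Union>x\<in>?s. \<Union>y\<in>ball 0 e. {x + y})"
  have V_eq: "V = (\<Union>x\<in>?s. ball x e)"
  proof (intro equalityI subsetI)
    fix z assume "z \<in> (\<Union>x\<in>?s. ball x e)"
    then obtain x where x: "x \<in> ?s" "dist x z < e" by auto
    hence "z - x \<in> ball 0 e" "z = x + (z - x)" by (auto simp: dist_norm norm_minus_commute)
    thus "z \<in> V" unfolding V_def using x by blast
  next
    fix z assume "z \<in> V"
    then obtain x y where "x \<in> ?s" "norm y < e" "z = x + y" by (auto simp: V_def)
    hence "x \<in> ?s" "z \<in> ball x e" by (simp_all add: dist_norm)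
    thus "z \<in> (\<Union>x\<in>?s. ball x e)" by blast
  qed
  have cv: "convex V" unfolding V_def by (intro convex_sums convex_closed_segment convex_ball)
  have op: "open V" unfolding V_eq by auto
  have "G holomorphic_on V" using E(3) e(2) by (auto simp: V_eq intro: holomorphic_on_subset)
  from holomorphic_convex_primitive'[OF cv op this] obtain P where
    P: "\<And>w. w \<in> V \<Longrightarrow> (P has_field_derivative G w) (at w within V)" by blast
  have "(P has_field_derivative G w) (at w)" if "w \<in> V" for w
    using P[OF that] at_within_open[OF that op] by simp
  moreover have "?s \<subseteq> V"
    using e(1) centre_in_ball unfolding V_eq by blast
  ultimately show thesis
    using that[OF op cv] by blast
qed

text \<open>Let \<open>H p\<close> be the integral of \<open>G\<close> over the vertical segment at
  \<open>p\<close>. A local primitive \<open>P\<close> gives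
  \<open>H p = P (g1 p) - P (g0 p)\<close>, whose derivative is, up to sign, the integrand along the
  curves. The fundamental theorem of calculus then takes the place of a closed contour.\<close>

lemma strip_residue_analytic:
  assumes G: "G analytic_on K"
  shows "strip_residue G 0"
proof -
  define H where "H p = contour_integral (linepath (g0 p) (g1 p)) G" for p
  have loc: "\<exists>P. (\<forall>\<^sub>F x in nhds p. H x = P (g1 x) - P (g0 x) \<and>
        (G has_contour_integral H x) (linepath (g0 x) (g1 x))) \<and>
        (P has_field_derivative G (g0 p)) (at (g0 p)) \<and> (P has_field_derivative G (g1 p)) (at (g1 p))"
    for p
  proof -
    obtain V P where V: "open V" "convex V" "closed_segment (g0 p) (g1 p) \<subseteq> V"
      "\<And>w. w \<in> V \<Longrightarrow> (P has_field_derivative G w) (at w)"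
      using local_primitive[OF G, of p] by blast
    have "\<forall>\<^sub>F x in nhds p. g0 x \<in> V" "\<forall>\<^sub>F x in nhds p. g1 x \<in> V"
      using g0_cont g1_cont V(1,3)
      by (auto simp: continuous_on_eq_continuous_at isCont_def tendsto_def eventually_nhds_conv_at
          dest!: spec[of _ V] bspec[of _ _ p])
    hence "\<forall>\<^sub>F x in nhds p. H x = P (g1 x) - P (g0 x) \<and>
        (G has_contour_integral H x) (linepath (g0 x) (g1 x))"
    proof eventually_elim
      case (elim x)
      have "closed_segment (g0 x) (g1 x) \<subseteq> V"
        using elim V(2) by (simp add: closed_segment_subset)
      hence "(G has_contour_integral (P (g1 x) - P (g0 x))) (linepath (g0 x) (g1 x))"
        using contour_integral_primitive[of V P G "linepath (g0 x) (g1 x)"] V(4)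
        by (auto intro: has_field_derivative_at_within)
      thus ?case unfolding H_def by (simp add: contour_integral_unique)
    qed
    thus ?thesis using V by (intro exI[of _ P]) auto
  qed
  have Hint: "(G has_contour_integral H p) (linepath (g0 p) (g1 p))" for p
    using loc[of p] by (auto dest: eventually_nhds_x_imp_x)
  have Hcont: "isCont H p" for p
  proof -
    from loc[of p] obtain P where ev: "\<forall>\<^sub>F x in nhds p. H x = P (g1 x) - P (g0 x) \<and>
        (G has_contour_integral H x) (linepath (g0 x) (g1 x))"
      and d: "(P has_field_derivative G (g0 p)) (at (g0 p))" "(P has_field_derivative G (g1 p)) (at (g1 p))"
      by blast
    have P: "\<forall>\<^sub>F x in nhds p. H x = P (g1 x) - P (g0 x)" "isCont P (g0 p)" "isCont P (g1 p)"
      using d[THEN DERIV_isCont] eventually_mono[OF ev] by auto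
    have "isCont (\<lambda>x. P (g1 x) - P (g0 x)) p"
      using g0_cont g1_cont P(2,3)
      by (intro continuous_intros isCont_o2[of p g0 P] isCont_o2[of p g1 P])
         (auto simp: continuous_on_eq_continuous_at)
    thus ?thesis using isCont_cong[OF P(1)] by simp
  qed
  have Hderiv: "(H has_vector_derivative (G (g1 p) * Complex 1 (d1 p) - G (g0 p) * Complex 1 (d0 p))) (at p)"
    if "p \<noteq> 0" for p
  proof -
    from loc[of p] obtain P where ev: "\<forall>\<^sub>F x in nhds p. H x = P (g1 x) - P (g0 x) \<and>
        (G has_contour_integral H x) (linepath (g0 x) (g1 x))"
      and d: "(P has_field_derivative G (g0 p)) (at (g0 p))" "(P has_field_derivative G (g1 p)) (at (g1 p))"
      by blast
    have P: "\<forall>\<^sub>F x in nhds p. P (g1 x) - P (g0 x) = H x"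
      using eventually_mono[OF ev] by auto
    have "((\<lambda>x. P (g1 x) - P (g0 x)) has_vector_derivative
       (Complex 1 (d1 p) * G (g1 p) - Complex 1 (d0 p) * G (g0 p))) (at p)"
      using field_vector_diff_chain_at[OF g1_deriv[OF that] d(2)]
        field_vector_diff_chain_at[OF g0_deriv[OF that] d(1)]
      by (intro has_vector_derivative_diff) (simp_all add: o_def mult.commute)
    moreover have "\<forall>\<^sub>F x in nhds p. x \<in> UNIV \<longrightarrow> P (g1 x) - P (g0 x) = H x"
      using P by simp
    ultimately show ?thesis
      using has_vector_derivative_cong_ev[of UNIV "\<lambda>x. P (g1 x) - P (g0 x)" H p] eventually_nhds_x_imp_x[OF P]
      by (simp add: mult.commute)
  qed
  show ?thesis unfolding strip_residue_def
  proof (intro allI impI)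
    fix R :: real assume R: "R > 0"
    have "((\<lambda>p. G (g1 p) * Complex 1 (d1 p) - G (g0 p) * Complex 1 (d0 p))
        has_integral (H R - H (-R))) {-R..R}"
      \<comment> \<open>At the exceptional point \<open>0\<close> continuity of \<open>H\<close> is
        enough.\<close>
      by (rule fundamental_theorem_of_calculus_interior_strong[of "{0}"])
         (use R Hderiv Hcont in \<open>auto intro!: continuous_at_imp_continuous_on\<close>)
    hence "((\<lambda>p. -(G (g1 p) * Complex 1 (d1 p) - G (g0 p) * Complex 1 (d0 p)))
        has_integral -(H R - H (-R))) {-R..R}" by (rule has_integral_neg)
    thus "\<exists>a b. (G has_contour_integral a) (linepath (g0 (-R)) (g1 (-R))) \<and>
     (G has_contour_integral b) (linepath (g0 R) (g1 R)) \<and>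
     ((\<lambda>p. G (g0 p) * Complex 1 (d0 p) - G (g1 p) * Complex 1 (d1 p))
        has_integral (a - b + 2 * of_real pi * \<i> * 0)) {-R..R}"
      using Hint by (intro exI[of _ "H (-R)"] exI[of _ "H R"]) simp
  qed
qed

lemma curve_primitive_integral:
  fixes P G :: "complex \<Rightarrow> complex"
  assumes "R > 0"
    and "\<And>p. (P has_field_derivative G (g p)) (at (g p))"
    and "continuous_on UNIV g"
    and "\<And>p. p \<noteq> 0 \<Longrightarrow> (g has_vector_derivative g' p) (at p)"
  shows "((\<lambda>p. G (g p) * g' p) has_integral (P (g R) - P (g (-R)))) {-R..R}"
proof (rule fundamental_theorem_of_calculus_interior_strong[of "{0}" _ _ "\<lambda>p. P (g p)"])
  fix x assume "x \<in> {-R<..<R} - {0}"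
  hence "x \<noteq> 0" by simp
  show "((\<lambda>p. P (g p)) has_vector_derivative G (g x) * g' x) (at x)"
    using field_vector_diff_chain_at[OF assms(4)[OF \<open>x \<noteq> 0\<close>] assms(2)] by (simp add: o_def mult.commute)
next
  have "isCont (\<lambda>p. P (g p)) x" for x
  proof (rule isCont_o2[of x g P])
    show "isCont g x" using assms(3) by (simp add: continuous_on_eq_continuous_at)
    show "isCont P (g x)" by (rule DERIV_isCont[OF assms(2)])
  qed
  thus "continuous_on {-R..R} (\<lambda>p. P (g p))" by (simp add: continuous_at_imp_continuous_on)
qed (use assms(1) in simp_all)

lemma segment_ne_pole: "w \<in> closed_segment (g0 R) (g1 R) \<Longrightarrow> R \<noteq> 0 \<Longrightarrow> Re w = R \<and> w \<noteq> pole"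
  using segment_subset_K[of R] by auto

lemma has_contour_integral_linepath_primitive:
  assumes "\<And>w. w \<in> closed_segment a b \<Longrightarrow> (P has_field_derivative F w) (at w)"
  shows "(F has_contour_integral (P b - P a)) (linepath a b)"
  using contour_integral_primitive[of "closed_segment a b" P F "linepath a b"] assms
  by (auto intro: has_field_derivative_at_within)

text \<open>A pure power of order at least two has a primitive on the whole punctured plane, so the
  boundary terms cancel at the corners.\<close>

lemma strip_residue_higher_pole: "strip_residue (\<lambda>w. 1 / (w - pole) ^ Suc (Suc k)) 0"
proof -
  define P where "P = (\<lambda>w. - 1 / (of_nat (Suc k) * (w - pole) ^ Suc k))"
  have P: "(P has_field_derivative 1 / (w - pole) ^ Suc (Suc k)) (at w)" if "w \<noteq> pole" for w
  proof -
    have nz: "(of_nat (Suc k) :: complex) \<noteq> 0" by (simp only: of_nat_eq_0_iff)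
    have "(P has_field_derivative (of_nat (Suc k) * (of_nat (Suc k) * (w - pole) ^ k)) /
       (of_nat (Suc k) * (w - pole) ^ Suc k)\<^sup>2) (at w)"
      unfolding P_def using that nz
      by (auto intro!: derivative_eq_intros simp del: of_nat_Suc power_Suc simp: power2_eq_square)
    also have "(of_nat (Suc k) * (of_nat (Suc k) * (w - pole) ^ k)) /
       (of_nat (Suc k) * (w - pole) ^ Suc k)\<^sup>2 = 1 / (w - pole) ^ Suc (Suc k)"
      using that nz by (simp add: divide_simps power2_eq_square del: of_nat_Suc)
    finally show ?thesis .
  qed
  show ?thesis unfolding strip_residue_def
  proof (intro allI impI)
    fix R :: real assume R: "R > 0"
    have 0: "((\<lambda>p. 1 / (g0 p - pole) ^ Suc (Suc k) * Complex 1 (d0 p)) has_integral (P (g0 R) - P (g0 (-R)))) {-R..R}"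
      by (rule curve_primitive_integral[where g = g0, OF R P]) (auto simp: g_ne_pole g0_cont g0_deriv)
    have 1: "((\<lambda>p. 1 / (g1 p - pole) ^ Suc (Suc k) * Complex 1 (d1 p)) has_integral (P (g1 R) - P (g1 (-R)))) {-R..R}"
      by (rule curve_primitive_integral[where g = g1, OF R P]) (auto simp: g_ne_pole g1_cont g1_deriv)
    have 2: "((\<lambda>w. 1 / (w - pole) ^ Suc (Suc k)) has_contour_integral (P (g1 p) - P (g0 p))) (linepath (g0 p) (g1 p))"
      if "p \<noteq> 0" for p
      by (intro has_contour_integral_linepath_primitive P) (use segment_ne_pole that in auto)
    show "\<exists>a b. ((\<lambda>w. 1 / (w - pole) ^ Suc (Suc k)) has_contour_integral a) (linepath (g0 (-R)) (g1 (-R))) \<and>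
     ((\<lambda>w. 1 / (w - pole) ^ Suc (Suc k)) has_contour_integral b) (linepath (g0 R) (g1 R)) \<and>
     ((\<lambda>p. 1 / (g0 p - pole) ^ Suc (Suc k) * Complex 1 (d0 p) - 1 / (g1 p - pole) ^ Suc (Suc k) * Complex 1 (d1 p))
        has_integral (a - b + 2 * of_real pi * \<i> * 0)) {-R..R}"
      using 2[of R] 2[of "-R"] R has_integral_diff[OF 0 1]
      by (intro exI[of _ "P (g1 (-R)) - P (g0 (-R))"] exI[of _ "P (g1 R) - P (g0 R)"]) (auto simp: algebra_simps)
  qed
qed

text \<open>Each side gets a branch of the logarithm whose cut points away from it:
  \<open>u = \<i>\<close> turns the cut upwards for the lower curve, \<open>u = - \<i>\<close>
  downwards for the upper one, and \<open>u = sgn p\<close> horizontally away from the vertical side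
  at \<open>p\<close>.\<close>

lemma strip_residue_simple_pole: "strip_residue (\<lambda>w. 1 / (w - pole)) 1"
  unfolding strip_residue_def
proof (intro allI impI)
  fix R :: real assume R: "R > 0"
  define P where "P u w = Ln (u * (w - pole))" for u w
  have P: "(P u has_field_derivative 1 / (w - pole)) (at w)" if "u * (w - pole) \<notin> \<real>\<^sub>\<le>\<^sub>0" "u \<noteq> 0" for u w
  proof -
    have "w \<noteq> pole" using that by auto
    thus ?thesis unfolding P_def using that
      by (auto intro!: derivative_eq_intros simp: divide_simps)
  qed
  have 0: "((\<lambda>p. 1 / (g0 p - pole) * Complex 1 (d0 p)) has_integral (P \<i> (g0 R) - P \<i> (g0 (-R)))) {-R..R}"
    by (rule curve_primitive_integral[where g = g0, OF R P])
       (use c_between g0_cont g0_deriv in \<open>auto simp: complex_nonpos_Reals_iff\<close>, auto simp: g0_def)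
  have 1: "((\<lambda>p. 1 / (g1 p - pole) * Complex 1 (d1 p)) has_integral (P (-\<i>) (g1 R) - P (-\<i>) (g1 (-R)))) {-R..R}"
    by (rule curve_primitive_integral[where g = g1, OF R P])
       (use c_between g1_cont g1_deriv in \<open>auto simp: complex_nonpos_Reals_iff\<close>, auto simp: g1_def)
  have 2: "((\<lambda>w. 1 / (w - pole)) has_contour_integral (P (of_real (sgn p)) (g1 p) - P (of_real (sgn p)) (g0 p)))
     (linepath (g0 p) (g1 p))" if "p \<noteq> 0" for p
  proof (intro has_contour_integral_linepath_primitive P)
    fix w assume "w \<in> closed_segment (g0 p) (g1 p)"
    hence "Re w = p" using segment_ne_pole that by auto
    thus "complex_of_real (sgn p) * (w - pole) \<notin> \<real>\<^sub>\<le>\<^sub>0"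
      using that by (auto simp: complex_nonpos_Reals_iff sgn_if)
  qed (use that in \<open>auto simp: sgn_if\<close>)
  \<comment> \<open>For \<open>Re z > 0\<close> a quarter turn in either direction stays within the
    principal range of the argument.\<close>
  have Lp: "Ln (\<i> * z) = Ln z + \<i> * of_real pi / 2" "Ln (-(\<i> * z)) = Ln z - \<i> * of_real pi / 2"
    if "Re z > 0" for z
  proof -
    have nz: "z \<noteq> 0" using that by auto
    show "Ln (\<i> * z) = Ln z + \<i> * of_real pi / 2" using that nz by (simp add: Ln_times_ii)
    have "Ln (\<i> * (- \<i> * z)) = Ln (-\<i> * z) + \<i> * of_real pi / 2 \<or> Im z > 0 \<and> Re z < 0"
      using that nz by (subst Ln_times_ii) auto
    thus "Ln (-(\<i> * z)) = Ln z - \<i> * of_real pi / 2" using that by (auto simp: mult.assoc[symmetric])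
  qed
  \<comment> \<open>At each of the four corners the adjacent branches differ by a quarter turn; the
    four jumps add up to \<open>2 * pi * \<i>\<close>.\<close>
  have Lr: "P \<i> w = P 1 w + \<i> * of_real pi / 2" "P (-\<i>) w = P 1 w - \<i> * of_real pi / 2" if "Re w > 0" for w
    using Lp[of "w - pole"] that by (auto simp: P_def)
  have Ll: "P \<i> w = P (-1) w - \<i> * of_real pi / 2" "P (-\<i>) w = P (-1) w + \<i> * of_real pi / 2" if "Re w < 0" for w
    using Lp[of "pole - w"] that by (auto simp: P_def algebra_simps)
  have R2: "Re (g0 R) > 0" "Re (g1 R) > 0" "Re (g0 (-R)) < 0" "Re (g1 (-R)) < 0"
    using R by (auto simp: g0_def g1_def)
  show "\<exists>a b. ((\<lambda>w. 1 / (w - pole)) has_contour_integral a) (linepath (g0 (-R)) (g1 (-R))) \<and>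
     ((\<lambda>w. 1 / (w - pole)) has_contour_integral b) (linepath (g0 R) (g1 R)) \<and>
     ((\<lambda>p. 1 / (g0 p - pole) * Complex 1 (d0 p) - 1 / (g1 p - pole) * Complex 1 (d1 p))
        has_integral (a - b + 2 * of_real pi * \<i> * 1)) {-R..R}"
  proof (intro exI conjI)
    show "((\<lambda>p. 1 / (g0 p - pole) * Complex 1 (d0 p) - 1 / (g1 p - pole) * Complex 1 (d1 p))
        has_integral ((P (-1) (g1 (-R)) - P (-1) (g0 (-R))) - (P 1 (g1 R) - P 1 (g0 R)) + 2 * of_real pi * \<i> * 1)) {-R..R}"
      using has_integral_diff[OF 0 1] R2 by (simp add: Lr Ll algebra_simps)
  qed (use 2[of R] 2[of "-R"] R in auto)
qed

text \<open>Taylor's formula for \<open>B\<close> splits the quotient into pure powers and an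
  analytic rest. Only the first power, which is the index \<open>k = n\<close>, contributes.\<close>

theorem strip_residue_pole:
  assumes "B analytic_on K" "N > 0"
  shows "strip_residue (\<lambda>w. B w / (w - pole) ^ N) (residue (\<lambda>w. B w / (w - pole) ^ N) pole)"
proof -
  define b where "b k = (diff_quot pole ^^ k) B pole" for k
  obtain n where N: "N = Suc n" using assms(2) gr0_conv_Suc by blast
  have "pole \<in> K" using c_between by (auto simp: K_def)
  hence res: "residue (\<lambda>w. B w / (w - pole) ^ N) pole = b n"
    unfolding N b_def using assms by (intro residue_over_power) (auto intro: analytic_on_subset)
  have "strip_residue (\<lambda>w. (diff_quot pole ^^ N) B w) 0"
    by (intro strip_residue_analytic analytic_intros assms)
  moreover have "strip_residue (\<lambda>w. \<Sum>k<N. b k * (1 / (w - pole) ^ (N - k))) (\<Sum>k<N. b k * (if k = n then 1 else 0))"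
  proof (intro strip_residue_sum strip_residue_cmult)
    fix k assume k: "k \<in> {..<N}"
    show "strip_residue (\<lambda>w. 1 / (w - pole) ^ (N - k)) (if k = n then 1 else 0)"
    proof (cases "k = n")
      case True thus ?thesis using strip_residue_simple_pole by (simp add: N)
    next
      case False
      then obtain j where "N - k = Suc (Suc j)"
        using k by (metis N Suc_diff_Suc Suc_diff_le lessThan_iff less_Suc_eq less_imp_Suc_add add_diff_cancel_left' diff_Suc_Suc less_imp_le)
      thus ?thesis using strip_residue_higher_pole[of j] False by simp
    qed
  qed simp
  ultimately have "strip_residue (\<lambda>w. (\<Sum>k<N. b k * (1 / (w - pole) ^ (N - k))) + (diff_quot pole ^^ N) B w)
    ((\<Sum>k<N. b k * (if k = n then 1 else 0)) + 0)"
    by (rule strip_residue_add[rotated])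
  moreover have "(\<Sum>k<N. b k * (if k = n then 1 else 0)) = b n"
    by (simp add: N if_distrib sum.delta cong: if_cong)
  moreover have "(\<Sum>k<N. b k * (1 / (w - pole) ^ (N - k))) + (diff_quot pole ^^ N) B w = B w / (w - pole) ^ N"
    if "w \<noteq> pole" for w
    using that taylor_diff_quot[of B w pole N]
    by (auto simp: b_def divide_simps sum_distrib_left sum_distrib_right power_diff field_simps
        intro!: sum.cong)
  ultimately show ?thesis unfolding res
    by (auto intro: strip_residue_cong)
qed

text \<open>The vertical sides have length at most \<open>C\<close> and \<open>F\<close> becomes
  small on them, so only the two curves remain in the limit.\<close>

theorem strip_integral_tendsto:
  assumes F: "strip_residue F r"
    and width: "\<And>p. y1 p - y0 p \<le> C"
    and decay: "\<And>e. e > 0 \<Longrightarrow> \<exists>R0. \<forall>w\<in>K. \<bar>Re w\<bar> \<ge> R0 \<longrightarrow> norm (F w) \<le> e"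
  shows "((\<lambda>R. integral {-R..R} (\<lambda>p. F (g0 p) * Complex 1 (d0 p) - F (g1 p) * Complex 1 (d1 p)))
    \<longlongrightarrow> 2 * of_real pi * \<i> * r) at_top"
proof (rule tendstoI)
  fix e :: real assume e: "e > 0"
  have C: "C \<ge> 0" using width[of 0] le[of 0] by linarith
  \<comment> \<open>Using \<open>C + 1\<close> avoids a zero denominator; each vertical side then
    contributes at most \<open>e / 4\<close>.\<close>
  define d where "d = e / (4 * (C + 1))"
  have d: "d > 0" unfolding d_def using e C by auto
  obtain R0 where R0: "\<And>w. w \<in> K \<Longrightarrow> \<bar>Re w\<bar> \<ge> R0 \<Longrightarrow> norm (F w) \<le> d"
    using decay[OF d] by blast
  show "\<forall>\<^sub>F R in at_top. dist (integral {-R..R} (\<lambda>p. F (g0 p) * Complex 1 (d0 p) - F (g1 p) * Complex 1 (d1 p)))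
     (2 * of_real pi * \<i> * r) < e"
    using eventually_gt_at_top[of 0] eventually_ge_at_top[of R0]
  proof eventually_elim
    case (elim R)
    from F \<open>0 < R\<close> obtain a b where
      *: "(F has_contour_integral a) (linepath (g0 (-R)) (g1 (-R)))"
       "(F has_contour_integral b) (linepath (g0 R) (g1 R))"
       "((\<lambda>p. F (g0 p) * Complex 1 (d0 p) - F (g1 p) * Complex 1 (d1 p))
          has_integral (a - b + 2 * of_real pi * \<i> * r)) {-R..R}"
      by (rule strip_residueE)
    have len: "norm (g1 p - g0 p) \<le> C" for p
      using le[of p] width[of p] by (simp add: g0_def g1_def cmod_def)
    have bd: "norm x \<le> d * C" if "(F has_contour_integral x) (linepath (g0 p) (g1 p))" "\<bar>p\<bar> \<ge> R0" for x p
    proof -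
      have "norm x \<le> d * norm (g1 p - g0 p)"
        by (rule has_contour_integral_bound_linepath[OF that(1)])
           (use d R0 segment_subset_K[of p] that(2) in auto)
      also have "\<dots> \<le> d * C" using len d by (intro mult_left_mono) auto
      finally show ?thesis .
    qed
    have "norm (a - b) \<le> norm a + norm b" by (rule norm_triangle_ineq4)
    also have "\<dots> \<le> d * C + d * C" using bd[OF *(1)] bd[OF *(2)] elim by (intro add_mono) auto
    also have "d * C \<le> d * (C + 1)" using d by simp
    also have "d * (C + 1) = e / 4" unfolding d_def using C by (simp add: divide_simps)
    also have "e / 4 + e / 4 < e" using e by simp
    finally show ?case using integral_unique[OF *(3)] by (simp add: dist_norm)
  qed
qed

end

subsection \<open>The kernel on the imaginary axis\<close>

definition wallis :: "nat \<Rightarrow> nat \<Rightarrow> real" where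
  "wallis m k = integral {0..pi/2} (\<lambda>t. sin t ^ (2 * m) * cos t ^ (2 * k))"

lemma wallis_has_integral:
  "((\<lambda>t. sin t ^ (2 * m) * cos t ^ (2 * k)) has_integral wallis m k) {0..pi/2}"
  unfolding wallis_def
  by (intro integrable_integral integrable_continuous_real continuous_intros)

lemma wallis_split: "wallis m k = wallis (Suc m) k + wallis m (Suc k)"
proof -
  have eq: "sin t ^ (2 * Suc m) * cos t ^ (2 * k) + sin t ^ (2 * m) * cos t ^ (2 * Suc k)
     = sin t ^ (2 * m) * cos t ^ (2 * k)" for t :: real
  proof -
    have "S * S * A * B + A * (C * C * B) = A * B * (S\<^sup>2 + C\<^sup>2)" for S C A B :: real
      by (simp add: algebra_simps power2_eq_square)
    from this[of "sin t" "sin t ^ (2 * m)" "cos t ^ (2 * k)" "cos t"]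
    show ?thesis by (simp add: mult.assoc)
  qed
  show ?thesis
    using has_integral_add[OF wallis_has_integral[of "Suc m" k] wallis_has_integral[of m "Suc k"]]
      wallis_has_integral[of m k] unfolding eq by (rule has_integral_unique[rotated])
qed

text \<open>Integration by parts: the function
  \<open>sin t ^ (2 * m + 1) * cos t ^ (2 * k + 1)\<close> vanishes at both ends of the
  interval.\<close>

lemma wallis_parts: "(2 * real k + 1) * wallis (Suc m) k = (2 * real m + 1) * wallis m (Suc k)"
proof -
  have "((\<lambda>t. (2 * real m + 1) * (sin t ^ (2 * m) * cos t ^ (2 * Suc k)) -
           (2 * real k + 1) * (sin t ^ (2 * Suc m) * cos t ^ (2 * k))) has_integral
         (sin (pi/2) ^ (2 * m + 1) * cos (pi/2) ^ (2 * k + 1) - sin 0 ^ (2 * m + 1) * cos 0 ^ (2 * k + 1))) {0..pi/2}"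
  proof (rule fundamental_theorem_of_calculus)
    fix t :: real
    show "((\<lambda>t. sin t ^ (2 * m + 1) * cos t ^ (2 * k + 1)) has_vector_derivative
       (2 * real m + 1) * (sin t ^ (2 * m) * cos t ^ (2 * Suc k)) -
           (2 * real k + 1) * (sin t ^ (2 * Suc m) * cos t ^ (2 * k))) (at t within {0..pi/2})"
    proof -
      have "((\<lambda>t. sin t ^ Suc (2 * m)) has_real_derivative ((1 + 2 * real m) * (cos t * sin t ^ (2 * m)))) (at t within {0..pi/2})"
        "((\<lambda>t. cos t ^ Suc (2 * k)) has_real_derivative ((1 + 2 * real k) * (- sin t * cos t ^ (2 * k)))) (at t within {0..pi/2})"
        by (rule DERIV_cong[OF DERIV_power_Suc], (rule derivative_eq_intros refl | simp)+)+
      from DERIV_mult[OF this] show ?thesis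
        by (simp add: algebra_simps has_real_derivative_iff_has_vector_derivative)
    qed
  qed simp
  moreover have "((\<lambda>t. (2 * real m + 1) * (sin t ^ (2 * m) * cos t ^ (2 * Suc k)) -
           (2 * real k + 1) * (sin t ^ (2 * Suc m) * cos t ^ (2 * k))) has_integral
        (2 * real m + 1) * wallis m (Suc k) - (2 * real k + 1) * wallis (Suc m) k) {0..pi/2}"
    by (intro has_integral_diff has_integral_mult_right wallis_has_integral)
  ultimately have "sin (pi/2) ^ (2 * m + 1) * cos (pi/2) ^ (2 * k + 1) - sin 0 ^ (2 * m + 1) * cos 0 ^ (2 * k + 1) =
      (2 * real m + 1) * wallis m (Suc k) - (2 * real k + 1) * wallis (Suc m) k"
    by (rule has_integral_unique)
  thus ?thesis by simp
qed

lemma wallis_Gamma_step: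
  fixes m x g h j :: real
  assumes "x \<ge> 0" "m \<ge> 0" "j > 0"
  shows "(2 * m + 1) / (2 * m + 2 * x + 2) * (g * h / (2 * j)) = (m + 1/2) * g * h / (2 * ((m + x + 1) * j))"
proof -
  have "(2 * m + 1) / (2 * m + 2 * x + 2) = (m + 1/2) / (m + x + 1)"
    using assms by (simp add: field_simps)
  thus ?thesis by (simp only: times_divide_times_eq mult_ac)
qed

text \<open>Together, \<open>wallis_split\<close> and \<open>wallis_parts\<close> give first-order
  recursions that the Gamma quotient satisfies too. The induction runs along \<open>m = 0\<close>
  first, then in \<open>m\<close>.\<close>

lemma wallis_Gamma: "wallis m k = Gamma (real m + 1/2) * Gamma (real k + 1/2) / (2 * Gamma (real m + real k + 1))"
proof -
  have G: "Gamma (real j + 1 + 1/2) = (real j + 1/2) * Gamma (real j + 1/2)" for j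
    using Gamma_plus1[of "real j + 1/2"] by (simp add: add_ac nonpos_Ints_def)
  have G1: "Gamma (real j + 1 + 1) = (real j + 1) * Gamma (real j + 1)" for j
    using Gamma_plus1[of "real j + 1"] by (simp add: add_ac nonpos_Ints_def)
  have pos: "Gamma (real j + 1) > 0" for j by (rule Gamma_real_pos) simp
  have k: "wallis 0 k = Gamma (1/2) * Gamma (real k + 1/2) / (2 * Gamma (real k + 1))" for k
  proof (induction k)
    case 0
    show ?case by (simp add: wallis_def Gamma_one_half_real)
  next
    case (Suc k)
    have "wallis 0 (Suc k) = (2 * real k + 1) / (2 * real k + 2 * 0 + 2) * wallis 0 k"
      using wallis_split[of 0 k] wallis_parts[of k 0] by (simp add: field_simps)
    also have "\<dots> = (2 * real k + 1) / (2 * real k + 2 * 0 + 2) *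
        (Gamma (real k + 1/2) * Gamma (1/2) / (2 * Gamma (real k + 1)))"
      by (simp only: Suc mult.commute)
    also have "\<dots> = (real k + 1/2) * Gamma (real k + 1/2) * Gamma (1/2) / (2 * ((real k + 0 + 1) * Gamma (real k + 1)))"
      by (rule wallis_Gamma_step) (use pos in auto)
    also have "\<dots> = Gamma (1/2) * Gamma (real (Suc k) + 1/2) / (2 * Gamma (real (Suc k) + 1))"
      using G[of k] G1[of k] by (simp add: add_ac)
    finally show ?case .
  qed
  show ?thesis
  proof (induction m)
    case 0 show ?case using k by simp
  next
    case (Suc m)
    have "wallis (Suc m) k = (2 * real m + 1) / (2 * real m + 2 * real k + 2) * wallis m k"
      using wallis_split[of m k] wallis_parts[of k m] by (simp add: field_simps)
    also have "\<dots> = (real m + 1/2) * Gamma (real m + 1/2) * Gamma (real k + 1/2) /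
        (2 * ((real m + real k + 1) * Gamma (real m + real k + 1)))"
      unfolding Suc by (rule wallis_Gamma_step) (use pos[of "m + k"] in auto)
    also have "\<dots> = Gamma (real (Suc m) + 1/2) * Gamma (real k + 1/2) / (2 * Gamma (real (Suc m) + real k + 1))"
      using G[of m] G1[of "m + k"] by (simp add: add_ac)
    finally show ?case .
  qed
qed

section \<open>Integrals with the denominator of the kernel\<close>

definition den :: "real \<Rightarrow> real \<Rightarrow> real \<Rightarrow> real" where
  "den a y t = a\<^sup>2 * (sin t)\<^sup>2 + y\<^sup>2 * (cos t)\<^sup>2"

lemma den_pos: "a > 0 \<Longrightarrow> y > 0 \<Longrightarrow> den a y t > 0"
proof -
  assume "a > 0" "y > 0"
  moreover have "sin t \<noteq> 0 \<or> cos t \<noteq> 0" using sin_zero_abs_cos_one by fastforce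
  ultimately show ?thesis unfolding den_def
    by (auto intro: add_pos_nonneg add_nonneg_pos)
qed

text \<open>With \<open>\<zeta> = a * tan t\<close> one has
  \<open>den a y t = (\<zeta>^2 + y^2) * (cos t)^2\<close>. For positive \<open>a\<close> and
  \<open>y\<close> the integral is therefore \<open>a^(2m+2k-1)\<close> times that of
  \<open>\<zeta>^(2m) / ((a^2 + \<zeta>^2)^(m+k) * (\<zeta>^2 + y^2))\<close> over
  \<open>\<zeta> > 0\<close>. The variable \<open>t\<close> keeps the interval compact.\<close>

definition den_integral :: "real \<Rightarrow> real \<Rightarrow> nat \<Rightarrow> nat \<Rightarrow> real" where
  "den_integral a y m k = integral {0..pi/2} (\<lambda>t. (a * sin t) ^ (2 * m) * cos t ^ (2 * k) / den a y t)"

lemma den_has_integral: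
  assumes "a > 0" "y > 0"
  shows "((\<lambda>t. (a * sin t) ^ (2 * m) * cos t ^ (2 * k) / den a y t) has_integral den_integral a y m k) {0..pi/2}"
  unfolding den_integral_def
proof (intro integrable_integral integrable_continuous_real continuous_intros ballI)
  show "continuous_on {0..pi/2} (den a y)" unfolding den_def by (intro continuous_intros)
  show "den a y t \<noteq> 0" for t using den_pos[OF assms, of t] by simp
qed

lemma den_integral_nonneg:
  assumes "a > 0" "y > 0"
  shows "den_integral a y m k \<ge> 0"
  by (rule has_integral_nonneg[OF den_has_integral[OF assms]])
     (use den_pos[OF assms] in \<open>simp add: less_imp_le\<close>)

lemma den_integral_0:
  assumes a: "a > 0" and y: "y > 0"
  shows "den_integral a y 0 0 = pi / (2 * a * y)"
proof -
  \<comment> \<open>The natural antiderivative \<open>arctan (a * tan t / y)\<close> breaks down at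
    \<open>pi / 2\<close>. Here \<open>u t\<close> is the tangent of its difference to
    \<open>t\<close>, so \<open>t + arctan (u t)\<close> continues it to the endpoint.\<close>
  define u where "u t = (a - y) * sin t * cos t / (y * (cos t)\<^sup>2 + a * (sin t)\<^sup>2)" for t
  have "((\<lambda>t. a * y / den a y t) has_integral ((pi/2 + arctan (u (pi/2))) - (0 + arctan (u 0)))) {0..pi/2}"
  proof (rule fundamental_theorem_of_calculus)
    fix t :: real
    define s c where "s = sin t" and "c = cos t"
    have sc: "s\<^sup>2 + c\<^sup>2 = 1" by (simp add: s_def c_def)
    define e where "e = y * c\<^sup>2 + a * s\<^sup>2"
    have e: "e > 0" unfolding e_def
    proof (cases "s = 0")
      case True thus "y * c\<^sup>2 + a * s\<^sup>2 > 0" using sc y by simp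
    next
      case False thus "y * c\<^sup>2 + a * s\<^sup>2 > 0" using a y by (intro add_nonneg_pos) auto
    qed
    define d where "d = a\<^sup>2 * s\<^sup>2 + y\<^sup>2 * c\<^sup>2"
    have d: "d > 0" using den_pos[OF a y, of t] by (simp add: d_def den_def s_def c_def)
    have du: "(u has_real_derivative (a - y) * ((c\<^sup>2 - s\<^sup>2) * e - s * c * (2 * (a - y) * s * c)) / e\<^sup>2) (at t within {0..pi/2})"
      unfolding u_def using e
      by (auto intro!: derivative_eq_intros simp: s_def[symmetric] c_def[symmetric] e_def[symmetric])
         (simp add: field_simps power2_eq_square)
    have "(a - y) * ((c\<^sup>2 - s\<^sup>2) * e - s * c * (2 * (a - y) * s * c)) = (a - y) * (y * c\<^sup>2 - a * s\<^sup>2)"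
    proof -
      have "(c\<^sup>2 - s\<^sup>2) * e - s * c * (2 * (a - y) * s * c) = (y * c\<^sup>2 - a * s\<^sup>2) * (s\<^sup>2 + c\<^sup>2)"
        unfolding e_def by (simp add: algebra_simps power2_eq_square)
      thus ?thesis by (simp add: sc)
    qed
    with du have du': "(u has_real_derivative (a - y) * (y * c\<^sup>2 - a * s\<^sup>2) / e\<^sup>2) (at t within {0..pi/2})"
      by (simp only:)
    have u2: "1 + (u t)\<^sup>2 = d / e\<^sup>2"
    proof -
      have "e\<^sup>2 + ((a - y) * s * c)\<^sup>2 = d * (s\<^sup>2 + c\<^sup>2)"
        unfolding e_def d_def by (simp add: algebra_simps power2_eq_square)
      hence "e\<^sup>2 + ((a - y) * s * c)\<^sup>2 = d" by (simp add: sc)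
      have ut: "u t = (a - y) * s * c / e" by (simp add: u_def s_def c_def e_def)
      have "1 + (u t)\<^sup>2 = (e\<^sup>2 + ((a - y) * s * c)\<^sup>2) / e\<^sup>2"
        using e unfolding ut power_divide add_divide_distrib by simp
      thus ?thesis by (simp only: \<open>e\<^sup>2 + ((a - y) * s * c)\<^sup>2 = d\<close>)
    qed
    have fin: "1 + (a - y) * (y * c\<^sup>2 - a * s\<^sup>2) / e\<^sup>2 / (1 + (u t)\<^sup>2) = a * y / d"
    proof -
      have "d + (a - y) * (y * c\<^sup>2 - a * s\<^sup>2) = a * y * (s\<^sup>2 + c\<^sup>2)"
        unfolding d_def by (simp add: algebra_simps power2_eq_square)
      hence "d + (a - y) * (y * c\<^sup>2 - a * s\<^sup>2) = a * y" by (simp add: sc)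
      hence "(d + (a - y) * (y * c\<^sup>2 - a * s\<^sup>2)) / d = a * y / d" by (simp only:)
      thus ?thesis unfolding u2 add_divide_distrib using d e by simp
    qed
    have "((\<lambda>t. t + arctan (u t)) has_real_derivative (a * y / d)) (at t within {0..pi/2})"
      unfolding fin[symmetric] by (auto intro!: derivative_eq_intros du' simp: divide_simps)
    thus "((\<lambda>t. t + arctan (u t)) has_vector_derivative (a * y / den a y t)) (at t within {0..pi/2})"
      by (simp add: has_real_derivative_iff_has_vector_derivative d_def den_def s_def c_def)
  qed simp
  hence "((\<lambda>t. a * y * (1 / den a y t)) has_integral pi/2) {0..pi/2}"
    by (simp add: u_def)
  moreover have "((\<lambda>t. a * y * (1 / den a y t)) has_integral a * y * den_integral a y 0 0) {0..pi/2}"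
    using den_has_integral[OF a y, of 0 0] by (intro has_integral_mult_right) simp
  ultimately have "a * y * den_integral a y 0 0 = pi/2"
    by (rule has_integral_unique[rotated])
  thus ?thesis using a y by (simp add: field_simps)
qed

text \<open>Replacing \<open>y^2 * (cos t)^2\<close> by \<open>den a y t - (a * sin t)^2\<close>
  trades a power of the cosine for one of the sine. Iterated, this yields the expansion in inverse
  powers of \<open>y\<close> with its exact remainder.\<close>

lemma den_integral_shift:
  assumes a: "a > 0" and y: "y > 0"
  shows "y\<^sup>2 * den_integral a y m (Suc k) = a ^ (2 * m) * wallis m k - den_integral a y (Suc m) k"
proof -
  have "((\<lambda>t. y\<^sup>2 * ((a * sin t) ^ (2 * m) * cos t ^ (2 * Suc k) / den a y t) +
      (a * sin t) ^ (2 * Suc m) * cos t ^ (2 * k) / den a y t) has_integral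
      y\<^sup>2 * den_integral a y m (Suc k) + den_integral a y (Suc m) k) {0..pi/2}"
    by (intro has_integral_add has_integral_mult_right den_has_integral assms)
  moreover have "y\<^sup>2 * ((a * sin t) ^ (2 * m) * cos t ^ (2 * Suc k) / den a y t) +
      (a * sin t) ^ (2 * Suc m) * cos t ^ (2 * k) / den a y t = a ^ (2 * m) * (sin t ^ (2 * m) * cos t ^ (2 * k))" for t
  proof -
    have "y\<^sup>2 * ((a * sin t) ^ (2 * m) * cos t ^ (2 * Suc k) / den a y t) +
      (a * sin t) ^ (2 * Suc m) * cos t ^ (2 * k) / den a y t =
      (a * sin t) ^ (2 * m) * cos t ^ (2 * k) * den a y t / den a y t"
      by (simp add: den_def add_divide_distrib[symmetric] power2_eq_square algebra_simps)
    thus ?thesis using den_pos[OF assms, of t] by (simp add: power_mult_distrib)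
  qed
  ultimately have "((\<lambda>t. a ^ (2 * m) * (sin t ^ (2 * m) * cos t ^ (2 * k))) has_integral
      y\<^sup>2 * den_integral a y m (Suc k) + den_integral a y (Suc m) k) {0..pi/2}" by simp
  moreover have "((\<lambda>t. a ^ (2 * m) * (sin t ^ (2 * m) * cos t ^ (2 * k))) has_integral a ^ (2 * m) * wallis m k) {0..pi/2}"
    by (intro has_integral_mult_right wallis_has_integral)
  ultimately have "y\<^sup>2 * den_integral a y m (Suc k) + den_integral a y (Suc m) k = a ^ (2 * m) * wallis m k"
    by (rule has_integral_unique)
  thus ?thesis by simp
qed

text \<open>Eliminating the sine from \<open>den_integral_shift\<close> leaves a recursion in
  \<open>k\<close> alone. Its left side vanishes at \<open>y = a\<close>, which is where the
  diagonal value comes from.\<close>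

lemma den_integral_Suc:
  assumes a: "a > 0" and y: "y > 0"
  shows "(y\<^sup>2 - a\<^sup>2) * den_integral a y 0 (Suc k) = wallis 0 k - a\<^sup>2 * den_integral a y 0 k"
proof -
  have "((\<lambda>t. (a * sin t) ^ (2 * Suc 0) * cos t ^ (2 * k) / den a y t) has_integral
     a\<^sup>2 * den_integral a y 0 k - a\<^sup>2 * den_integral a y 0 (Suc k)) {0..pi/2}"
  proof (rule has_integral_eq)
    show "((\<lambda>t. a\<^sup>2 * ((a * sin t) ^ (2 * 0) * cos t ^ (2 * k) / den a y t) -
        a\<^sup>2 * ((a * sin t) ^ (2 * 0) * cos t ^ (2 * Suc k) / den a y t)) has_integral
     a\<^sup>2 * den_integral a y 0 k - a\<^sup>2 * den_integral a y 0 (Suc k)) {0..pi/2}"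
      by (intro has_integral_diff has_integral_mult_right den_has_integral assms)
    fix t
    have "a\<^sup>2 * cos t ^ (2 * k) - a\<^sup>2 * cos t ^ (2 * Suc k) = (a * sin t)\<^sup>2 * cos t ^ (2 * k)"
      by (simp add: power_mult_distrib sin_squared_eq) (simp add: algebra_simps power2_eq_square)
    thus "a\<^sup>2 * ((a * sin t) ^ (2 * 0) * cos t ^ (2 * k) / den a y t) -
        a\<^sup>2 * ((a * sin t) ^ (2 * 0) * cos t ^ (2 * Suc k) / den a y t) =
        (a * sin t) ^ (2 * Suc 0) * cos t ^ (2 * k) / den a y t"
      by (simp add: diff_divide_distrib[symmetric] power2_eq_square)
  qed
  hence "den_integral a y (Suc 0) k = a\<^sup>2 * den_integral a y 0 k - a\<^sup>2 * den_integral a y 0 (Suc k)"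
    using den_has_integral[OF a y, of "Suc 0" k] has_integral_unique by blast
  with den_integral_shift[OF a y, of 0 k] show ?thesis by (simp add: algebra_simps)
qed

lemma den_integral_diag:
  assumes a: "a > 0" shows "a\<^sup>2 * den_integral a a 0 k = wallis 0 k"
  using den_integral_Suc[OF a a, of k] by simp

lemma den_integral_continuous:
  assumes a: "a > 0" shows "continuous_on {0<..} (\<lambda>y. den_integral a y m k)"
proof -
  have "continuous_on ({0<..} \<times> cbox 0 (pi/2)) (\<lambda>(y, t). (a * sin t) ^ (2 * m) * cos t ^ (2 * k) / den a y t)"
    unfolding split_beta den_def
  proof (intro continuous_intros ballI)
    fix x assume "x \<in> {0::real<..} \<times> cbox 0 (pi/2)"
    thus "a\<^sup>2 * (sin (snd x))\<^sup>2 + (fst x)\<^sup>2 * (cos (snd x))\<^sup>2 \<noteq> 0"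
      using den_pos[OF a, of "fst x" "snd x"] by (auto simp: den_def)
  qed
  from integral_continuous_on_param[OF this] show ?thesis
    by (simp add: den_integral_def cbox_interval)
qed

text \<open>
  With \<open>\<zeta> = a tan t\<close> this is \<open>y/\<pi>\<close> times the integral over \<open>0 < \<zeta> < \<infinity>\<close> of
  \<open>1 / ((a\<^sup>2 + \<zeta>\<^sup>2)\<^sup>N (\<zeta>\<^sup>2 + y\<^sup>2))\<close>. As a rational function of \<open>y\<close> it is the principal part at \<open>y = -a\<close>
  of \<open>1 / (a\<^sup>2 - y\<^sup>2)\<^sup>N\<close>.
\<close>

definition half_kernel :: "real \<Rightarrow> nat \<Rightarrow> real \<Rightarrow> real" where
  "half_kernel a N y = y * a / (pi * a ^ (2 * N)) * den_integral a y 0 N"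

section \<open>The half kernel as a rational function and its enveloping expansion\<close>

lemma half_kernel_Suc:
  assumes a: "a > 0" and y: "y > 0"
  shows "(y\<^sup>2 - a\<^sup>2) * half_kernel a (Suc N) y = y * (wallis 0 N / (pi * a * a ^ (2 * N))) - half_kernel a N y"
proof -
  have "(y\<^sup>2 - a\<^sup>2) * half_kernel a (Suc N) y = y * a / (pi * a ^ (2 * Suc N)) * ((y\<^sup>2 - a\<^sup>2) * den_integral a y 0 (Suc N))"
    by (simp add: half_kernel_def)
  also have "\<dots> = y * a / (pi * a ^ (2 * Suc N)) * (wallis 0 N - a\<^sup>2 * den_integral a y 0 N)"
    by (simp only: den_integral_Suc[OF a y])
  also have "\<dots> = y * (wallis 0 N / (pi * a * a ^ (2 * N))) - half_kernel a N y"
    using a y by (simp add: half_kernel_def field_simps power2_eq_square)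
  finally show ?thesis .
qed

lemma half_kernel_diag:
  assumes a: "a > 0"
  shows "half_kernel a N a = a * (wallis 0 N / (pi * a * a ^ (2 * N)))"
  using den_integral_diag[OF a, of N] a by (simp add: half_kernel_def power2_eq_square field_simps)

lemma half_kernel_continuous:
  assumes a: "a > 0" shows "continuous_on {0<..} (half_kernel a N)"
  unfolding half_kernel_def using a by (intro continuous_intros den_integral_continuous) auto

text \<open>The second claim is the partial fraction decomposition of
  \<open>1 / (a^2 - z^2) ^ N\<close>, cleared of denominators; the third identifies
  \<open>half_kernel\<close> with the part at \<open>- a\<close>. The degree bound will give decay
  at infinity. The induction follows \<open>half_kernel_Suc\<close>, dividing by
  \<open>y^2 - a^2\<close> at each step.\<close>

lemma half_kernel_rational:
  assumes a: "a > 0"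
  obtains p :: "complex poly" where "degree p \<le> N - 1"
    "\<And>z. poly p z * (of_real a - z) ^ N + poly p (-z) * (of_real a + z) ^ N = 1"
    "\<And>y. y > 0 \<Longrightarrow> of_real (half_kernel a N y) = poly p (of_real y) / (of_real y + of_real a) ^ N"
proof -
  let ?a = "complex_of_real a"
  have "\<exists>p :: complex poly. degree p \<le> N - 1 \<and>
    (\<forall>z. poly p z * (?a - z) ^ N + poly p (-z) * (?a + z) ^ N = 1) \<and>
    (\<forall>y>0. of_real (half_kernel a N y) = poly p (of_real y) / (of_real y + ?a) ^ N)"
  proof (induction N)
    case 0
    show ?case
      \<comment> \<open>For \<open>N = 0\<close> the kernel is the constant \<open>1 / 2\<close>, by
        \<open>den_integral_0\<close>, and \<open>N - 1\<close> stands for \<open>0\<close>.\<close>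
      using a by (intro exI[of _ "[:1/2:]"]) (simp add: half_kernel_def den_integral_0)
  next
    case (Suc N)
    then obtain p where p: "degree p \<le> N - 1"
      "\<And>z. poly p z * (?a - z) ^ N + poly p (-z) * (?a + z) ^ N = 1"
      "\<And>y. y > 0 \<Longrightarrow> of_real (half_kernel a N y) = poly p (of_real y) / (of_real y + ?a) ^ N" by blast
    define k where "k = wallis 0 N / (pi * a * a ^ (2 * N))"
    define r where "r = [:0, of_real k:] * [:?a, 1:] ^ N - p"
    have ne: "of_real y + ?a \<noteq> 0" if "y > 0" for y
      using a that by (metis add_pos_pos less_irrefl of_real_add of_real_eq_0_iff)
    \<comment> \<open>The diagonal value says that the right side of the recursion vanishes at
      \<open>a\<close>, so the factor \<open>z - a\<close> can be divided out.\<close>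
    have "poly r ?a = 0"
    proof -
      have "of_real (half_kernel a N a) = poly p ?a / (?a + ?a) ^ N" using p(3)[OF a] .
      hence "poly p ?a = of_real (a * k) * (?a + ?a) ^ N"
        using ne[OF a] half_kernel_diag[OF a, of N] unfolding k_def[symmetric] by (simp add: field_simps)
      thus ?thesis by (simp add: r_def)
    qed
    then obtain q where q: "r = [:-?a, 1:] * q" unfolding poly_eq_0_iff_dvd by (auto elim: dvdE)
    have rq: "poly q z * (z - ?a) = z * of_real k * (z + ?a) ^ N - poly p z" for z
      using arg_cong[OF q, of "\<lambda>r. poly r z"] by (simp add: r_def algebra_simps)
    have deg: "degree q \<le> N"
    proof (cases "q = 0")
      case False
      have "degree ([:0, of_real k:] * [:?a, 1:] ^ N :: complex poly) \<le> 1 + N"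
        by (rule order.trans[OF degree_mult_le]) (simp add: degree_linear_power)
      hence "degree r \<le> 1 + N" unfolding r_def
        using p(1) by (intro degree_diff_le) auto
      moreover have "degree r = 1 + degree q" unfolding q using False by (subst degree_mult_eq) auto
      ultimately show ?thesis by simp
    qed simp
    \<comment> \<open>The contributions of \<open>k\<close> at \<open>z\<close> and at
      \<open>- z\<close> cancel, so the identity passes from \<open>p\<close> to
      \<open>q\<close>.\<close>
    have sym: "poly q z * (?a - z) ^ Suc N + poly q (-z) * (?a + z) ^ Suc N = 1" for z
    proof -
      have "poly q z * (?a - z) ^ Suc N + poly q (-z) * (?a + z) ^ Suc N =
        - (poly q z * (z - ?a)) * (?a - z) ^ N - (poly q (-z) * (-z - ?a)) * (?a + z) ^ N"
        by (simp add: algebra_simps)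
      also have "\<dots> = poly p z * (?a - z) ^ N + poly p (-z) * (?a + z) ^ N"
        unfolding rq by (simp add: algebra_simps)
      finally show ?thesis using p(2) by simp
    qed
    have off: "of_real (half_kernel a (Suc N) y) = poly q (of_real y) / (of_real y + ?a) ^ Suc N"
      if y: "y > 0" "y \<noteq> a" for y
    proof -
      let ?y = "complex_of_real y"
      have ya: "?y - ?a \<noteq> 0" using y by simp
      have "(?y\<^sup>2 - ?a\<^sup>2) * of_real (half_kernel a (Suc N) y) = ?y * of_real k - of_real (half_kernel a N y)"
        using arg_cong[OF half_kernel_Suc[OF a y(1), of N], of complex_of_real] by (simp add: k_def)
      also have "\<dots> = (?y * of_real k * (?y + ?a) ^ N - poly p ?y) / (?y + ?a) ^ N"
        using p(3)[OF y(1)] ne[OF y(1)] by (simp add: field_simps)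
      also have "\<dots> = poly q ?y * (?y - ?a) / (?y + ?a) ^ N" by (simp only: rq)
      finally have "(?y - ?a) * ((?y + ?a) * of_real (half_kernel a (Suc N) y)) = (?y - ?a) * (poly q ?y / (?y + ?a) ^ N)"
        by (simp add: power2_eq_square algebra_simps)
      hence "(?y + ?a) * of_real (half_kernel a (Suc N) y) = poly q ?y / (?y + ?a) ^ N"
        using ya by (metis mult_left_cancel)
      hence "of_real (half_kernel a (Suc N) y) = poly q ?y / (?y + ?a) ^ N / (?y + ?a)"
        using ne[OF y(1)] by (metis nonzero_mult_div_cancel_left)
      thus ?thesis by (simp add: mult.commute)
    qed
    \<comment> \<open>At \<open>y = a\<close> the recursion determines nothing; the value follows by
      continuity of both sides.\<close>
    have diag: "of_real (half_kernel a (Suc N) a) = poly q ?a / (?a + ?a) ^ Suc N"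
    proof -
      have 1: "((\<lambda>y. complex_of_real (half_kernel a (Suc N) y)) \<longlongrightarrow> of_real (half_kernel a (Suc N) a)) (at a)"
        using half_kernel_continuous[OF a, of "Suc N"] a
        by (intro tendsto_intros) (simp add: continuous_on_eq_continuous_at isCont_def)
      have 2: "((\<lambda>y. poly q (of_real y) / (of_real y + ?a) ^ Suc N) \<longlongrightarrow> poly q ?a / (?a + ?a) ^ Suc N) (at a)"
        using ne[OF a] by (intro tendsto_intros) auto
      have 3: "\<forall>\<^sub>F y in at a. complex_of_real (half_kernel a (Suc N) y) = poly q (of_real y) / (of_real y + ?a) ^ Suc N"
      proof -
        have "\<forall>\<^sub>F y in at a. y \<in> {0<..} \<and> y \<noteq> a"
          using a eventually_at_in_open'[of "{0<..}" a] by (auto simp: eventually_conj_iff eventually_neq_at_within)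
        thus ?thesis by eventually_elim (use off in auto)
      qed
      show ?thesis
        using tendsto_unique[OF trivial_limit_at 1 tendsto_cong[OF 3, THEN iffD2, OF 2]] .
    qed
    have "of_real (half_kernel a (Suc N) y) = poly q (of_real y) / (of_real y + ?a) ^ Suc N" if "y > 0" for y
      using off[OF that] diag by (cases "y = a") (auto simp del: power_Suc)
    thus ?case using deg sym by (intro exI[of _ q]) (simp del: power_Suc)
  qed
  thus thesis using that by blast
qed

text \<open>For \<open>m < N\<close> and \<open>\<zeta> = a * tan t\<close> this is
  \<open>1 / pi\<close> times the integral of \<open>\<zeta>^(2m) / (a^2 + \<zeta>^2)^N\<close> over
  \<open>\<zeta> > 0\<close>: up to sign, the coefficient that the geometric series of
  \<open>y / (\<zeta>^2 + y^2)\<close> produces.\<close>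

definition half_kernel_moment :: "real \<Rightarrow> nat \<Rightarrow> nat \<Rightarrow> real" where
  "half_kernel_moment a N m = a / (pi * a ^ (2 * N)) * (a ^ (2 * m) * wallis m (N - m - 1))"

text \<open>The geometric expansion ends in an exact remainder, \<open>(-1) ^ M\<close> times a
  nonnegative integral. One more use of \<open>den_integral_shift\<close>, with a nonnegative term
  dropped, bounds it by the first omitted term.\<close>

lemma half_kernel_enveloped:
  assumes a: "a > 0" and y: "y > 0" and M: "M < N"
  shows "\<bar>half_kernel a N y - (\<Sum>m<M. (-1) ^ m * half_kernel_moment a N m / y ^ (2 * m + 1))\<bar>
    \<le> half_kernel_moment a N M / y ^ (2 * M + 1)"
proof -
  define C where "C = a / (pi * a ^ (2 * N))"
  have C: "C \<ge> 0" unfolding C_def using a by simp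
  have eq: "half_kernel a N y = (\<Sum>m<M. (-1) ^ m * half_kernel_moment a N m / y ^ (2 * m + 1)) +
      (-1) ^ M * C * y * den_integral a y M (N - M) / y ^ (2 * M)" if "M \<le> N" for M
    using that
  proof (induction M)
    case 0
    show ?case by (simp add: half_kernel_def C_def)
  next
    case (Suc M)
    hence NM: "N - M = Suc (N - M - 1)" "N - M - 1 = N - Suc M" by auto
    have "y\<^sup>2 * den_integral a y M (N - M) = a ^ (2 * M) * wallis M (N - M - 1) - den_integral a y (Suc M) (N - Suc M)"
      using den_integral_shift[OF a y, of M "N - M - 1"] NM by simp
    hence sh: "den_integral a y M (N - M) = (a ^ (2 * M) * wallis M (N - M - 1) - den_integral a y (Suc M) (N - Suc M)) / y\<^sup>2"
      using y by (simp add: field_simps)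
    have "half_kernel a N y = (\<Sum>m<M. (-1) ^ m * half_kernel_moment a N m / y ^ (2 * m + 1)) +
      (-1) ^ M * C * y * ((a ^ (2 * M) * wallis M (N - M - 1) - den_integral a y (Suc M) (N - Suc M)) / y\<^sup>2) / y ^ (2 * M)"
      using Suc by (simp add: sh)
    also have "(-1) ^ M * C * y * ((a ^ (2 * M) * wallis M (N - M - 1) - den_integral a y (Suc M) (N - Suc M)) / y\<^sup>2) / y ^ (2 * M)
      = (-1) ^ M * half_kernel_moment a N M / y ^ (2 * M + 1) +
        (-1) ^ Suc M * C * y * den_integral a y (Suc M) (N - Suc M) / y ^ (2 * Suc M)"
      using y unfolding half_kernel_moment_def C_def[symmetric] by (simp add: field_simps power2_eq_square)
    finally show ?case by simp
  qed
  have NM: "N - M = Suc (N - M - 1)" using M by auto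
  have "y\<^sup>2 * den_integral a y M (N - M) \<le> a ^ (2 * M) * wallis M (N - M - 1)"
    using den_integral_shift[OF a y, of M "N - M - 1"] NM den_integral_nonneg[OF a y, of "Suc M" "N - M - 1"] by simp
  hence le: "den_integral a y M (N - M) \<le> a ^ (2 * M) * wallis M (N - M - 1) / y\<^sup>2"
    using y by (simp add: field_simps)
  have "half_kernel a N y - (\<Sum>m<M. (-1) ^ m * half_kernel_moment a N m / y ^ (2 * m + 1)) =
     (-1) ^ M * (C * y * den_integral a y M (N - M) / y ^ (2 * M))"
    using eq[of M] M by simp
  hence "\<bar>half_kernel a N y - (\<Sum>m<M. (-1) ^ m * half_kernel_moment a N m / y ^ (2 * m + 1))\<bar> =
      C * y * den_integral a y M (N - M) / y ^ (2 * M)"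
    using C y den_integral_nonneg[OF a y, of M "N - M"] by (simp add: abs_mult)
  also have "\<dots> \<le> C * y * (a ^ (2 * M) * wallis M (N - M - 1) / y\<^sup>2) / y ^ (2 * M)"
    using C y by (intro divide_right_mono mult_left_mono le) auto
  also have "\<dots> = half_kernel_moment a N M / y ^ (2 * M + 1)"
    using y unfolding half_kernel_moment_def C_def[symmetric] by (simp add: field_simps power2_eq_square)
  finally show ?thesis .
qed

subsection \<open>The phase function and its steepest descent curves\<close>

lemma Re_sinh: "Re (sinh w) = sinh (Re w) * cos (Im w)"
  and Im_sinh: "Im (sinh w) = cosh (Re w) * sin (Im w)"
  by (simp_all add: sinh_def cosh_def Re_exp Im_exp algebra_simps)

lemma sinh_le_cosh_mult: "x \<ge> 0 \<Longrightarrow> sinh x \<le> x * cosh (x :: real)"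
proof -
  assume x: "x \<ge> 0"
  have "0 * cosh 0 - sinh 0 \<le> x * cosh x - sinh x"
  proof (rule DERIV_nonneg_imp_nondecreasing[OF x])
    fix t :: real assume t: "0 \<le> t"
    have "((\<lambda>t. t * cosh t - sinh t) has_real_derivative t * sinh t) (at t)"
      by (auto intro!: derivative_eq_intros)
    thus "\<exists>y. ((\<lambda>t. t * cosh t - sinh t) has_real_derivative y) (at t) \<and> 0 \<le> y"
      using t by (intro exI[of _ "t * sinh t"]) auto
  qed
  thus ?thesis by simp
qed

lemma half_le_sinh_minus: "x \<ge> 4 \<Longrightarrow> x / 2 \<le> sinh x - (x :: real)"
proof -
  assume x: "x \<ge> 4"
  have 1: "1 + x + x\<^sup>2 / 2 \<le> exp x" using x by (intro exp_lower_Taylor_quadratic) auto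
  have 2: "exp (-x) \<le> 1" using x by simp
  have 3: "4 * x \<le> x\<^sup>2" using x by (simp add: power2_eq_square)
  have "2 * sinh x = exp x - exp (-x)" by (simp add: sinh_def)
  moreover have "1 + 3 * x \<le> exp x" using 1 3 by (simp add: field_simps)
  ultimately show ?thesis using 2 by linarith
qed

lemma norm_sinh_ge: "sinh \<bar>Re w\<bar> \<le> norm (sinh w)"
proof -
  have *: "sinh (Re w) \<le> norm (sinh w)" for w :: complex
  proof -
    have "norm (exp w) - norm (exp (-w)) \<le> norm (exp w - exp (-w))" by (rule norm_triangle_ineq2)
    thus ?thesis by (simp add: sinh_def)
  qed
  show ?thesis using *[of w] *[of "-w"] by (cases "Re w \<ge> 0") auto
qed

lemma cos_less_of_between:
  assumes "0 \<le> q" "q \<le> pi" "q < y" "y < 2 * pi - q"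
  shows "cos y < cos q"
proof (cases "y \<le> pi")
  case True thus ?thesis using assms by (intro cos_monotone_0_pi) auto
next
  case False
  have "cos (2 * pi - y) < cos q" using False assms by (intro cos_monotone_0_pi) auto
  thus ?thesis by simp
qed

lemma cos_less_of_abs_less:
  assumes "q \<le> pi" "\<bar>y\<bar> < q"
  shows "cos q < cos y"
  using cos_monotone_0_pi[of "\<bar>y\<bar>" q] assms by simp

definition sinhc_inv :: "real \<Rightarrow> real" where
  "sinhc_inv p = (if p = 0 then 1 else p / sinh p)"

lemma sinhc_inv_minus [simp]: "sinhc_inv (-p) = sinhc_inv p"
  by (simp add: sinhc_inv_def)

lemma sinhc_inv_pos: "sinhc_inv p > 0"
  by (auto simp: sinhc_inv_def zero_less_divide_iff linorder_neq_iff)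

lemma sinhc_inv_lt_1: "p \<noteq> 0 \<Longrightarrow> sinhc_inv p < 1"
proof -
  have *: "sinhc_inv p < 1" if "p > 0" for p
  proof -
    have "0 - sinh 0 > p - sinh p"
    proof (rule DERIV_neg_imp_decreasing_open[OF that])
      fix t :: real assume t: "0 < t"
      have "((\<lambda>t. t - sinh t) has_real_derivative 1 - cosh t) (at t)"
        by (auto intro!: derivative_eq_intros)
      moreover have "cosh t > 1" using t cosh_real_strict_mono[of 0 t] by simp
      ultimately show "\<exists>y. ((\<lambda>t. t - sinh t) has_real_derivative y) (at t) \<and> y < 0"
        by (intro exI[of _ "1 - cosh t"]) auto
    qed (intro continuous_intros)
    thus ?thesis using that by (simp add: sinhc_inv_def)
  qed
  assume "p \<noteq> 0" thus ?thesis using *[of p] *[of "-p"] by (cases "p > 0") auto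
qed

lemma sinhc_inv_le_1: "sinhc_inv p \<le> 1"
  using sinhc_inv_lt_1[of p] by (cases "p = 0") (auto simp: sinhc_inv_def)

lemma cosh_gt_1: "p \<noteq> 0 \<Longrightarrow> 1 < cosh (p :: real)"
  using cosh_real_strict_mono[of 0 "\<bar>p\<bar>"] by (cases "p < 0") auto

lemma cosh_mult_sinhc_inv_ge: "1 \<le> cosh p * sinhc_inv p"
proof -
  have *: "1 \<le> cosh p * sinhc_inv p" if "p > 0" for p
    using sinh_le_cosh_mult[of p] that by (simp add: sinhc_inv_def field_simps)
  show ?thesis using *[of p] *[of "-p"] by (cases "p = 0") (auto simp: sinhc_inv_def linorder_neq_iff)
qed

lemma sinh_mult_sinhc_inv: "sinh p * sinhc_inv p = p"
  by (simp add: sinhc_inv_def)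

lemma sinhc_inv_deriv:
  "p \<noteq> 0 \<Longrightarrow> (sinhc_inv has_real_derivative (sinh p - p * cosh p) / (sinh p)\<^sup>2) (at p)"
proof -
  assume p: "p \<noteq> 0"
  have "((\<lambda>p. p / sinh p) has_real_derivative (sinh p - p * cosh p) / (sinh p)\<^sup>2) (at p)"
    using p by (auto intro!: derivative_eq_intros simp: power2_eq_square)
  moreover have "\<forall>\<^sub>F x in nhds p. x / sinh x = sinhc_inv x"
    using t1_space_nhds[OF p] by (auto simp: sinhc_inv_def elim: eventually_mono)
  ultimately show ?thesis by (simp only: DERIV_cong_ev[OF refl _ refl])
qed

lemma sinhc_inv_cont: "isCont sinhc_inv p"
proof (cases "p = 0")
  case False thus ?thesis using sinhc_inv_deriv DERIV_isCont by blast
next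
  case True
  have "((\<lambda>x. inverse (sinh x / x)) \<longlongrightarrow> inverse 1) (at (0 :: real))"
  proof (intro tendsto_inverse)
    have "(sinh has_real_derivative 1) (at 0)" by (auto intro!: derivative_eq_intros)
    thus "((\<lambda>x. sinh x / x) \<longlongrightarrow> 1) (at (0 :: real))" by (simp add: DERIV_def)
  qed simp
  moreover have "\<forall>\<^sub>F x in at (0 :: real). inverse (sinh x / x) = sinhc_inv x"
    by (auto simp: eventually_at_filter sinhc_inv_def)
  ultimately have "(sinhc_inv \<longlongrightarrow> 1) (at 0)"
    using Lim_transform_eventually by fastforce
  thus ?thesis using True by (simp add: isCont_def sinhc_inv_def)
qed

section \<open>The phase function on the imaginary axis and on the curves\<close>

locale debye =
  fixes \<beta> :: real
  assumes beta_pos: "0 < \<beta>" and beta_less: "\<beta> < pi / 2"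
begin

definition sigma :: real where "sigma = tan \<beta> - \<beta>"
definition f :: "complex \<Rightarrow> complex" where "f w = sinh w / of_real (cos \<beta>) - w"
definition S :: "complex \<Rightarrow> complex" where "S w = - \<i> * f w - of_real sigma"
definition q :: "real \<Rightarrow> real" where "q p = arccos (cos \<beta> * sinhc_inv p)"
definition dq :: "real \<Rightarrow> real" where
  "dq p = cos \<beta> * ((sinh p - p * cosh p) / (sinh p)\<^sup>2) * - inverse (sqrt (1 - (cos \<beta> * sinhc_inv p)\<^sup>2))"
text \<open>The real value of \<open>- \<i> * f\<close> on the path \<open>Im w = q (Re w)\<close>
  through the saddle.\<close>

definition height :: "real \<Rightarrow> real" where "height p = cosh p * sin (q p) / cos \<beta> - q p"
abbreviation saddle :: complex where "saddle \<equiv> Complex 0 \<beta>"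

lemma cos_pos: "cos \<beta> > 0" and cos_less_1: "cos \<beta> < 1" and sin_pos: "sin \<beta> > 0"
  using beta_pos beta_less cos_monotone_0_pi[of 0 \<beta>] by (auto intro: cos_gt_zero sin_gt_zero)

lemma tan_pos: "tan \<beta> > 0" using beta_pos beta_less by (rule tan_gt_zero)

text \<open>The function is \<open>- \<i> * f\<close> on the imaginary axis, with derivative
  \<open>cos t / cos \<beta> - 1\<close>, positive for \<open>\<bar>t\<bar> < \<beta>\<close>. With
  the decreasing stretch that follows, \<open>sigma\<close> becomes a strict maximum at the
  saddle.\<close>

lemma axis_increasing:
  assumes "-\<beta> \<le> x" "x < y" "y \<le> \<beta>"
  shows "sin x / cos \<beta> - x < sin y / cos \<beta> - y"
proof (rule DERIV_pos_imp_increasing_open[OF assms(2)])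
  fix t assume t: "x < t" "t < y"
  have "cos \<beta> < cos t" using t assms beta_less by (intro cos_less_of_abs_less) auto
  moreover have "((\<lambda>t. sin t / cos \<beta> - t) has_real_derivative cos t / cos \<beta> - 1) (at t)"
    using cos_pos by (auto intro!: derivative_eq_intros)
  ultimately show "\<exists>z. ((\<lambda>t. sin t / cos \<beta> - t) has_real_derivative z) (at t) \<and> 0 < z"
    using cos_pos by (intro exI[of _ "cos t / cos \<beta> - 1"]) auto
qed (use cos_pos in \<open>auto intro!: continuous_intros\<close>)

lemma axis_decreasing:
  assumes "\<beta> \<le> x" "x < y" "y \<le> 2 * pi - \<beta>"
  shows "sin y / cos \<beta> - y < sin x / cos \<beta> - x"
proof (rule DERIV_neg_imp_decreasing_open[OF assms(2)])
  fix t assume t: "x < t" "t < y"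
  have "cos t < cos \<beta>" using t assms beta_less beta_pos by (intro cos_less_of_between) auto
  moreover have "((\<lambda>t. sin t / cos \<beta> - t) has_real_derivative cos t / cos \<beta> - 1) (at t)"
    using cos_pos by (auto intro!: derivative_eq_intros)
  ultimately show "\<exists>z. ((\<lambda>t. sin t / cos \<beta> - t) has_real_derivative z) (at t) \<and> z < 0"
    using cos_pos by (intro exI[of _ "cos t / cos \<beta> - 1"]) auto
qed (use cos_pos in \<open>auto intro!: continuous_intros\<close>)

lemma sigma_eq: "sigma = sin \<beta> / cos \<beta> - \<beta>" by (simp add: sigma_def tan_def)

lemma sigma_pos: "sigma > 0"
  using axis_increasing[of 0 \<beta>] beta_pos by (simp add: sigma_eq)

lemma axis_less_sigma:
  assumes "-\<beta> \<le> y" "y \<le> 2 * pi - \<beta>" "y \<noteq> \<beta>"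
  shows "sin y / cos \<beta> - y < sigma"
  using axis_increasing[of y \<beta>] axis_decreasing[of \<beta> y] assms by (auto simp: sigma_eq linorder_neq_iff)

lemma cos_sinhc_inv: "0 < cos \<beta> * sinhc_inv p" "cos \<beta> * sinhc_inv p \<le> cos \<beta>" "cos \<beta> * sinhc_inv p < 1"
proof -
  show "0 < cos \<beta> * sinhc_inv p" using cos_pos sinhc_inv_pos[of p] by simp
  show "cos \<beta> * sinhc_inv p \<le> cos \<beta>" using cos_pos sinhc_inv_le_1[of p] by simp
  thus "cos \<beta> * sinhc_inv p < 1" using cos_less_1 by simp
qed

lemma cos_q: "cos (q p) = cos \<beta> * sinhc_inv p"
  using cos_sinhc_inv[of p] by (simp add: q_def)

lemma cos_q_pos: "cos (q p) > 0" using cos_sinhc_inv[of p] by (simp add: cos_q)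

lemma q_0 [simp]: "q 0 = \<beta>"
  using beta_pos beta_less by (simp add: q_def sinhc_inv_def arccos_cos)

lemma q_minus [simp]: "q (-p) = q p" by (simp add: q_def)

lemma q_ge: "\<beta> \<le> q p"
proof -
  have "arccos (cos \<beta>) \<le> q p" unfolding q_def
    using cos_sinhc_inv[of p] cos_less_1 by (intro arccos_le_arccos) auto
  thus ?thesis using beta_pos beta_less by (simp add: arccos_cos)
qed

lemma q_pos: "q p > 0" using q_ge[of p] beta_pos by simp

lemma q_less: "q p < pi / 2"
proof -
  have "arccos (cos \<beta> * sinhc_inv p) < arccos 0"
    using cos_sinhc_inv[of p] by (intro arccos_less_arccos) auto
  thus ?thesis by (simp add: q_def)
qed

lemma q_cont: "continuous_on UNIV q"
  unfolding q_def using cos_sinhc_inv sinhc_inv_cont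
  by (intro continuous_intros continuous_at_imp_continuous_on)
     (auto intro!: order.strict_implies_order order.trans[OF _ order.strict_implies_order[OF cos_sinhc_inv(1)]])

lemma q_deriv: "p \<noteq> 0 \<Longrightarrow> (q has_real_derivative dq p) (at p)"
proof -
  assume p: "p \<noteq> 0"
  have "((\<lambda>p. cos \<beta> * sinhc_inv p) has_real_derivative cos \<beta> * ((sinh p - p * cosh p) / (sinh p)\<^sup>2)) (at p)"
    by (intro DERIV_cmult sinhc_inv_deriv p)
  moreover have "(arccos has_real_derivative inverse (- sqrt (1 - (cos \<beta> * sinhc_inv p)\<^sup>2))) (at (cos \<beta> * sinhc_inv p))"
    by (rule DERIV_arccos) (use cos_sinhc_inv[of p] in linarith)+
  ultimately show ?thesis
    unfolding q_def dq_def using DERIV_chain2 by (fastforce simp: mult.commute)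
qed

lemma dq_minus: "dq (-p) = - dq p"
proof -
  have "sinh (-p) - (-p) * cosh (-p) = - (sinh p - p * cosh p)" by simp
  hence "dq (-p) = cos \<beta> * (- (sinh p - p * cosh p) / (sinh p)\<^sup>2) * - inverse (sqrt (1 - (cos \<beta> * sinhc_inv p)\<^sup>2))"
    unfolding dq_def by (simp only: sinh_minus power2_minus sinhc_inv_minus)
  also have "c * (- u / v) * - w = - (c * (u / v) * - w)" for c u v w :: real by simp
  finally show ?thesis unfolding dq_def .
qed

text \<open>Because \<open>sinh p * sinhc_inv p = p\<close>, the factor \<open>p\<close> comes out
  in front. The formula then covers the axis as well, and signs can be read off by comparing
  \<open>cos y\<close> with \<open>cos (q p)\<close>.\<close>

lemma Re_f: "Re (f (Complex p y)) = p * (cos y / cos (q p) - 1)"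
proof -
  have "p * (cos y / cos (q p)) = sinh p * cos y / cos \<beta>"
    using sinh_mult_sinhc_inv[of p] sinhc_inv_pos[of p] cos_pos
    by (simp add: cos_q field_simps)
  thus ?thesis by (simp add: f_def Re_sinh right_diff_distrib)
qed

lemma Im_f: "Im (f (Complex p y)) = cosh p * sin y / cos \<beta> - y"
  by (simp add: f_def Im_sinh)

lemma Re_S: "Re (S (Complex p y)) = cosh p * sin y / cos \<beta> - y - sigma"
  and Im_S: "Im (S (Complex p y)) = p * (1 - cos y / cos (q p))"
  by (simp_all add: S_def Im_f Re_f algebra_simps)

text \<open>All three curves satisfy \<open>cos y = cos (q p)\<close>, so the real part vanishes.
  The third is the first moved up by a period of \<open>sinh\<close>.\<close>

lemma f_low: "f (Complex p (- q p)) = Complex 0 (- height p)"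
  and f_mid: "f (Complex p (q p)) = Complex 0 (height p)"
  and f_up: "f (Complex p (2 * pi - q p)) = Complex 0 (- height p - 2 * pi)"
proof -
  have c: "cos (2 * pi - q p) = cos (q p)" "sin (2 * pi - q p) = - sin (q p)" by simp_all
  show "f (Complex p (- q p)) = Complex 0 (- height p)" "f (Complex p (q p)) = Complex 0 (height p)"
    "f (Complex p (2 * pi - q p)) = Complex 0 (- height p - 2 * pi)"
    using cos_q_pos[of p]
    by (intro complex_eqI; simp only: Re_f Im_f c; simp add: height_def)+
qed

text \<open>Concavity of \<open>sin\<close> controls the sliver between the horizontal line through the saddle and the
  steepest descent path, where \<open>Re S\<close> is positive although \<open>Im S\<close> has the sign of the lower part.\<close>

lemma Re_S_sliver:
  assumes "\<beta> \<le> y" "y \<le> q p"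
  shows "tan \<beta> * (cosh p - 1) + (y - \<beta>) * (cos y / cos (q p) - 1) \<le> Re (S (Complex p y))"
proof -
  \<comment> \<open>By concavity the chord from \<open>\<beta>\<close> to \<open>y\<close> is at
    least as steep as the tangent at \<open>y\<close>.\<close>
  have sin: "(y - \<beta>) * cos y \<le> sin y - sin \<beta>"
  proof (cases "y = \<beta>")
    case False
    hence "\<beta> < y" using assms by simp
    then obtain z where z: "\<beta> < z" "z < y" "sin y - sin \<beta> = (y - \<beta>) * cos z"
      using MVT2[of \<beta> y sin cos] by (auto intro: DERIV_sin)
    have "cos y \<le> cos z" using z assms beta_pos q_less[of p] by (intro cos_monotone_0_pi_le) auto
    thus ?thesis using z \<open>\<beta> < y\<close> by (simp add: mult_left_mono)
  qed simp
  have cy: "cos y \<ge> 0" using assms q_less[of p] beta_pos by (intro cos_ge_zero) auto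
  have "1 / sinhc_inv p \<le> cosh p"
    using cosh_mult_sinhc_inv_ge[of p] sinhc_inv_pos[of p] by (simp add: field_simps)
  hence "(1 / sinhc_inv p) * ((y - \<beta>) * cos y / cos \<beta>) \<le> cosh p * ((y - \<beta>) * cos y / cos \<beta>)"
    using cy cos_pos assms by (intro mult_right_mono) auto
  also have "\<dots> \<le> cosh p * ((sin y - sin \<beta>) / cos \<beta>)"
    using sin cos_pos by (intro mult_left_mono divide_right_mono) auto
  finally have "(y - \<beta>) * (cos y / cos (q p)) \<le> cosh p * ((sin y - sin \<beta>) / cos \<beta>)"
    by (simp add: cos_q mult_ac)
  thus ?thesis
    unfolding Re_S sigma_eq tan_def
    by (simp add: algebra_simps diff_divide_distrib)
qed

text \<open>On the path itself \<open>cos y = cos (q p)\<close>, so the second term of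
  \<open>Re_S_sliver\<close> drops out.\<close>

lemma height_ge: "sigma \<le> height p"
proof -
  have "tan \<beta> * (cosh p - 1) \<le> height p - sigma"
    using Re_S_sliver[of "q p" p] q_ge[of p] cos_q_pos[of p] by (simp add: Re_S height_def)
  moreover have "0 \<le> tan \<beta> * (cosh p - 1)" using tan_pos cosh_real_ge_1[of p] by simp
  ultimately show ?thesis by simp
qed

lemma height_pos: "height p > 0" using height_ge[of p] sigma_pos by simp

section \<open>Zeros and growth of the phase function between the curves\<close>

definition K1 :: "complex set" where "K1 = {w. - q (Re w) \<le> Im w \<and> Im w \<le> 2 * pi - q (Re w)}"
text \<open>The part of \<open>K1\<close> below the path through the saddle. It serves the residue
  at the origin, which is the only zero of \<open>f\<close> in it.\<close>

definition K2 :: "complex set" where "K2 = {w. - q (Re w) \<le> Im w \<and> Im w \<le> q (Re w)}"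

text \<open>A vanishing real part leaves only the axis and the boundary curves. On the curves
  \<open>f\<close> is \<open>\<i>\<close> times a nonzero height; on the axis monotonicity leaves
  the origin.\<close>

lemma f_zero_K2:
  assumes "w \<in> K2" "f w = 0" shows "w = 0"
proof -
  obtain p y where w: "w = Complex p y" by (cases w)
  have y: "- q p \<le> y" "y \<le> q p" using assms(1) by (auto simp: K2_def w)
  show ?thesis
  proof (cases "p = 0")
    case False
    have "cos y / cos (q p) = 1" using assms(2) False Re_f[of p y] by (simp add: w)
    hence "cos y = cos (q p)" using cos_q_pos[of p] by simp
    hence "\<not> \<bar>y\<bar> < q p" using cos_less_of_abs_less[of "q p" y] q_less[of p] q_pos[of p] by auto
    hence "y = q p \<or> y = - q p" using y by linarith
    hence "f w = Complex 0 (height p) \<or> f w = Complex 0 (- height p)" using f_mid f_low by (auto simp: w)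
    thus ?thesis using assms(2) height_pos[of p] by (auto simp: complex_eq_iff)
  next
    case True
    have "sin y / cos \<beta> - y = 0" using assms(2) Im_f[of p y] True by (simp add: w)
    hence "\<not> 0 < y" "\<not> y < 0" using axis_increasing[of 0 y] axis_increasing[of y 0] y beta_pos True
      by auto
    hence "y = 0" by simp
    thus ?thesis using True by (simp add: w complex_eq_iff)
  qed
qed

text \<open>Further zeros in \<open>K1\<close> are not excluded, only placed above the level of the
  saddle. That suffices, because there \<open>Z\<close> takes the sign opposite to its value at the
  origin.\<close>

lemma f_zero_K1:
  assumes "w \<in> K1" "f w = 0" "w \<noteq> 0" shows "Im w > \<beta>"
proof -
  obtain p y where w: "w = Complex p y" by (cases w)
  have y: "- q p \<le> y" "y \<le> 2 * pi - q p" using assms(1) by (auto simp: K1_def w)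
  show ?thesis
  proof (cases "y \<le> q p")
    case True
    hence "w \<in> K2" using y by (simp add: K2_def w)
    thus ?thesis using f_zero_K2 assms by blast
  next
    case False thus ?thesis using q_ge[of p] by (simp add: w)
  qed
qed

text \<open>In a strip of bounded height \<open>sinh\<close> outgrows the linear term.\<close>

lemma f_tendsto_infinity:
  assumes "\<And>w. w \<in> K \<Longrightarrow> \<bar>Im w\<bar> \<le> 2 * pi"
  shows "\<exists>R0. \<forall>w\<in>K. \<bar>Re w\<bar> \<ge> R0 \<longrightarrow> norm (f w) \<ge> B"
proof (intro exI ballI impI)
  \<comment> \<open>For \<open>x = \<bar>Re w\<bar>\<close> the bound gives
    \<open>sinh x - x \<ge> x / 2 \<ge> B + 2 * pi\<close>; the summand \<open>2 * pi\<close> pays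
    for the imaginary part.\<close>
  fix w assume w: "w \<in> K" and R: "\<bar>Re w\<bar> \<ge> max 4 (2 * (B + 2 * pi))"
  have "sinh \<bar>Re w\<bar> \<le> norm (sinh w)" by (rule norm_sinh_ge)
  also have "\<dots> \<le> norm (sinh w / of_real (cos \<beta>))"
    using cos_pos cos_less_1 by (simp add: norm_divide divide_simps mult_left_le)
  also have "\<dots> \<le> norm (f w) + norm w" unfolding f_def by (metis add.commute norm_triangle_sub)
  also have "norm w \<le> \<bar>Re w\<bar> + \<bar>Im w\<bar>" by (rule cmod_le)
  also have "\<bar>Im w\<bar> \<le> 2 * pi" using assms w by blast
  finally show "norm (f w) \<ge> B" using half_le_sinh_minus[of "\<bar>Re w\<bar>"] R by auto
qed

section \<open>The double zero at the saddle\<close>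

definition h :: "complex \<Rightarrow> complex" where "h = diff_quot saddle (diff_quot saddle S)"

lemma f_deriv: "(f has_field_derivative (cosh w / of_real (cos \<beta>) - 1)) (at w)"
  unfolding f_def using cos_pos by (auto intro!: derivative_eq_intros)

lemma f_analytic [analytic_intros]: "f analytic_on A"
  unfolding f_def using cos_pos by (intro analytic_intros) auto

lemma S_analytic [analytic_intros]: "S analytic_on A"
  unfolding S_def by (intro analytic_intros)

lemma h_analytic [analytic_intros]: "h analytic_on A"
  unfolding h_def by (intro analytic_intros)

lemma S_deriv: "(S has_field_derivative - \<i> * (cosh w / of_real (cos \<beta>) - 1)) (at w)"
  unfolding S_def by (auto intro!: derivative_eq_intros f_deriv)

lemma cosh_saddle: "cosh saddle = of_real (cos \<beta>)" and sinh_saddle: "sinh saddle = \<i> * of_real (sin \<beta>)"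
proof -
  have "saddle = \<i> * of_real \<beta>" by (simp add: complex_eq_iff)
  moreover have "\<i> * (\<i> * of_real \<beta>) = - complex_of_real \<beta>" by (simp flip: mult.assoc)
  ultimately show "cosh saddle = of_real (cos \<beta>)" "sinh saddle = \<i> * of_real (sin \<beta>)"
    by (simp_all add: cosh_conv_cos sinh_conv_sin cos_of_real sin_of_real)
qed

text \<open>Both \<open>S\<close> and its derivative vanish at the saddle, so two divided
  differences divide out the square.\<close>

lemma S_eq: "S w = (w - saddle)\<^sup>2 * h w"
proof -
  have "S saddle = 0"
    by (intro complex_eqI) (simp_all add: Re_S Im_S sigma_eq)
  moreover have "diff_quot saddle S saddle = 0"
    using DERIV_imp_deriv[OF S_deriv[of saddle]] cos_pos by (simp add: diff_quot_def cosh_saddle)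
  ultimately show ?thesis
    using diff_quot_eq[of S w saddle] diff_quot_eq[of "diff_quot saddle S" w saddle]
    by (simp add: h_def power2_eq_square)
qed

text \<open>A twice iterated divided difference at its centre is a Taylor coefficient, here half the
  second derivative of \<open>S\<close>; the residue serves as the link between the two.\<close>

lemma h_saddle: "h saddle = of_real (tan \<beta> / 2)"
proof -
  have "h saddle = (diff_quot saddle ^^ 2) S saddle" by (simp add: h_def numeral_2_eq_2)
  also have "\<dots> = residue (\<lambda>w. S w / (w - saddle) ^ Suc 2) saddle"
    by (rule residue_over_power[symmetric]) (intro analytic_intros)
  also have "\<dots> = (deriv ^^ 2) S saddle / fact 2"
    by (rule residue_holomorphic_over_power[of UNIV]) (auto intro!: analytic_imp_holomorphic analytic_intros)
  also have "(deriv ^^ 2) S = deriv (\<lambda>w. - \<i> * (cosh w / of_real (cos \<beta>) - 1))"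
  proof -
    have "deriv S = (\<lambda>w. - \<i> * (cosh w / of_real (cos \<beta>) - 1))"
      using DERIV_imp_deriv[OF S_deriv] by (intro ext)
    thus ?thesis by (simp add: numeral_2_eq_2)
  qed
  also have "deriv (\<lambda>w. - \<i> * (cosh w / of_real (cos \<beta>) - 1)) saddle = - \<i> * (sinh saddle / of_real (cos \<beta>))"
    using cos_pos by (intro DERIV_imp_deriv) (auto intro!: derivative_eq_intros)
  finally show ?thesis using cos_pos
    by (simp add: sinh_saddle tan_def)
qed

lemma S_on_curves:
  "S (Complex p (- q p)) = - of_real (sigma + height p)"
  "S (Complex p (q p)) = of_real (height p - sigma)"
  "S (Complex p (2 * pi - q p)) = - of_real (sigma + height p + 2 * pi)"
  by (simp_all add: S_def f_low f_mid f_up complex_eq_iff)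

text \<open>If \<open>h w = - r\<close> with \<open>r \<ge> 0\<close>, then
  \<open>S = - r * (w - saddle)^2\<close>. Off the axis and inside the strip, the imaginary parts of
  the two sides have incompatible signs above the path and below the level of the saddle; the
  remaining cases go by real parts. This is what makes the principal square root of \<open>h\<close>
  analytic on \<open>K1\<close>.\<close>

lemma h_not_nonpos:
  assumes "w \<in> K1" shows "h w \<notin> \<real>\<^sub>\<le>\<^sub>0"
proof
  assume "h w \<in> \<real>\<^sub>\<le>\<^sub>0"
  then obtain r where hr: "h w = - of_real r" and r: "r \<ge> 0"
    by (metis nonpos_Reals_cases minus_minus of_real_minus neg_0_le_iff_le)
  obtain p y where w: "w = Complex p y" by (cases w)
  have y: "- q p \<le> y" "y \<le> 2 * pi - q p" using assms by (auto simp: K1_def w)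
  have ne: "w \<noteq> saddle"
  proof
    assume "w = saddle"
    hence "complex_of_real (tan \<beta> / 2) = of_real (- r)" using hr h_saddle by simp
    hence "tan \<beta> / 2 = - r" by (simp only: of_real_eq_iff)
    thus False using tan_pos r by simp
  qed
  have "w - saddle = Complex p (y - \<beta>)" by (simp add: w complex_eq_iff)
  hence S: "S (Complex p y) = - of_real r * (Complex p (y - \<beta>))\<^sup>2" using S_eq[of w] hr by (simp add: w)
  have Re: "Re (S (Complex p y)) = - r * (p\<^sup>2 - (y - \<beta>)\<^sup>2)"
    unfolding S by (simp add: power2_eq_square)
  have "Im (S (Complex p y)) = - r * (2 * p * (y - \<beta>))"
    unfolding S by (simp add: power2_eq_square)
  hence "p * (1 - cos y / cos (q p)) = p * (- 2 * r * (y - \<beta>))" unfolding Im_S by simp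
  hence Im: "p \<noteq> 0 \<Longrightarrow> 1 - cos y / cos (q p) = - 2 * r * (y - \<beta>)" by (metis mult_left_cancel)
  show False
  proof (cases "p = 0")
    \<comment> \<open>On the axis \<open>S\<close> is negative off the saddle, whereas
      \<open>- r * (w - saddle)^2\<close> is nonnegative.\<close>
    case True
    hence "y \<noteq> \<beta>" using ne by (simp add: w)
    hence "Re (S (Complex p y)) < 0" using axis_less_sigma[of y] y True by (simp add: Re_S)
    moreover have "Re (S (Complex p y)) \<ge> 0" unfolding Re using r True by simp
    ultimately show False by simp
  next
    case p: False
    note Im = Im[OF p]
    have r0: "r \<noteq> 0" if "cos y / cos (q p) \<noteq> 1" using that Im by auto
    consider "y > q p" | "\<beta> \<le> y" "y \<le> q p" | "y < \<beta>" by linarith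
    thus False
    proof cases
      case 1
      hence yb: "y > \<beta>" using q_ge[of p] by simp
      show False
      \<comment> \<open>On a boundary curve the imaginary part of \<open>S\<close> vanishes, which
        forces \<open>r = 0\<close> and so \<open>S = 0\<close>, although \<open>S\<close> is
        strictly negative there.\<close>
      proof (cases "y = 2 * pi - q p")
        case True
        have "cos y = cos (q p)" using True by simp
        hence "r = 0" using Im yb cos_q_pos[of p] by simp
        hence "Re (S (Complex p y)) = 0" unfolding Re by simp
        thus False using S_on_curves(3)[of p] height_pos[of p] sigma_pos True pi_gt_zero by simp
      next
        case False
        hence "cos y < cos (q p)"
          using 1 y q_pos[of p] q_less[of p] by (intro cos_less_of_between) auto
        hence "1 - cos y / cos (q p) > 0" using cos_q_pos[of p] by simp
        moreover have "- 2 * r * (y - \<beta>) \<le> 0" using r yb by simp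
        ultimately show False using Im by simp
      qed
    next
      case 2
      \<comment> \<open>In the sliver the imaginary parts agree in sign, so the real part has to
        decide. Inserting the value of \<open>cos y / cos (q p) - 1\<close> into
        \<open>Re_S_sliver\<close> leaves a sum of a positive and a nonnegative term that would be
        at most zero.\<close>
      have t: "0 < tan \<beta> * (cosh p - 1)"
        using p tan_pos cosh_gt_1[of p] by simp
      have "tan \<beta> * (cosh p - 1) + (y - \<beta>) * (cos y / cos (q p) - 1) \<le> - r * (p\<^sup>2 - (y - \<beta>)\<^sup>2)"
        using Re_S_sliver[OF 2] unfolding Re .
      also have "\<dots> \<le> r * (y - \<beta>)\<^sup>2" using r by (simp add: algebra_simps)
      also have "cos y / cos (q p) - 1 = 2 * r * (y - \<beta>)" using Im by simp
      finally have "tan \<beta> * (cosh p - 1) + r * (y - \<beta>)\<^sup>2 \<le> 0" by (simp add: power2_eq_square algebra_simps)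
      moreover have "0 \<le> r * (y - \<beta>)\<^sup>2" using r by simp
      ultimately show False using t by linarith
    next
      case 3
      show False
      proof (cases "y = - q p")
        case True
        have "cos y = cos (q p)" using True by simp
        hence "r = 0" using Im 3 cos_q_pos[of p] by simp
        hence "Re (S (Complex p y)) = 0" unfolding Re by simp
        thus False using S_on_curves(1)[of p] height_pos[of p] sigma_pos True by simp
      next
        case False
        hence "cos (q p) < cos y"
          using 3 y q_ge[of p] q_less[of p] by (intro cos_less_of_abs_less) auto
        hence "1 - cos y / cos (q p) < 0" using cos_q_pos[of p] by simp
        moreover have "- 2 * r * (y - \<beta>) \<ge> 0" using r 3 by (simp add: mult_nonneg_nonpos)
        ultimately show False using Im by simp
      qed
    qed
  qed
qed

section \<open>The single-valued square root of S\<close>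

definition k :: "complex \<Rightarrow> complex" where "k w = exp (Ln (h w) / 2)"
text \<open>Only the nonvanishing factor \<open>h\<close> goes under the square root; the double
  zero contributes the linear factor. So \<open>Z\<close> has no branch point at the saddle.\<close>

definition Z :: "complex \<Rightarrow> complex" where "Z w = (w - saddle) * k w"

lemma k_analytic: "k analytic_on K1"
  unfolding k_def using h_not_nonpos by (intro analytic_intros) auto

lemma Z_analytic: "Z analytic_on K1"
  unfolding Z_def by (intro analytic_intros k_analytic)

lemma k_nonzero: "k w \<noteq> 0" by (simp add: k_def)

lemma h_nonzero: "w \<in> K1 \<Longrightarrow> h w \<noteq> 0" using h_not_nonpos by force

lemma Z_squared: "w \<in> K1 \<Longrightarrow> (Z w)\<^sup>2 = S w"
proof -
  assume "w \<in> K1"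
  hence "(k w)\<^sup>2 = h w" using h_nonzero[of w] by (simp add: k_def flip: exp_double)
  thus ?thesis by (simp add: Z_def S_eq power_mult_distrib)
qed

text \<open>The argument of \<open>h\<close> lies strictly between \<open>- pi\<close> and
  \<open>pi\<close>, and halving it leads into the right half-plane.\<close>

lemma Re_k_pos: "w \<in> K1 \<Longrightarrow> Re (k w) > 0"
proof -
  assume w: "w \<in> K1"
  have "Im (Ln (h w)) < pi" "- pi < Im (Ln (h w))"
    using Im_Ln_less_pi[OF h_not_nonpos[OF w]] mpi_less_Im_Ln[OF h_nonzero[OF w]] by auto
  hence "cos (Im (Ln (h w)) / 2) > 0" by (intro cos_gt_zero_pi) auto
  thus ?thesis by (simp add: k_def Re_exp)
qed

text \<open>The square determines \<open>Z w\<close> up to sign. Since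
  \<open>Z w = (w - saddle) * k w\<close> with \<open>Re (k w) > 0\<close>, the sign is that of
  \<open>Im w - \<beta>\<close>.\<close>

lemma Z_of_negative:
  assumes w: "w \<in> K1" and S: "S w = - of_real x" and x: "x > 0"
  shows "Z w = (if Im w > \<beta> then \<i> else - \<i>) * of_real (sqrt x)"
proof -
  have "(Z w)\<^sup>2 = (\<i> * of_real (sqrt x))\<^sup>2"
    using x by (simp add: Z_squared[OF w] S power_mult_distrib flip: of_real_power)
  hence "Z w = \<i> * of_real (sqrt x) \<or> Z w = - (\<i> * of_real (sqrt x))"
    by (simp only: power2_eq_iff)
  then obtain s :: real where s: "s = 1 \<or> s = -1" "Z w = of_real s * \<i> * of_real (sqrt x)"
    by (metis mult_1 mult_minus_left of_real_1 of_real_minus)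
  have "w - saddle = Z w / k w" using k_nonzero[of w] by (simp add: Z_def)
  also have "\<dots> = \<i> * of_real (s * sqrt x) / k w" by (simp add: s)
  finally have "Im (w - saddle) = s * sqrt x * Re (k w) / (cmod (k w))\<^sup>2"
    by (simp add: Im_divide cmod_power2)
  hence I: "Im w - \<beta> = s * (sqrt x * Re (k w) / (cmod (k w))\<^sup>2)" by simp
  have pos: "sqrt x * Re (k w) / (cmod (k w))\<^sup>2 > 0"
    using x Re_k_pos[OF w] k_nonzero[of w] by simp
  show ?thesis
    using s(1)
  proof
    assume "s = 1"
    thus ?thesis using I pos s(2) by simp
  next
    assume "s = -1"
    thus ?thesis using I pos s(2) by simp
  qed
qed

lemma Z_low: "Z (Complex p (- q p)) = - \<i> * of_real (sqrt (sigma + height p))"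
  using Z_of_negative[of "Complex p (- q p)", OF _ S_on_curves(1)] q_pos[of p] q_less[of p]
    height_pos[of p] sigma_pos beta_pos by (simp add: K1_def)

lemma Z_up: "Z (Complex p (2 * pi - q p)) = \<i> * of_real (sqrt (sigma + height p + 2 * pi))"
  using Z_of_negative[of "Complex p (2 * pi - q p)", OF _ S_on_curves(3)] q_pos[of p] q_less[of p]
    height_pos[of p] sigma_pos beta_pos beta_less by (simp add: K1_def)

text \<open>The square of \<open>norm (Z w)\<close> is \<open>norm (S w)\<close>, hence at least
  \<open>norm (f w) - sigma\<close>.\<close>

lemma Z_tendsto_infinity: "\<exists>R0. \<forall>w\<in>K1. \<bar>Re w\<bar> \<ge> R0 \<longrightarrow> norm (Z w) \<ge> B"
proof -
  have "\<bar>Im w\<bar> \<le> 2 * pi" if "w \<in> K1" for w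
    using that q_pos[of "Re w"] q_less[of "Re w"] by (auto simp: K1_def)
  then obtain R0 where R0: "\<And>w. w \<in> K1 \<Longrightarrow> \<bar>Re w\<bar> \<ge> R0 \<Longrightarrow> norm (f w) \<ge> B\<^sup>2 + sigma"
    using f_tendsto_infinity[of K1 "B\<^sup>2 + sigma"] by blast
  have "norm (Z w) \<ge> B" if w: "w \<in> K1" "\<bar>Re w\<bar> \<ge> R0" for w
  proof -
    have "norm (f w) = norm (S w + of_real sigma)" by (simp add: S_def norm_mult)
    also have "\<dots> \<le> norm (S w) + norm (complex_of_real sigma)" by (rule norm_triangle_ineq)
    also have "norm (complex_of_real sigma) = sigma" using sigma_pos by simp
    also have "norm (S w) = (norm (Z w))\<^sup>2" by (simp add: Z_squared[OF w(1), symmetric] norm_power)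
    finally have "B\<^sup>2 \<le> (norm (Z w))\<^sup>2" using R0[OF w] by simp
    thus ?thesis by (rule power2_le_imp_le) simp
  qed
  thus ?thesis by blast
qed

end

subsection \<open>Contour integrals along the curves\<close>

text \<open>The tangent of the curve is \<open>1 - \<i> * d\<close>. With \<open>v\<close> even and
  \<open>d\<close> odd, the imaginary part changes sign under \<open>p \<mapsto> - p\<close> and
  integrates to zero.\<close>

lemma integral_even_times_odd:
  fixes v d :: "real \<Rightarrow> real"
  assumes "((\<lambda>p. of_real (v p) * Complex 1 (- d p)) has_integral I) {-R..R}"
    and "\<And>p. v (-p) = v p" "\<And>p. d (-p) = - d p"
  shows "(v has_integral Re I) {-R..R}" "I = of_real (Re I)"
proof -
  show "(v has_integral Re I) {-R..R}"
    using has_integral_linear[OF assms(1) bounded_linear_Re] by (simp add: o_def)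
  have odd: "((\<lambda>p. - (v p * d p)) has_integral Im I) {-R..R}"
    using has_integral_linear[OF assms(1) bounded_linear_Im] by (simp add: o_def)
  have "((\<lambda>p. - (v (-p) * d (-p))) has_integral Im I) {-R..R}"
    using odd has_integral_reflect_real[of "\<lambda>p. - (v p * d p)" "Im I" R "-R"] by simp
  hence "((\<lambda>p. v p * d p) has_integral Im I) {-R..R}" by (simp add: assms)
  from has_integral_unique[OF has_integral_neg[OF this] odd] have "Im I = 0" by simp
  thus "I = of_real (Re I)" by (simp add: complex_eq_iff)
qed

lemma Gamma_half: "Gamma (real m + 1/2) = fact (2 * m) * sqrt pi / (4 ^ m * fact m)"
proof (induction m)
  case 0 show ?case by (simp add: Gamma_one_half_real)
next
  case (Suc m)
  have "Gamma (real (Suc m) + 1/2) = (real m + 1/2) * Gamma (real m + 1/2)"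
    using Gamma_plus1[of "real m + 1/2"] by (simp add: add_ac nonpos_Ints_def)
  also have "\<dots> = fact (2 * Suc m) * sqrt pi / (4 ^ Suc m * fact (Suc m))"
  proof -
    have "fact (2 * Suc m) = (2 * real m + 2) * (2 * real m + 1) * fact (2 * m)"
      by (simp add: algebra_simps)
    moreover have "(x + 1/2) * (F * s / (X * G)) = (2 * x + 2) * (2 * x + 1) * F * s / (4 * X * ((x + 1) * G))"
      if "x \<ge> 0" "X > 0" "G > 0" for x F s X G :: real
      using that by (simp add: divide_simps) (simp add: algebra_simps)
    from this[of "real m" "4 ^ m" "fact m" "fact (2 * m)" "sqrt pi"]
    have "(real m + 1/2) * (fact (2 * m) * sqrt pi / (4 ^ m * fact m)) =
      (2 * real m + 2) * (2 * real m + 1) * fact (2 * m) * sqrt pi / (4 * 4 ^ m * ((real m + 1) * fact m))"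
      by simp
    ultimately show ?thesis unfolding Suc by (simp add: add.commute)
  qed
  finally show ?case .
qed

context debye
begin

lemma height_minus [simp]: "height (-p) = height p" by (simp add: height_def)

text \<open>The position of the pole stays free, because the same strip serves the saddle,
  \<open>c = \<beta>\<close>, and the origin, \<open>c = 0\<close>.\<close>

lemma strip_K1:
  assumes "- \<beta> < c" "c < 2 * pi - \<beta>"
  shows "strip (\<lambda>p. - q p) (\<lambda>p. 2 * pi - q p) (\<lambda>p. - dq p) (\<lambda>p. - dq p) c"
proof
  fix p show "- q p \<le> 2 * pi - q p" by simp
  show "((\<lambda>p. - q p) has_real_derivative - dq p) (at p)" if "p \<noteq> 0"
    using q_deriv[OF that] by (rule DERIV_minus)
  show "((\<lambda>p. 2 * pi - q p) has_real_derivative - dq p) (at p)" if "p \<noteq> 0"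
    using DERIV_diff[OF DERIV_const q_deriv[OF that], of "2 * pi"] by simp
qed (use assms in \<open>auto intro!: continuous_intros q_cont\<close>)

lemma strip_K2: "strip (\<lambda>p. - q p) q (\<lambda>p. - dq p) dq 0"
proof
  fix p show "- q p \<le> q p" using q_pos[of p] by simp
  show "((\<lambda>p. - q p) has_real_derivative - dq p) (at p)" if "p \<noteq> 0"
    using q_deriv[OF that] by (rule DERIV_minus)
qed (use beta_pos in \<open>auto intro!: continuous_intros q_cont q_deriv\<close>)

text \<open>The two curves are vertical translates and share their tangent, so the boundary
  integrand is the difference of the values of \<open>F\<close> times that tangent. If this
  difference is a constant times an even real function \<open>v\<close>, the residue becomes a real
  integral of \<open>v\<close>.\<close>

lemma K1_limit:
  assumes c: "- \<beta> < c" "c < 2 * pi - \<beta>" and B: "B analytic_on K1" "N > 0"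
    and FB: "\<And>w. w \<in> K1 \<Longrightarrow> w \<noteq> Complex 0 c \<Longrightarrow> B w / (w - Complex 0 c) ^ N = F w"
    and decay: "\<And>e. e > 0 \<Longrightarrow> \<exists>R0. \<forall>w\<in>K1. \<bar>Re w\<bar> \<ge> R0 \<longrightarrow> norm (F w) \<le> e"
    and val: "\<And>p. F (Complex p (- q p)) - F (Complex p (2 * pi - q p)) = \<kappa> * of_real (v p)" "\<kappa> \<noteq> 0"
    and even: "\<And>p. v (-p) = v p"
  shows "((\<lambda>R. of_real (integral {-R..R} v)) \<longlongrightarrow>
      2 * of_real pi * \<i> * residue (\<lambda>w. B w / (w - Complex 0 c) ^ N) (Complex 0 c) / \<kappa>) at_top"
    and "\<And>R. R > 0 \<Longrightarrow> v integrable_on {-R..R}"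
proof -
  interpret strip "\<lambda>p. - q p" "\<lambda>p. 2 * pi - q p" "\<lambda>p. - dq p" "\<lambda>p. - dq p" c
    by (rule strip_K1[OF c])
  define r where "r = residue (\<lambda>w. B w / (w - Complex 0 c) ^ N) (Complex 0 c)"
  have K: "K = K1" by (simp add: K_def K1_def)
  have "strip_residue (\<lambda>w. B w / (w - Complex 0 c) ^ N) r"
    unfolding r_def using B by (intro strip_residue_pole) (simp_all add: K)
  hence F: "strip_residue F r"
    by (rule strip_residue_cong) (use FB in \<open>simp add: K\<close>)
  have eq: "F (g0 p) * Complex 1 (- dq p) - F (g1 p) * Complex 1 (- dq p) =
      \<kappa> * (of_real (v p) * Complex 1 (- dq p))" for p
    using val(1)[of p] by (simp add: g0_def g1_def left_diff_distrib[symmetric])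
  have int: "((\<lambda>p. of_real (v p) * Complex 1 (- dq p)) has_integral
      (integral {-R..R} (\<lambda>p. F (g0 p) * Complex 1 (- dq p) - F (g1 p) * Complex 1 (- dq p)) / \<kappa>)) {-R..R}"
    if "R > 0" for R
  proof -
    from F that obtain J where
      "((\<lambda>p. F (g0 p) * Complex 1 (- dq p) - F (g1 p) * Complex 1 (- dq p)) has_integral J) {-R..R}"
      by (rule strip_residueE)
    hence "((\<lambda>p. F (g0 p) * Complex 1 (- dq p) - F (g1 p) * Complex 1 (- dq p)) has_integral
      integral {-R..R} (\<lambda>p. F (g0 p) * Complex 1 (- dq p) - F (g1 p) * Complex 1 (- dq p))) {-R..R}"
      by (simp add: integral_unique)
    from has_integral_mult_right[OF this, of "1 / \<kappa>"] show ?thesis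
      unfolding eq using val(2) by (simp add: mult.assoc[symmetric])
  qed
  note v = integral_even_times_odd[OF int even dq_minus]
  show "v integrable_on {-R..R}" if "R > 0" for R
    using v(1)[OF that] by blast
  have "((\<lambda>R. integral {-R..R} (\<lambda>p. F (g0 p) * Complex 1 (- dq p) - F (g1 p) * Complex 1 (- dq p)) / \<kappa>)
    \<longlongrightarrow> 2 * of_real pi * \<i> * r / \<kappa>) at_top"
    by (intro tendsto_divide tendsto_const val(2) strip_integral_tendsto[OF F, of "2 * pi"])
       (use decay in \<open>simp_all add: K\<close>)
  moreover have "\<forall>\<^sub>F R in at_top. integral {-R..R} (\<lambda>p. F (g0 p) * Complex 1 (- dq p) - F (g1 p) * Complex 1 (- dq p)) / \<kappa>
      = of_real (integral {-R..R} v)"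
    using eventually_gt_at_top[of 0]
  proof eventually_elim
    case (elim R)
    show ?case using v(2)[OF elim] integral_unique[OF v(1)[OF elim]] by simp
  qed
  ultimately show "((\<lambda>R. of_real (integral {-R..R} v)) \<longlongrightarrow>
      2 * of_real pi * \<i> * residue (\<lambda>w. B w / (w - Complex 0 c) ^ N) (Complex 0 c) / \<kappa>) at_top"
    unfolding r_def[symmetric] by (rule Lim_transform_eventually)
qed

lemma Z_decay:
  assumes "(\<phi> \<longlongrightarrow> (0 :: complex)) at_infinity" "e > 0"
  shows "\<exists>R0. \<forall>w\<in>K1. \<bar>Re w\<bar> \<ge> R0 \<longrightarrow> norm (\<phi> (Z w)) \<le> e"
proof -
  have "\<forall>\<^sub>F z in at_infinity. norm (\<phi> z) < e" using assms by (simp add: tendsto_iff)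
  then obtain b where "\<And>z. norm z \<ge> b \<Longrightarrow> norm (\<phi> z) < e"
    unfolding eventually_at_infinity by blast
  with Z_tendsto_infinity[of b] show ?thesis by (meson less_imp_le)
qed

section \<open>Moments over the two curves\<close>

definition y1 :: "real \<Rightarrow> real" where "y1 p = sqrt (sigma + height p)"
definition y2 :: "real \<Rightarrow> real" where "y2 p = sqrt (sigma + height p + 2 * pi)"

lemma y1_pos: "y1 p > 0" and y2_pos: "y2 p > 0"
  using sigma_pos height_pos[of p] by (simp_all add: y1_def y2_def add_pos_pos)

lemma y_minus [simp]: "y1 (-p) = y1 p" "y2 (-p) = y2 p" by (simp_all add: y1_def y2_def)

lemma beta_bounds: "- \<beta> < \<beta>" "\<beta> < 2 * pi - \<beta>" "- \<beta> < 0" "0 < 2 * pi - \<beta>"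
  using beta_pos beta_less by auto

text \<open>The residue of \<open>1 / Z ^ (2 * m + 1)\<close>, written as an analytic numerator over
  a power of \<open>w - saddle\<close>.\<close>

definition saddle_residue :: "nat \<Rightarrow> complex" where
  "saddle_residue m = residue (\<lambda>w. (1 / k w) ^ (2 * m + 1) / (w - saddle) ^ (2 * m + 1)) saddle"

text \<open>On the curves \<open>Z\<close> is \<open>- \<i> * y1\<close> and
  \<open>\<i> * y2\<close>. Odd powers of \<open>- \<i>\<close> and \<open>\<i>\<close> are
  opposite, so the difference across the strip is a constant times a sum of positive terms.\<close>

lemma moment_limit:
  shows "((\<lambda>R. of_real (integral {-R..R} (\<lambda>p. 1 / y1 p ^ (2 * m + 1) + 1 / y2 p ^ (2 * m + 1)))) \<longlongrightarrow>
    2 * of_real pi * (-1) ^ m * saddle_residue m) at_top"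
    and "R > 0 \<Longrightarrow> (\<lambda>p. 1 / y1 p ^ (2 * m + 1) + 1 / y2 p ^ (2 * m + 1)) integrable_on {-R..R}"
proof -
  have an: "(\<lambda>w. (1 / k w) ^ (2 * m + 1)) analytic_on K1"
    using k_nonzero by (intro analytic_intros k_analytic) auto
  have FB: "(1 / k w) ^ (2 * m + 1) / (w - saddle) ^ (2 * m + 1) = 1 / Z w ^ (2 * m + 1)" for w
    by (simp add: Z_def power_mult_distrib power_one_over)
  have "((\<lambda>z :: complex. 1 / z ^ (2 * m + 1)) \<longlongrightarrow> 0) at_infinity"
    by (intro tendsto_divide_0[OF tendsto_const] filterlim_power_at_infinity filterlim_ident) auto
  note decay = Z_decay[OF this]
  have pw: "(- \<i>) ^ (2 * m + 1) = - \<i> * (-1) ^ m" "\<i> ^ (2 * m + 1) = \<i> * (-1) ^ m"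
    by (simp_all add: power_mult)
  have inv: "inverse (\<i> * (-1) ^ m) = - \<i> * (-1) ^ m" "inverse (- \<i> * (-1) ^ m) = \<i> * (-1) ^ m"
    by (cases "even m"; simp)+
  have low: "1 / Z (Complex p (- q p)) ^ (2 * m + 1) = \<i> * (-1) ^ m * of_real (1 / y1 p ^ (2 * m + 1))" for p
  proof -
    have "1 / Z (Complex p (- q p)) ^ (2 * m + 1) = inverse ((- \<i>) ^ (2 * m + 1)) * of_real (1 / y1 p ^ (2 * m + 1))"
      by (simp only: Z_low power_mult_distrib y1_def inverse_eq_divide of_real_divide of_real_power of_real_1 times_divide_times_eq mult_1)
    thus ?thesis unfolding pw inv .
  qed
  have up: "1 / Z (Complex p (2 * pi - q p)) ^ (2 * m + 1) = - \<i> * (-1) ^ m * of_real (1 / y2 p ^ (2 * m + 1))" for p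
  proof -
    have "1 / Z (Complex p (2 * pi - q p)) ^ (2 * m + 1) = inverse (\<i> ^ (2 * m + 1)) * of_real (1 / y2 p ^ (2 * m + 1))"
      by (simp only: Z_up power_mult_distrib y2_def inverse_eq_divide of_real_divide of_real_power of_real_1 times_divide_times_eq mult_1)
    thus ?thesis unfolding pw inv .
  qed
  have val: "1 / Z (Complex p (- q p)) ^ (2 * m + 1) - 1 / Z (Complex p (2 * pi - q p)) ^ (2 * m + 1) =
     (\<i> * (-1) ^ m) * of_real (1 / y1 p ^ (2 * m + 1) + 1 / y2 p ^ (2 * m + 1))" for p
    unfolding low up by (simp add: algebra_simps)
  note L = K1_limit[OF beta_bounds(1,2) an _ FB decay val]
  have "2 * of_real pi * \<i> * saddle_residue m / (\<i> * (-1) ^ m) = 2 * of_real pi * (-1) ^ m * saddle_residue m"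
    by (cases "even m") simp_all
  with L(1) show "((\<lambda>R. of_real (integral {-R..R} (\<lambda>p. 1 / y1 p ^ (2 * m + 1) + 1 / y2 p ^ (2 * m + 1)))) \<longlongrightarrow>
    2 * of_real pi * (-1) ^ m * saddle_residue m) at_top"
    by (simp add: saddle_residue_def)
  show "R > 0 \<Longrightarrow> (\<lambda>p. 1 / y1 p ^ (2 * m + 1) + 1 / y2 p ^ (2 * m + 1)) integrable_on {-R..R}"
    by (rule L(2)) auto
qed

section \<open>The pole at the origin\<close>

definition e :: "complex \<Rightarrow> complex" where "e = diff_quot 0 f"

lemma e_analytic [analytic_intros]: "e analytic_on A"
  unfolding e_def by (intro analytic_intros)

lemma f_0: "f 0 = 0" by (simp add: f_def)

lemma f_eq: "f w = w * e w"
  using diff_quot_eq[of f w 0] by (simp add: e_def f_0)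

lemma over_e_power:
  assumes "e w \<noteq> 0" "w \<noteq> 0"
  shows "(\<i> / e w) ^ N / w ^ N = 1 / (- \<i> * f w) ^ N"
proof -
  have "\<i> / e w / w = 1 / (- \<i> * f w)"
    using assms by (simp add: f_eq field_simps)
  thus ?thesis by (metis power_divide power_one_over)
qed

lemma e_0: "e 0 \<noteq> 0"
proof -
  have "deriv f 0 = of_real (1 / cos \<beta> - 1)"
    using DERIV_imp_deriv[OF f_deriv[of 0]] by simp
  moreover have "1 / cos \<beta> - 1 \<noteq> 0" using cos_pos cos_less_1 by simp
  ultimately show ?thesis by (simp add: e_def diff_quot_def del: of_real_diff of_real_divide)
qed

lemma e_nonzero: "w \<in> K2 \<Longrightarrow> e w \<noteq> 0"
  using e_0 f_zero_K2[of w] f_eq[of w] by (cases "w = 0") auto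

text \<open>The residue of \<open>1 / (- \<i> * f) ^ N\<close>. The factor \<open>\<i>\<close>
  passes from \<open>f\<close> to \<open>- \<i> * f\<close>, which is real on the curves.\<close>

definition origin_residue :: "nat \<Rightarrow> complex" where
  "origin_residue N = residue (\<lambda>w. (\<i> / e w) ^ N / w ^ N) 0"

text \<open>On the boundary of \<open>K2\<close> the values of \<open>- \<i> * f\<close> are
  \<open>- height\<close> below and \<open>height\<close> above, and the tangents are conjugate. For
  odd \<open>N\<close> the imaginary parts cancel pointwise and \<open>- 2 / height p ^ N\<close>
  remains.\<close>

lemma height_limit:
  assumes N: "odd N"
  shows "((\<lambda>R. of_real (integral {-R..R} (\<lambda>p. 1 / height p ^ N))) \<longlongrightarrow> - of_real pi * \<i> * origin_residue N) at_top"
    and "R > 0 \<Longrightarrow> (\<lambda>p. 1 / height p ^ N) integrable_on {-R..R}"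
proof -
  interpret strip "\<lambda>p. - q p" q "\<lambda>p. - dq p" dq 0
    by (rule strip_K2)
  let ?F = "\<lambda>w. 1 / (- \<i> * f w) ^ N"
  have K: "K = K2" by (simp add: K_def K2_def)
  have p0: "pole = 0" by (simp add: complex_eq_iff)
  have an: "(\<lambda>w. (\<i> / e w) ^ N) analytic_on K"
    unfolding K using e_nonzero by (intro analytic_intros) auto
  have N0: "N > 0" using N by (cases N) auto
  have res: "strip_residue (\<lambda>w. (\<i> / e w) ^ N / w ^ N) (origin_residue N)"
    using strip_residue_pole[OF an N0] unfolding p0 origin_residue_def by simp
  have F: "strip_residue ?F (origin_residue N)"
  proof (rule strip_residue_cong[OF res])
    fix w assume "w \<in> K" "w \<noteq> pole"
    hence "e w \<noteq> 0" "w \<noteq> 0" using e_nonzero K p0 by auto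
    thus "(\<i> / e w) ^ N / w ^ N = ?F w" by (rule over_e_power)
  qed
  have low: "?F (g0 p) = - of_real (1 / height p ^ N)" and up: "?F (g1 p) = of_real (1 / height p ^ N)" for p
  proof -
    have "- \<i> * f (g0 p) = - of_real (height p)" "- \<i> * f (g1 p) = of_real (height p)"
      by (simp_all add: g0_def g1_def f_low f_mid complex_eq_iff)
    thus "?F (g0 p) = - of_real (1 / height p ^ N)" "?F (g1 p) = of_real (1 / height p ^ N)"
      using N by simp_all
  qed
  have eq: "?F (g0 p) * Complex 1 (- dq p) - ?F (g1 p) * Complex 1 (dq p) = of_real (- 2 * (1 / height p ^ N))" for p
    unfolding low up by (simp add: complex_eq_iff)
  have int: "(\<lambda>p. - 2 * (1 / height p ^ N)) integrable_on {-R..R}" if "R > 0" for R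
  proof -
    from F that obtain J where "((\<lambda>p. ?F (g0 p) * Complex 1 (- dq p) - ?F (g1 p) * Complex 1 (dq p)) has_integral J) {-R..R}"
      by (rule strip_residueE)
    from has_integral_linear[OF this[unfolded eq] bounded_linear_Re] show ?thesis
      by (auto simp: o_def)
  qed
  show int': "(\<lambda>p. 1 / height p ^ N) integrable_on {-R..R}" if "R > 0" for R
    using integrable_cmul[OF int[OF that], of "-1/2"] by simp
  have width: "q p - (- q p) \<le> pi" for p using q_less[of p] by simp
  have decay: "\<exists>R0. \<forall>w\<in>K. \<bar>Re w\<bar> \<ge> R0 \<longrightarrow> norm (?F w) \<le> d" if d: "d > 0" for d
  proof -
    have "\<bar>Im w\<bar> \<le> 2 * pi" if "w \<in> K" for w
      using that q_less[of "Re w"] by (auto simp: K K2_def)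
    then obtain R0 where R0: "\<And>w. w \<in> K \<Longrightarrow> \<bar>Re w\<bar> \<ge> R0 \<Longrightarrow> norm (f w) \<ge> max 1 (1 / d)"
      using f_tendsto_infinity[of K "max 1 (1 / d)"] by blast
    have "norm (?F w) \<le> d" if w: "w \<in> K" "\<bar>Re w\<bar> \<ge> R0" for w
    proof -
      have f: "norm (f w) \<ge> 1" "norm (f w) \<ge> 1 / d" using R0[OF w] by auto
      have "norm (f w) ^ 1 \<le> norm (f w) ^ N" using N0 f by (intro power_increasing) auto
      moreover have "norm (f w) > 0" using f by linarith
      ultimately have "1 / norm (f w) ^ N \<le> 1 / norm (f w)"
        by (intro divide_left_mono mult_pos_pos zero_less_power) auto
      also have "\<dots> \<le> d" using f d by (simp add: divide_simps mult.commute)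
      finally show ?thesis by (simp add: norm_divide norm_mult norm_power)
    qed
    thus ?thesis by blast
  qed
  have lim: "((\<lambda>R. - 1 / 2 * integral {-R..R} (\<lambda>p. complex_of_real (- 2 * (1 / height p ^ N)))) \<longlongrightarrow>
     - 1 / 2 * (2 * of_real pi * \<i> * origin_residue N)) at_top"
    using strip_integral_tendsto[OF F width decay] unfolding eq by (intro tendsto_mult tendsto_const)
  have "\<forall>\<^sub>F R in at_top. - 1 / 2 * integral {-R..R} (\<lambda>p. complex_of_real (- 2 * (1 / height p ^ N))) =
     of_real (integral {-R..R} (\<lambda>p. 1 / height p ^ N))"
    using eventually_gt_at_top[of 0]
  proof eventually_elim
    case (elim R)
    have "((\<lambda>p. - 2 * (1 / height p ^ N)) has_integral - 2 * integral {-R..R} (\<lambda>p. 1 / height p ^ N)) {-R..R}"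
      using has_integral_mult_right[OF integrable_integral[OF int'[OF elim]], of "-2"] by simp
    from integral_unique[OF has_integral_of_real[OF this, where 'b = complex]] show ?case by simp
  qed
  from Lim_transform_eventually[OF lim this]
  show "((\<lambda>R. of_real (integral {-R..R} (\<lambda>p. 1 / height p ^ N))) \<longlongrightarrow> - of_real pi * \<i> * origin_residue N) at_top"
    by (simp add: mult_ac)
qed

section \<open>Factorisation through Z and the residue as a kernel integral\<close>

abbreviation a :: real where "a \<equiv> sqrt sigma"

lemma a_pos: "a > 0" using sigma_pos by simp

lemma zero_in_K1: "0 \<in> K1" using q_pos[of 0] q_less[of 0] by (simp add: K1_def)

lemma Z_0: "Z 0 = - \<i> * of_real a"
  using Z_of_negative[OF zero_in_K1, of sigma] sigma_pos beta_pos
  by (simp add: S_def f_0)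

text \<open>At the origin \<open>Z 0 = - \<i> * a\<close>, so \<open>a - \<i> * Z\<close> vanishes
  there, and \<open>D\<close> is its quotient by \<open>w\<close>.\<close>

definition D :: "complex \<Rightarrow> complex" where "D = diff_quot 0 (\<lambda>w. of_real a - \<i> * Z w)"

lemma D_analytic: "D analytic_on K1"
  unfolding D_def by (intro analytic_intros Z_analytic)

lemma D_eq: "of_real a - \<i> * Z w = w * D w"
proof -
  have "of_real a - \<i> * Z 0 = 0" by (simp add: Z_0 mult.assoc[symmetric])
  thus ?thesis using diff_quot_eq[of "\<lambda>w. of_real a - \<i> * Z w" w 0] by (simp add: D_def)
qed

lemma product_eq: "w \<in> K1 \<Longrightarrow> (of_real a - \<i> * Z w) * (of_real a + \<i> * Z w) = - \<i> * f w"
proof -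
  assume w: "w \<in> K1"
  have "(of_real a - \<i> * Z w) * (of_real a + \<i> * Z w) = (of_real a)\<^sup>2 + (Z w)\<^sup>2"
    by (simp add: algebra_simps power2_eq_square)
  also have "(of_real a)\<^sup>2 = complex_of_real sigma" using sigma_pos by (simp flip: of_real_power)
  also have "(Z w)\<^sup>2 = - \<i> * f w - of_real sigma" by (simp add: Z_squared[OF w] S_def)
  finally show ?thesis by simp
qed

text \<open>Away from the origin, a zero of \<open>D\<close> would be a zero of \<open>f\<close>,
  hence above the saddle. There \<open>Z = \<i> * a\<close>, which makes \<open>a - \<i> * Z\<close>
  equal to \<open>2 * a\<close>, not zero.\<close>

lemma D_nonzero:
  assumes w: "w \<in> K1" shows "D w \<noteq> 0"
proof (cases "w = 0")
  case True
  have "isCont D 0" "isCont e 0" "isCont Z 0"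
    using D_analytic e_analytic Z_analytic zero_in_K1
    by (auto intro!: analytic_at_imp_isCont intro: analytic_on_subset)
  \<comment> \<open>Dividing \<open>product_eq\<close> by \<open>w\<close> and letting
    \<open>w\<close> tend to \<open>0\<close> relates \<open>D 0\<close> to \<open>e 0\<close>,
    which is nonzero.\<close>
  have "((\<lambda>w. D w * (of_real a + \<i> * Z w)) \<longlongrightarrow> D 0 * (of_real a + \<i> * Z 0)) (at 0)"
    using \<open>isCont D 0\<close> \<open>isCont Z 0\<close> by (intro tendsto_intros) (auto simp: isCont_def)
  moreover have "\<forall>\<^sub>F w in at 0. D w * (of_real a + \<i> * Z w) = - \<i> * e w"
  proof -
    have "open {w. - q (Re w) < Im w \<and> Im w < 2 * pi - q (Re w)}"
      by (intro open_Collect_conj open_Collect_less continuous_intros continuous_on_compose2[OF q_cont]) auto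
    hence "\<forall>\<^sub>F w in at 0. - q (Re w) < Im w \<and> Im w < 2 * pi - q (Re w)"
      using eventually_at_in_open'[of "{w. - q (Re w) < Im w \<and> Im w < 2 * pi - q (Re w)}" 0] q_pos[of 0] q_less[of 0]
      by simp
    hence "\<forall>\<^sub>F w in at 0. w \<in> K1" by eventually_elim (simp add: K1_def)
    moreover have "\<forall>\<^sub>F w in at (0 :: complex). w \<noteq> 0" by (simp add: eventually_neq_at_within)
    ultimately show ?thesis
    proof eventually_elim
      case (elim w)
      have "w * (D w * (of_real a + \<i> * Z w)) = w * (- \<i> * e w)"
        using product_eq[OF elim(1)] by (simp add: D_eq f_eq mult_ac)
      with elim(2) show ?case by (metis mult_left_cancel)
    qed
  qed
  ultimately have "((\<lambda>w. - \<i> * e w) \<longlongrightarrow> D 0 * (of_real a + \<i> * Z 0)) (at 0)"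
    by (rule Lim_transform_eventually)
  moreover have "((\<lambda>w. - \<i> * e w) \<longlongrightarrow> - \<i> * e 0) (at 0)"
    using \<open>isCont e 0\<close> by (intro tendsto_intros) (auto simp: isCont_def)
  ultimately have "D 0 * (of_real a + \<i> * Z 0) = - \<i> * e 0"
    using tendsto_unique[OF trivial_limit_at] by blast
  thus ?thesis using True e_0 by auto
next
  case False
  show ?thesis
  proof
    assume "D w = 0"
    hence Zw: "of_real a - \<i> * Z w = 0" using D_eq[of w] by simp
    hence "f w = 0" using product_eq[OF w] by simp
    hence Im: "Im w > \<beta>" using f_zero_K1[OF w _ False] by simp
    have "S w = - of_real sigma" using \<open>f w = 0\<close> by (simp add: S_def)
    hence "Z w = \<i> * of_real a" using Z_of_negative[OF w _ sigma_pos] Im by simp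
    hence "of_real a - \<i> * Z w = of_real (2 * a)" by (simp add: mult.assoc[symmetric])
    thus False using Zw a_pos by simp
  qed
qed

text \<open>The partial fractions of \<open>1 / (a^2 + Z^2) ^ N\<close> have one summand,
  \<open>\<Psi> (Z w)\<close>, that carries the whole residue at the origin. Moved to the curves it
  gives \<open>half_kernel\<close> on both, plus a term \<open>1 / height ^ N\<close> on the lower
  one, which \<open>height_limit\<close> removes.\<close>

lemma kernel_limit:
  assumes N: "odd N"
  shows "((\<lambda>R. of_real (integral {-R..R} (\<lambda>p. half_kernel a N (y1 p) + half_kernel a N (y2 p)))) \<longlongrightarrow>
    - of_real pi * \<i> * origin_residue N) at_top"
    and "R > 0 \<Longrightarrow> (\<lambda>p. half_kernel a N (y1 p) + half_kernel a N (y2 p)) integrable_on {-R..R}"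
proof -
  have N0: "N > 0" using N by (cases N) auto
  obtain P :: "complex poly" where deg: "degree P \<le> N - 1"
    and sym: "\<And>z. poly P z * (of_real a - z) ^ N + poly P (-z) * (of_real a + z) ^ N = 1"
    and P: "\<And>y. y > 0 \<Longrightarrow> of_real (half_kernel a N y) = poly P (of_real y) / (of_real y + of_real a) ^ N"
    using half_kernel_rational[OF a_pos, of N] by blast
  \<comment> \<open>The only possible pole is \<open>z = - \<i> * a\<close>, the value of
    \<open>Z\<close> at the origin. The other zeros of \<open>f\<close> in the strip have
    \<open>Z = \<i> * a\<close> and cause no pole.\<close>
  define \<Psi> where "\<Psi> z = poly P (- \<i> * z) / (of_real a - \<i> * z) ^ N" for z
  define B where "B w = poly P (- \<i> * Z w) / D w ^ N" for w
  define v where "v p = 1 / height p ^ N + (half_kernel a N (y1 p) + half_kernel a N (y2 p))" for p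
  have an: "B analytic_on K1"
    unfolding B_def poly_altdef using D_nonzero by (intro analytic_intros Z_analytic D_analytic) auto
  have FB: "B w / (w - Complex 0 0) ^ N = \<Psi> (Z w)" for w
  proof -
    have "w - Complex 0 0 = w" by (simp add: complex_eq_iff)
    thus ?thesis by (simp add: B_def \<Psi>_def D_eq power_mult_distrib mult.commute)
  qed
  have split: "poly P z / (of_real a + z) ^ N + poly P (-z) / (of_real a - z) ^ N = 1 / ((of_real a - z) * (of_real a + z)) ^ N"
    if "of_real a + z \<noteq> 0" "of_real a - z \<noteq> 0" for z
    using sym[of z] that by (simp add: divide_simps power_mult_distrib mult_ac add.commute)
  have "(\<Psi> \<longlongrightarrow> 0) at_infinity"
  proof -
    have "((\<lambda>z. poly (pcompose P [:0, - \<i>:]) z / poly ([:of_real a, - \<i>:] ^ N) z) \<longlongrightarrow> 0) at_infinity"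
    proof (rule poly_divide_tendsto_0_at_infinity)
      have "degree (pcompose P [:0, - \<i>:]) \<le> degree P * degree [:0, - \<i>:]"
        by (rule degree_pcompose_le)
      also have "\<dots> \<le> N - 1" using deg by simp
      also have "N - 1 < N" using N0 by simp
      also have "N = degree ([:of_real a, - \<i>:] ^ N)"
        by (subst degree_power_eq) auto
      finally show "degree (pcompose P [:0, - \<i>:]) < degree ([:complex_of_real a, - \<i>:] ^ N)" .
    qed
    thus ?thesis by (simp add: \<Psi>_def[abs_def] poly_pcompose poly_power mult.commute)
  qed
  note decay = Z_decay[OF this]
  have sq: "(y1 p)\<^sup>2 = sigma + height p" for p using sigma_pos height_pos[of p] by (simp add: y1_def)
  \<comment> \<open>On the lower curve \<open>- \<i> * Z\<close> is the negative number
    \<open>- y1\<close>, where the rational formula for the kernel does not apply. The partial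
    fraction identity reflects it to \<open>y1\<close>, at the price of the full term
    \<open>1 / (- height) ^ N\<close>; odd \<open>N\<close> turns that into
    \<open>- 1 / height ^ N\<close>.\<close>
  have low: "\<Psi> (Z (Complex p (- q p))) = - of_real (1 / height p ^ N + half_kernel a N (y1 p))" for p
  proof -
    let ?y = "complex_of_real (y1 p)"
    have Z: "- \<i> * Z (Complex p (- q p)) = - ?y" "of_real a - \<i> * Z (Complex p (- q p)) = of_real a - ?y"
      unfolding Z_low y1_def[symmetric] by (simp_all add: mult.assoc[symmetric])
    have "y1 p \<noteq> a"
      using sq[of p] height_pos[of p] sigma_pos by (metis add_cancel_left_right less_irrefl real_sqrt_pow2 less_imp_le)
    hence ne: "of_real a - ?y \<noteq> 0" by simp
    have "a + y1 p \<noteq> 0" using add_pos_pos[OF a_pos y1_pos[of p]] by linarith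
    hence ne2: "of_real a + ?y \<noteq> 0" by (metis of_real_add of_real_eq_0_iff)
    have "(of_real a - ?y) * (of_real a + ?y) = (of_real a)\<^sup>2 - ?y\<^sup>2"
      by (simp add: algebra_simps power2_eq_square)
    also have "\<dots> = of_real (a\<^sup>2 - (y1 p)\<^sup>2)" by (simp only: of_real_diff of_real_power)
    also have "a\<^sup>2 - (y1 p)\<^sup>2 = - height p" using sq[of p] sigma_pos by simp
    finally have "poly P ?y / (of_real a + ?y) ^ N + poly P (- ?y) / (of_real a - ?y) ^ N = 1 / (of_real (- height p)) ^ N"
      using split[OF ne2 ne] by simp
    moreover have "\<Psi> (Z (Complex p (- q p))) = poly P (- ?y) / (of_real a - ?y) ^ N"
      unfolding \<Psi>_def Z ..
    moreover have "poly P ?y / (of_real a + ?y) ^ N = of_real (half_kernel a N (y1 p))"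
      using P[OF y1_pos] by (simp add: add.commute)
    moreover have "1 / (of_real (- height p)) ^ N = - complex_of_real (1 / height p ^ N)"
      using N by simp
    ultimately show ?thesis by (simp add: algebra_simps add_eq_0_iff)
  qed
  have up: "\<Psi> (Z (Complex p (2 * pi - q p))) = of_real (half_kernel a N (y2 p))" for p
  proof -
    have Z: "- \<i> * Z (Complex p (2 * pi - q p)) = of_real (y2 p)"
      "of_real a - \<i> * Z (Complex p (2 * pi - q p)) = of_real (y2 p) + of_real a"
      unfolding Z_up y2_def[symmetric] by (simp_all add: mult.assoc[symmetric])
    show ?thesis unfolding \<Psi>_def Z P[OF y2_pos] ..
  qed
  have val: "\<Psi> (Z (Complex p (- q p))) - \<Psi> (Z (Complex p (2 * pi - q p))) = (- 1) * of_real (v p)" for p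
    unfolding low up v_def by simp
  \<comment> \<open>The other summand, \<open>C\<close>, is holomorphic near the origin because
    \<open>a + \<i> * Z 0 = 2 * a\<close> is nonzero, so it contributes no residue.\<close>
  have res: "residue (\<lambda>w. B w / (w - Complex 0 0) ^ N) (Complex 0 0) = origin_residue N"
  proof -
    define C where "C w = poly P (\<i> * Z w) / (of_real a + \<i> * Z w) ^ N" for w
    have zero: "Complex 0 0 = 0" by (simp add: complex_eq_iff)
    have "of_real a + \<i> * Z 0 = of_real (2 * a)" by (simp add: Z_0 mult.assoc[symmetric])
    hence ne0: "of_real a + \<i> * Z 0 \<noteq> 0" using a_pos by simp
    have "open {w. - q (Re w) < Im w \<and> Im w < 2 * pi - q (Re w)}" (is "open ?U")
      by (intro open_Collect_conj open_Collect_less continuous_intros continuous_on_compose2[OF q_cont]) auto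
    have UK: "?U \<subseteq> K1" by (auto simp: K1_def)
    have ZU: "Z holomorphic_on ?U" "D holomorphic_on ?U"
      using Z_analytic D_analytic UK by (auto intro!: analytic_imp_holomorphic intro: analytic_on_subset)
    define A where "A = ?U \<inter> (\<lambda>w. of_real a + \<i> * Z w) -` (- {0})"
    have A: "open A" unfolding A_def
      using \<open>open ?U\<close> ZU by (intro continuous_open_preimage continuous_intros holomorphic_on_imp_continuous_on) auto
    have A0: "0 \<in> A" using ne0 q_pos[of 0] q_less[of 0] by (simp add: A_def)
    have AU: "A \<subseteq> ?U" by (auto simp: A_def)
    have AZ: "Z holomorphic_on A" "D holomorphic_on A" using ZU AU by (auto intro: holomorphic_on_subset)
    have C: "C holomorphic_on A" unfolding C_def
      by (intro holomorphic_intros AZ) (auto simp: A_def)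
    have Bh: "(\<lambda>w. B w / w ^ N) holomorphic_on A - {0}" unfolding B_def
      using AU UK D_nonzero AZ by (auto intro!: holomorphic_intros intro: holomorphic_on_subset)
    have "origin_residue N = residue (\<lambda>w. B w / w ^ N + C w) 0"
      unfolding origin_residue_def
    proof (rule residue_cong)
      have "\<forall>\<^sub>F w in at 0. w \<in> A - {0}" using A A0 by (rule eventually_at_in_open)
      thus "\<forall>\<^sub>F w in at 0. (\<i> / e w) ^ N / w ^ N = B w / w ^ N + C w"
      proof eventually_elim
        case (elim w)
        hence w: "w \<in> K1" "w \<noteq> 0" "of_real a + \<i> * Z w \<noteq> 0" using AU UK by (auto simp: A_def)
        have ne: "of_real a - \<i> * Z w \<noteq> 0" using D_eq[of w] D_nonzero[OF w(1)] w(2) by simp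
        have pr: "(of_real a - \<i> * Z w) * (of_real a + \<i> * Z w) = - \<i> * f w" by (rule product_eq[OF w(1)])
        hence "f w \<noteq> 0" using ne w by auto
        hence "e w \<noteq> 0" using f_eq[of w] by auto
        hence "(\<i> / e w) ^ N / w ^ N = 1 / (- \<i> * f w) ^ N"
          using w(2) by (rule over_e_power)
        also have "\<dots> = 1 / ((of_real a - - \<i> * Z w) * (of_real a + - \<i> * Z w)) ^ N"
          unfolding pr[symmetric] by (simp add: mult.commute)
        also have "\<dots> = poly P (- \<i> * Z w) / (of_real a + - \<i> * Z w) ^ N + poly P (- (- \<i> * Z w)) / (of_real a - - \<i> * Z w) ^ N"
          by (rule split[symmetric]) (use w ne in auto)
        also have "\<dots> = B w / w ^ N + C w"
          by (simp add: B_def C_def D_eq power_mult_distrib mult.commute)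
        finally show ?case .
      qed
    qed simp
    also have "\<dots> = residue (\<lambda>w. B w / w ^ N) 0 + residue C 0"
      using C by (intro residue_add[OF A A0 Bh]) (auto intro: holomorphic_on_subset)
    also have "residue C 0 = 0" by (rule residue_holo[OF A A0 C])
    finally show ?thesis unfolding zero by simp
  qed
  have ev: "v (-p) = v p" for p by (simp add: v_def)
  note L = K1_limit[OF beta_bounds(3,4) an N0 FB decay val _ ev, unfolded res]
  \<comment> \<open>The integral of \<open>v\<close> accounts for \<open>- 2 * pi * \<i>\<close>
    times the residue and that of \<open>1 / height ^ N\<close> for half of it; their difference is
    the kernel integral.\<close>
  have lim: "((\<lambda>R. of_real (integral {-R..R} v) - of_real (integral {-R..R} (\<lambda>p. 1 / height p ^ N))) \<longlongrightarrow>
      2 * of_real pi * \<i> * origin_residue N / (- 1) - (- of_real pi * \<i> * origin_residue N)) at_top"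
    by (intro tendsto_diff L(1) height_limit[OF N]) auto
  have vint: "v integrable_on {-R..R}" if "R > 0" for R
    by (rule L(2)) (use that in auto)
  have int: "((\<lambda>p. half_kernel a N (y1 p) + half_kernel a N (y2 p)) has_integral
      integral {-R..R} v - integral {-R..R} (\<lambda>p. 1 / height p ^ N)) {-R..R}" if "R > 0" for R
    using has_integral_diff[OF integrable_integral[OF vint[OF that]] integrable_integral[OF height_limit(2)[OF N that]]]
    by (simp add: v_def)
  show "R > 0 \<Longrightarrow> (\<lambda>p. half_kernel a N (y1 p) + half_kernel a N (y2 p)) integrable_on {-R..R}"
    using int by blast
  have "\<forall>\<^sub>F R in at_top. complex_of_real (integral {-R..R} v) - of_real (integral {-R..R} (\<lambda>p. 1 / height p ^ N)) =
     of_real (integral {-R..R} (\<lambda>p. half_kernel a N (y1 p) + half_kernel a N (y2 p)))"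
    using eventually_gt_at_top[of 0]
  proof eventually_elim
    case (elim R)
    show ?case using integral_unique[OF int[OF elim]] by simp
  qed
  from Lim_transform_eventually[OF lim this]
  show "((\<lambda>R. of_real (integral {-R..R} (\<lambda>p. half_kernel a N (y1 p) + half_kernel a N (y2 p)))) \<longlongrightarrow>
    - of_real pi * \<i> * origin_residue N) at_top"
    by (simp add: algebra_simps)
qed

text \<open>The pointwise bound \<open>half_kernel_enveloped\<close> is integrated along both curves
  over \<open>- R \<le> p \<le> R\<close>, and then \<open>R\<close> tends to infinity.\<close>

theorem residue_enveloped:
  assumes N: "odd N" and M: "M < N"
  shows "norm (- of_real pi * \<i> * origin_residue N -
      (\<Sum>m<M. of_real (2 * pi * half_kernel_moment a N m) * saddle_residue m))
    \<le> norm (of_real (2 * pi * half_kernel_moment a N M) * saddle_residue M)"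
proof -
  let ?L = "\<lambda>m R. integral {-R..R} (\<lambda>p. 1 / y1 p ^ (2 * m + 1) + 1 / y2 p ^ (2 * m + 1))"
  let ?T = "\<lambda>R. integral {-R..R} (\<lambda>p. half_kernel a N (y1 p) + half_kernel a N (y2 p))"
  let ?t = "half_kernel_moment a N"
  \<comment> \<open>The alternating sign of the kernel expansion cancels the sign in
    \<open>moment_limit\<close>.\<close>
  have t_sgn: "(-1) ^ m * complex_of_real (?t m) * (2 * of_real pi * (-1) ^ m * saddle_residue m) = of_real (2 * pi * ?t m) * saddle_residue m" for m
    by (cases "even m") simp_all
  have "((\<lambda>R. of_real (?T R) - (\<Sum>m<M. (-1) ^ m * of_real (?t m) * of_real (?L m R))) \<longlongrightarrow>
     - of_real pi * \<i> * origin_residue N - (\<Sum>m<M. (-1) ^ m * of_real (?t m) * (2 * of_real pi * (-1) ^ m * saddle_residue m))) at_top"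
    by (intro tendsto_diff tendsto_sum tendsto_mult tendsto_const moment_limit kernel_limit[OF N])
  hence 1: "((\<lambda>R. norm (of_real (?T R) - (\<Sum>m<M. (-1) ^ m * complex_of_real (?t m) * of_real (?L m R)))) \<longlongrightarrow>
     norm (- of_real pi * \<i> * origin_residue N - (\<Sum>m<M. of_real (2 * pi * ?t m) * saddle_residue m))) at_top"
    unfolding t_sgn by (rule tendsto_norm)
  have "((\<lambda>R. of_real (?t M) * of_real (?L M R)) \<longlongrightarrow> of_real (?t M) * (2 * of_real pi * (-1) ^ M * saddle_residue M)) at_top"
    by (intro tendsto_mult tendsto_const moment_limit)
  hence 2: "((\<lambda>R. norm (complex_of_real (?t M) * of_real (?L M R))) \<longlongrightarrow> norm (of_real (?t M) * (2 * of_real pi * (-1) ^ M * saddle_residue M))) at_top"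
    by (rule tendsto_norm)
  have "\<forall>\<^sub>F R in at_top. norm (of_real (?T R) - (\<Sum>m<M. (-1) ^ m * complex_of_real (?t m) * of_real (?L m R)))
     \<le> norm (complex_of_real (?t M) * of_real (?L M R))"
    using eventually_gt_at_top[of 0]
  proof eventually_elim
    case (elim R)
    let ?w = "\<lambda>m p. 1 / y1 p ^ (2 * m + 1) + 1 / y2 p ^ (2 * m + 1)"
    have 1: "((\<lambda>p. (half_kernel a N (y1 p) + half_kernel a N (y2 p)) - (\<Sum>m<M. (-1) ^ m * ?t m * ?w m p)) has_integral
       (?T R - (\<Sum>m<M. (-1) ^ m * ?t m * ?L m R))) {-R..R}" (is "(?d has_integral _) _")
      by (intro has_integral_diff has_integral_sum has_integral_mult_right integrable_integral
          kernel_limit(2)[OF N] moment_limit(2) elim) auto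
    have 2: "((\<lambda>p. ?t M * ?w M p) has_integral ?t M * ?L M R) {-R..R}"
      by (intro has_integral_mult_right integrable_integral moment_limit(2) elim)
    have bd: "\<bar>?d p\<bar> \<le> ?t M * ?w M p" for p
    proof -
      have "?d p = (half_kernel a N (y1 p) - (\<Sum>m<M. (-1) ^ m * ?t m / y1 p ^ (2 * m + 1))) +
         (half_kernel a N (y2 p) - (\<Sum>m<M. (-1) ^ m * ?t m / y2 p ^ (2 * m + 1)))"
        by (simp add: distrib_left sum.distrib)
      also have "\<bar>\<dots>\<bar> \<le> ?t M / y1 p ^ (2 * M + 1) + ?t M / y2 p ^ (2 * M + 1)"
        by (intro order.trans[OF abs_triangle_ineq] add_mono half_kernel_enveloped a_pos y1_pos y2_pos M)
      finally show ?thesis by (simp add: distrib_left)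
    qed
    have "?T R - (\<Sum>m<M. (-1) ^ m * ?t m * ?L m R) \<le> ?t M * ?L M R"
      by (rule has_integral_le[OF 1 2]) (use bd in \<open>simp add: abs_le_iff\<close>)
    moreover have "- (?T R - (\<Sum>m<M. (-1) ^ m * ?t m * ?L m R)) \<le> ?t M * ?L M R"
      by (rule has_integral_le[OF has_integral_neg[OF 1] 2]) (use bd in \<open>simp only: abs_le_iff\<close>)
    ultimately have "\<bar>?T R - (\<Sum>m<M. (-1) ^ m * ?t m * ?L m R)\<bar> \<le> \<bar>?t M * ?L M R\<bar>" by linarith
    moreover have "of_real (?T R) - (\<Sum>m<M. (-1) ^ m * complex_of_real (?t m) * of_real (?L m R)) =
       of_real (?T R - (\<Sum>m<M. (-1) ^ m * ?t m * ?L m R))" by simp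
    moreover have "complex_of_real (?t M) * of_real (?L M R) = of_real (?t M * ?L M R)" by simp
    ultimately show ?case by (simp only: norm_of_real)
  qed
  from tendsto_le[OF trivial_limit_at_top_linorder 2 1 this]
  show ?thesis by (simp add: norm_mult norm_power mult_ac)
qed

end

subsection \<open>The two coefficient families\<close>

context debye
begin

text \<open>The addition theorem at the saddle, where \<open>cosh\<close> is
  \<open>cos \<beta>\<close> and \<open>sinh\<close> is \<open>\<i> * sin \<beta>\<close>,
  identifies the denominator in \<open>debye_U\<close> as a multiple of \<open>S\<close> moved to
  the origin.\<close>

lemma cot_S: "of_real (cot \<beta>) * S (s + saddle) = \<i> * of_real (cot \<beta>) * (s - sinh s) + cosh s - 1"
proof -
  have "S (s + saddle) = - \<i> * ((sinh s * of_real (cos \<beta>) + cosh s * (\<i> * of_real (sin \<beta>))) / of_real (cos \<beta>) - (s + saddle)) - of_real sigma"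
    by (simp add: S_def f_def sinh_add cosh_saddle sinh_saddle)
  also have "\<dots> = - \<i> * (sinh s - s) + of_real (tan \<beta>) * (cosh s - 1)"
  proof -
    have "saddle = \<i> * of_real \<beta>" by (simp add: complex_eq_iff)
    thus ?thesis using cos_pos by (simp add: sigma_def tan_def field_simps)
  qed
  finally have S: "S (s + saddle) = - \<i> * (sinh s - s) + of_real (tan \<beta>) * (cosh s - 1)" .
  have "of_real (cot \<beta>) * S (s + saddle) =
      \<i> * of_real (cot \<beta>) * (s - sinh s) + of_real (cot \<beta> * tan \<beta>) * (cosh s - 1)"
    unfolding S by (simp add: algebra_simps)
  moreover have "cot \<beta> * tan \<beta> = 1" using cos_pos sin_pos by (simp add: cot_def tan_def)
  ultimately show ?thesis by simp
qed

text \<open>Derivatives at the saddle call for an open set on which the branch in \<open>k\<close>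
  is analytic.\<close>

definition regular :: "complex set" where "regular = h -` (- \<real>\<^sub>\<le>\<^sub>0)"

lemma open_regular: "open regular" and saddle_regular: "saddle \<in> regular"
proof -
  have "continuous_on UNIV h"
    by (intro holomorphic_on_imp_continuous_on analytic_imp_holomorphic h_analytic)
  thus "open regular" unfolding regular_def
    by (intro open_vimage) (auto simp: open_Compl closed_nonpos_Reals_complex)
  have "Re (h saddle) = tan \<beta> / 2" unfolding h_saddle by simp
  thus "saddle \<in> regular" using tan_pos by (simp add: regular_def complex_nonpos_Reals_iff)
qed

text \<open>By \<open>cot_S\<close> the denominator is
  \<open>cot \<beta> * s^2 * h (s + saddle)\<close>, so \<open>s^2\<close> cancels off the origin
  and the continued function is the limit.\<close>

lemma debye_base:
  assumes "s + saddle \<in> regular"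
  shows "remove_sings (\<lambda>s. (1 / 2) * (s ^ 2 / (\<i> * of_real (cot \<beta>) * (s - sinh s) + cosh s - 1))) s =
     of_real (tan \<beta> / 2) / h (s + saddle)"
proof (rule remove_sings_eqI)
  let ?U = "{s. s + saddle \<in> regular}"
  have "?U = (\<lambda>s. s + saddle) -` regular" by auto
  hence U: "open ?U" using open_regular by (auto intro!: open_vimage continuous_intros)
  have nz: "h (t + saddle) \<noteq> 0" if "t \<in> ?U" for t using that by (auto simp: regular_def)
  have "isCont (\<lambda>s. h (s + saddle)) s"
  proof (rule isCont_o2[of s "\<lambda>s. s + saddle" h])
    show "isCont h (s + saddle)" by (rule analytic_at_imp_isCont[OF h_analytic])
  qed (intro continuous_intros)
  hence "((\<lambda>s. of_real (tan \<beta> / 2) / h (s + saddle)) \<longlongrightarrow> of_real (tan \<beta> / 2) / h (s + saddle)) (at s)"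
    using nz assms by (intro tendsto_intros) (auto simp: isCont_def)
  moreover have "\<forall>\<^sub>F t in at s. of_real (tan \<beta> / 2) / h (t + saddle) =
      (1 / 2) * (t ^ 2 / (\<i> * of_real (cot \<beta>) * (t - sinh t) + cosh t - 1))"
  proof -
    have "\<forall>\<^sub>F t in at s. t \<in> ?U" using U assms eventually_at_in_open'[OF U] by simp
    moreover have "\<forall>\<^sub>F t in at s. t \<noteq> 0" by (rule eventually_neq_at_within)
    ultimately show ?thesis
    proof eventually_elim
      case (elim t)
      have "\<i> * of_real (cot \<beta>) * (t - sinh t) + cosh t - 1 = of_real (cot \<beta>) * (t\<^sup>2 * h (t + saddle))"
        unfolding cot_S[symmetric] by (simp add: S_eq)
      moreover have "complex_of_real (tan \<beta> / 2) / h (t + saddle) =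
          (1 / 2) * (t\<^sup>2 / (of_real (cot \<beta>) * (t\<^sup>2 * h (t + saddle))))"
      proof -
        have "tan \<beta> / 2 = 1 / (2 * cot \<beta>)" by (simp add: cot_def tan_def)
        hence "complex_of_real (tan \<beta> / 2) = 1 / (2 * of_real (cot \<beta>))" by simp
        thus ?thesis using elim(2) by simp
      qed
      ultimately show ?case by simp
    qed
  qed
  ultimately show "((\<lambda>s. (1 / 2) * (s ^ 2 / (\<i> * of_real (cot \<beta>) * (s - sinh s) + cosh s - 1))) \<longlongrightarrow>
     of_real (tan \<beta> / 2) / h (s + saddle)) (at s)"
    by (rule Lim_transform_eventually)
qed

text \<open>As \<open>h w\<close> avoids the cut and \<open>tan \<beta> / 2\<close> is positive, the
  principal logarithm of the quotient is the difference of the logarithms. The principal power is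
  thus the same branch as the one in \<open>k\<close>.\<close>

lemma debye_base_powr:
  assumes "w \<in> regular"
  shows "(of_real (tan \<beta> / 2) / h w) powr (of_nat m + 1 / 2) =
    of_real ((tan \<beta> / 2) ^ m * sqrt (tan \<beta> / 2)) * (1 / k w) ^ (2 * m + 1)"
proof -
  define c where "c = tan \<beta> / 2"
  have c: "c > 0" using tan_pos by (simp add: c_def)
  have h: "h w \<notin> \<real>\<^sub>\<le>\<^sub>0" "h w \<noteq> 0" using assms by (auto simp: regular_def)
  have "Ln (of_real c / h w) = of_real (ln c) - Ln (h w)"
    using Ln_times_of_real[OF c, of "inverse (h w)"] Ln_inverse[OF h(1)] h(2) Ln_of_real[OF c]
    by (simp add: divide_inverse)
  hence "(of_real c / h w) powr (of_nat m + 1 / 2) = exp ((of_nat m + 1 / 2) * (of_real (ln c) - Ln (h w)))"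
    using c h by (simp add: powr_def)
  also have "(of_nat m + 1 / 2) * (of_real (ln c) - Ln (h w)) =
     of_real ((real m + 1/2) * ln c) - of_nat (2 * m + 1) * (Ln (h w) / 2)"
    by (simp add: algebra_simps)
  also have "exp \<dots> = of_real (exp ((real m + 1/2) * ln c)) / k w ^ (2 * m + 1)"
    unfolding exp_diff k_def exp_of_nat_mult exp_of_real ..
  also have "exp ((real m + 1/2) * ln c) = c powr (real m + 1/2)" using c by (simp add: powr_def)
  also have "\<dots> = c ^ m * sqrt c" using c by (simp add: powr_add powr_realpow powr_half_sqrt)
  finally show ?thesis unfolding c_def by (simp add: power_one_over)
qed

text \<open>The derivative of order \<open>2 * m\<close> is \<open>(2 * m)!\<close> times a residue
  at the saddle. Since \<open>cot \<beta> * tan \<beta> = 1\<close>, the powers of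
  \<open>cot \<beta>\<close> cancel against those from the base.\<close>

lemma debye_U_eq:
  "debye_U m (\<i> * of_real (cot \<beta>)) =
     (- \<i>) ^ m * of_real (fact (2 * m) / (4 ^ m * fact m) * sqrt (tan \<beta> / 2)) * saddle_residue m"
proof -
  define C where "C = complex_of_real ((tan \<beta> / 2) ^ m * sqrt (tan \<beta> / 2))"
  define B where "B w = (1 / k w) ^ (2 * m + 1)" for w
  have B: "B holomorphic_on regular" unfolding B_def k_def
    by (intro holomorphic_intros analytic_imp_holomorphic[OF h_analytic]) (auto simp: regular_def)
  have sh: "open ((\<lambda>s. s + saddle) -` regular)" using open_regular by (intro open_vimage continuous_intros)
  have "\<forall>\<^sub>F s in nhds 0. s + saddle \<in> regular"
    using eventually_nhds_in_open[OF sh, of 0] saddle_regular by simp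
  hence "\<forall>\<^sub>F s in nhds 0. (remove_sings (\<lambda>s. (1 / 2) * (s ^ 2 / (\<i> * of_real (cot \<beta>) * (s - sinh s) + cosh s - 1))) s)
     powr (of_nat m + 1 / 2) = C * B (1 * s + saddle)"
    by eventually_elim (simp only: debye_base debye_base_powr C_def B_def mult_1)
  hence "(deriv ^^ (2 * m)) (\<lambda>s. (remove_sings (\<lambda>s. (1 / 2) * (s ^ 2 / (\<i> * of_real (cot \<beta>) * (s - sinh s) + cosh s - 1))) s)
     powr (of_nat m + 1 / 2)) 0 = (deriv ^^ (2 * m)) (\<lambda>s. C * B (1 * s + saddle)) 0"
    by (rule higher_deriv_cong_ev) simp
  also have "\<dots> = C * (deriv ^^ (2 * m)) (\<lambda>s. B (1 * s + saddle)) 0"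
  proof (rule higher_deriv_cmult[OF _ _ sh])
    show "(\<lambda>s. B (1 * s + saddle)) holomorphic_on (\<lambda>s. s + saddle) -` regular"
      by (rule holomorphic_on_compose_gen[OF _ B, unfolded o_def]) (auto intro!: holomorphic_intros)
  qed (use saddle_regular in simp)
  \<comment> \<open>The explicit factor \<open>1 *\<close> gives the translation the linear form
    that the chain rule for higher derivatives expects.\<close>
  also have "(deriv ^^ (2 * m)) (\<lambda>s. B (1 * s + saddle)) 0 = 1 ^ (2 * m) * (deriv ^^ (2 * m)) B (1 * 0 + saddle)"
    by (rule higher_deriv_compose_linear'[OF B sh open_regular]) (use saddle_regular in auto)
  also have "(deriv ^^ (2 * m)) B (1 * 0 + saddle) = fact (2 * m) * saddle_residue m"
    using residue_holomorphic_over_power[OF open_regular saddle_regular B, of "2 * m"]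
    by (simp add: saddle_residue_def B_def)
  finally have D: "(deriv ^^ (2 * m)) (\<lambda>s. (remove_sings (\<lambda>s. (1 / 2) * (s ^ 2 / (\<i> * of_real (cot \<beta>) * (s - sinh s) + cosh s - 1))) s)
     powr (of_nat m + 1 / 2)) 0 = C * (fact (2 * m) * saddle_residue m)" by simp
  have "debye_U m (\<i> * of_real (cot \<beta>)) =
     (-1) ^ m * ((\<i> * of_real (cot \<beta>)) ^ m / (2 ^ m * fact m)) * (C * (fact (2 * m) * saddle_residue m))"
    unfolding debye_U_def D ..
  also have "\<dots> = (- \<i>) ^ m * (of_real (cot \<beta> ^ m * (tan \<beta> / 2) ^ m) * of_real (sqrt (tan \<beta> / 2)) *
      fact (2 * m) / (2 ^ m * fact m) * saddle_residue m)"
    by (simp add: C_def power_mult_distrib power_minus[of \<i>])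
  also have "cot \<beta> ^ m * (tan \<beta> / 2) ^ m = 1 / 2 ^ m"
    using cos_pos sin_pos by (simp add: power_mult_distrib[symmetric] cot_def tan_def power_one_over)
  also have "(- \<i>) ^ m * (complex_of_real (1 / 2 ^ m) * of_real (sqrt (tan \<beta> / 2)) * fact (2 * m) / (2 ^ m * fact m) * saddle_residue m) =
     (- \<i>) ^ m * of_real (fact (2 * m) / (4 ^ m * fact m) * sqrt (tan \<beta> / 2)) * saddle_residue m"
  proof -
    have "(4 :: complex) ^ m = 2 ^ m * 2 ^ m" by (simp flip: power_mult_distrib)
    thus ?thesis by (simp add: mult_ac)
  qed
  finally show ?thesis .
qed

text \<open>The derivative is a Taylor coefficient of \<open>(1 / e) ^ (2 * n + 1)\<close>, hence a
  residue. The right side is arranged around the expression that \<open>residue_enveloped\<close>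
  expands.\<close>

lemma anger_weber_eq:
  "- fact (2 * n) * anger_weber_coeff n (- of_real (1 / cos \<beta>)) =
     fact (2 * n) * (-1) ^ n / of_real pi * (- of_real pi * \<i> * origin_residue (2 * n + 1))"
proof -
  define B where "B w = (1 / e w) ^ (2 * n + 1)" for w
  define A where "A = e -` (- {0})"
  have "continuous_on UNIV e"
    by (intro holomorphic_on_imp_continuous_on analytic_imp_holomorphic e_analytic)
  hence A: "open A" unfolding A_def by (intro open_vimage) auto
  have A0: "0 \<in> A" using e_0 by (simp add: A_def)
  have B: "B holomorphic_on A" unfolding B_def
    by (intro holomorphic_intros analytic_imp_holomorphic[OF e_analytic]) (auto simp: A_def)
  have rs: "remove_sings (\<lambda>s. s / ((- (- of_real (1 / cos \<beta>))) * sinh s - s)) s = 1 / e s" if "s \<in> A" for s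
  proof (rule remove_sings_eqI)
    have "isCont e s" using analytic_at_imp_isCont[OF e_analytic] .
    hence "((\<lambda>t. 1 / e t) \<longlongrightarrow> 1 / e s) (at s)"
      using that by (intro tendsto_intros) (auto simp: isCont_def A_def)
    moreover have "\<forall>\<^sub>F t in at s. 1 / e t = t / ((- (- of_real (1 / cos \<beta>))) * sinh t - t)"
    proof -
      have "\<forall>\<^sub>F t in at s. t \<in> A" using eventually_at_in_open'[OF A that] .
      moreover have "\<forall>\<^sub>F t in at s. t \<noteq> 0" by (rule eventually_neq_at_within)
      ultimately show ?thesis
      proof eventually_elim
        case (elim t)
        have "(- (- of_real (1 / cos \<beta>))) * sinh t - t = f t" by (simp add: f_def)
        thus ?case using elim by (simp add: f_eq)
      qed
    qed
    ultimately show "((\<lambda>s. s / ((- (- of_real (1 / cos \<beta>))) * sinh s - s)) \<longlongrightarrow> 1 / e s) (at s)"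
      by (rule Lim_transform_eventually)
  qed
  have "\<forall>\<^sub>F s in nhds 0. s \<in> A" using eventually_nhds_in_open[OF A A0] .
  hence "\<forall>\<^sub>F s in nhds 0. (remove_sings (\<lambda>s. s / ((- (- of_real (1 / cos \<beta>))) * sinh s - s)) s) ^ (2 * n + 1) = B s"
    by eventually_elim (simp only: rs B_def)
  hence "(deriv ^^ (2 * n)) (\<lambda>t. (remove_sings (\<lambda>s. s / ((- (- of_real (1 / cos \<beta>))) * sinh s - s)) t) ^ (2 * n + 1)) 0 =
     (deriv ^^ (2 * n)) B 0" by (rule higher_deriv_cong_ev) simp
  hence 1: "- fact (2 * n) * anger_weber_coeff n (- of_real (1 / cos \<beta>)) = (deriv ^^ (2 * n)) B 0"
    by (simp add: anger_weber_coeff_def)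
  \<comment> \<open>The factor \<open>\<i> ^ (2 * n + 1) = \<i> * (-1) ^ n\<close> is where the sign
    \<open>(-1) ^ n\<close> of the prefactor originates.\<close>
  have B': "(\<lambda>w. \<i> ^ (2 * n + 1) * B w) holomorphic_on A" by (intro holomorphic_intros B)
  have "origin_residue (2 * n + 1) = residue (\<lambda>w. \<i> ^ (2 * n + 1) * B w / w ^ Suc (2 * n)) 0"
    by (simp add: origin_residue_def B_def power_divide)
  also have "\<dots> = (deriv ^^ (2 * n)) (\<lambda>w. \<i> ^ (2 * n + 1) * B w) 0 / fact (2 * n)"
    by (rule residue_holomorphic_over_power'[OF A A0 B'])
  also have "(deriv ^^ (2 * n)) (\<lambda>w. \<i> ^ (2 * n + 1) * B w) 0 = \<i> ^ (2 * n + 1) * (deriv ^^ (2 * n)) B 0"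
    by (rule higher_deriv_cmult[OF B A0 A])
  finally have 2: "origin_residue (2 * n + 1) = \<i> * (-1) ^ n * (deriv ^^ (2 * n)) B 0 / fact (2 * n)"
    by (simp add: power_mult)
  have "(-1 :: complex) ^ n * (-1) ^ n = 1" by (simp flip: power_mult_distrib)
  thus ?thesis unfolding 1 2 by (simp add: mult_ac)
qed

section \<open>Matching the constants and the enveloped expansion\<close>

definition prefactor :: "nat \<Rightarrow> real" where
  "prefactor n = sqrt (2 * cot \<beta> / (pi * sigma)) * ((-1) ^ n * Gamma (2 * real n + 1 / 2) / sigma ^ (2 * n))"

definition debye_term :: "nat \<Rightarrow> nat \<Rightarrow> complex" where
  "debye_term n m = (\<i> * of_real sigma) ^ m * debye_U m (\<i> * of_real (cot \<beta>)) *
     of_real (Gamma (2 * real n - real m + 1 / 2) / Gamma (2 * real n + 1 / 2))"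

lemma prefactor_nonzero: "prefactor n \<noteq> 0"
proof -
  have "cot \<beta> > 0" using cos_pos sin_pos by (simp add: cot_def)
  moreover have "Gamma (2 * real n + 1 / 2) > 0" by (rule Gamma_real_pos) simp
  hence "Gamma (2 * real n + 1 / 2) \<noteq> 0" by linarith
  ultimately show ?thesis using sigma_pos by (simp add: prefactor_def)
qed

text \<open>For \<open>N = 2 * n + 1\<close> the moment contains
  \<open>wallis m (2 * n - m)\<close>. Of its Gamma factors, that at \<open>m + 1/2\<close> matches
  the factorials of \<open>debye_U_eq\<close>, that at \<open>2 * n - m + 1/2\<close> stays, and the
  denominator cancels \<open>fact (2 * n)\<close>.\<close>

lemma moment_eq:
  assumes m: "m \<le> 2 * n"
  shows "2 * fact (2 * n) * half_kernel_moment a (2 * n + 1) m =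
     sqrt (2 * cot \<beta> / (pi * sigma)) * (sigma ^ m / sigma ^ (2 * n)) *
     (fact (2 * m) / (4 ^ m * fact m) * sqrt (tan \<beta> / 2)) * Gamma (2 * real n - real m + 1 / 2)"
proof -
  define G where "G = Gamma (2 * real n - real m + 1 / 2)"
  define F :: real where "F = fact (2 * m) / (4 ^ m * fact m)"
  have W: "wallis m (2 * n - m) = F * sqrt pi * G / (2 * fact (2 * n))"
  proof -
    have "real m + real (2 * n - m) + 1 = 1 + real (2 * n)"
      "real (2 * n - m) + 1 / 2 = 2 * real n - real m + 1 / 2"
      using m by (simp_all add: of_nat_diff)
    hence "wallis m (2 * n - m) = Gamma (real m + 1/2) * G / (2 * Gamma (1 + real (2 * n)))"
      unfolding wallis_Gamma G_def by (simp only:)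
    also have "Gamma (1 + real (2 * n)) = fact (2 * n)" by (rule Gamma_fact)
    finally show ?thesis unfolding Gamma_half F_def by simp
  qed
  have a2: "a ^ (2 * j) = sigma ^ j" for j using sigma_pos by (simp add: power_mult)
  \<comment> \<open>The trigonometric parts of the prefactor and of \<open>debye_U_eq\<close>
    combine through \<open>cot \<beta> * tan \<beta> = 1\<close>.\<close>
  have sq: "sqrt (2 * cot \<beta> / (pi * sigma)) * sqrt (tan \<beta> / 2) = 1 / (sqrt pi * a)"
  proof -
    have "(2 * cot \<beta> / (pi * sigma)) * (tan \<beta> / 2) = 1 / (pi * sigma)"
      using cos_pos sin_pos by (simp add: cot_def tan_def)
    hence "sqrt (2 * cot \<beta> / (pi * sigma)) * sqrt (tan \<beta> / 2) = sqrt (1 / (pi * sigma))"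
      by (simp only: real_sqrt_mult[symmetric])
    thus ?thesis by (simp add: real_sqrt_mult real_sqrt_divide)
  qed
  have "2 * fact (2 * n) * half_kernel_moment a (2 * n + 1) m =
     2 * fact (2 * n) * (a / (pi * (sigma * sigma ^ (2 * n))) * (sigma ^ m * wallis m (2 * n - m)))"
    unfolding half_kernel_moment_def a2 by simp
  also have "\<dots> = a / (pi * sigma) * (sigma ^ m / sigma ^ (2 * n)) * (F * sqrt pi * G)"
    unfolding W by simp
  also have "a / (pi * sigma) * (sigma ^ m / sigma ^ (2 * n)) * (F * sqrt pi * G) =
     1 / (sqrt pi * a) * (sigma ^ m / sigma ^ (2 * n)) * (F * G)"
  proof -
    have "x / (p * p * (x * x)) * p = 1 / (p * x)" if "p \<noteq> 0" "x \<noteq> 0" for p x :: real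
      using that by simp
    from this[of "sqrt pi" a] have "a / (pi * sigma) * sqrt pi = 1 / (sqrt pi * a)"
      using sigma_pos by simp
    moreover have "x * y * (u * v * w) = x * v * y * (u * w)" for x y u v w :: real
      by (simp only: mult_ac)
    ultimately show ?thesis by (simp only:)
  qed
  finally show ?thesis unfolding sq[symmetric] G_def[symmetric] F_def[symmetric] by (simp add: mult_ac)
qed

text \<open>The power of \<open>\<i>\<close> in the term cancels the \<open>(- \<i>) ^ m\<close> of
  \<open>debye_U_eq\<close>, and \<open>moment_eq\<close> matches the rest. The common factor on the
  right is the one in \<open>anger_weber_eq\<close>.\<close>

lemma prefactor_term:
  assumes "m \<le> 2 * n"
  shows "of_real (prefactor n) * debye_term n m =
    fact (2 * n) * (-1) ^ n / of_real pi * (of_real (2 * pi * half_kernel_moment a (2 * n + 1) m) * saddle_residue m)"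
proof -
  have "Gamma (2 * real n + 1 / 2) > 0" by (rule Gamma_real_pos) simp
  hence Gp: "Gamma (2 * real n + 1 / 2) \<noteq> 0" by linarith
  have i: "(\<i> * complex_of_real sigma) ^ m * (- \<i>) ^ m = of_real (sigma ^ m)"
  proof -
    have "(\<i> * complex_of_real sigma) * (- \<i>) = of_real sigma" by (simp add: complex_eq_iff)
    thus ?thesis by (simp only: power_mult_distrib[symmetric] of_real_power)
  qed
  have "of_real (prefactor n) * debye_term n m = of_real (prefactor n) * (((\<i> * of_real sigma) ^ m * (- \<i>) ^ m) *
     of_real (fact (2 * m) / (4 ^ m * fact m) * sqrt (tan \<beta> / 2)) * saddle_residue m *
     of_real (Gamma (2 * real n - real m + 1 / 2) / Gamma (2 * real n + 1 / 2)))"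
    unfolding debye_term_def debye_U_eq by (simp only: mult_ac)
  also have "\<dots> = of_real (prefactor n * sigma ^ m * (fact (2 * m) / (4 ^ m * fact m) * sqrt (tan \<beta> / 2)) *
     (Gamma (2 * real n - real m + 1 / 2) / Gamma (2 * real n + 1 / 2))) * saddle_residue m"
    unfolding i by (simp only: of_real_mult mult_ac)
  also have "prefactor n * sigma ^ m * (fact (2 * m) / (4 ^ m * fact m) * sqrt (tan \<beta> / 2)) *
     (Gamma (2 * real n - real m + 1 / 2) / Gamma (2 * real n + 1 / 2)) =
     (-1) ^ n * (sqrt (2 * cot \<beta> / (pi * sigma)) * (sigma ^ m / sigma ^ (2 * n)) *
     (fact (2 * m) / (4 ^ m * fact m) * sqrt (tan \<beta> / 2)) * Gamma (2 * real n - real m + 1 / 2))"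
    unfolding prefactor_def using Gp by simp
  also have "\<dots> = (-1) ^ n * (2 * fact (2 * n) * half_kernel_moment a (2 * n + 1) m)"
    unfolding moment_eq[OF assms] ..
  finally show ?thesis by simp
qed

text \<open>Taking \<open>A\<close> as the difference makes the identity hold by definition.
  Multiplied by the prefactor, its bound is \<open>residue_enveloped\<close> scaled by a common
  constant.\<close>

lemma expansion_enveloped:
  assumes M: "M \<le> 2 * n"
  shows "\<exists>A. - fact (2 * n) * anger_weber_coeff n (- of_real (1 / cos \<beta>)) =
      of_real (prefactor n) * ((\<Sum>m<M. debye_term n m) + A) \<and> norm A \<le> norm (debye_term n M)"
proof -
  let ?L = "- fact (2 * n) * anger_weber_coeff n (- of_real (1 / cos \<beta>))"
  let ?P = "complex_of_real (prefactor n)"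
  let ?c = "fact (2 * n) * (-1) ^ n / complex_of_real pi"
  let ?t = "\<lambda>m. of_real (2 * pi * half_kernel_moment a (2 * n + 1) m) * saddle_residue m"
  define A where "A = ?L / ?P - (\<Sum>m<M. debye_term n m)"
  have P: "?P \<noteq> 0" using prefactor_nonzero[of n] by simp
  have "?P * A = ?L - (\<Sum>m<M. ?P * debye_term n m)"
    using P by (simp add: A_def right_diff_distrib sum_distrib_left)
  also have "(\<Sum>m<M. ?P * debye_term n m) = (\<Sum>m<M. ?c * ?t m)"
    using M by (intro sum.cong refl prefactor_term) auto
  also have "?L - \<dots> = ?c * ((- of_real pi * \<i> * origin_residue (2 * n + 1)) - (\<Sum>m<M. ?t m))"
    unfolding anger_weber_eq right_diff_distrib sum_distrib_left ..
  finally have "norm (?P * A) = norm (?c * ((- of_real pi * \<i> * origin_residue (2 * n + 1)) - (\<Sum>m<M. ?t m)))"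
    by (rule arg_cong)
  hence "norm ?P * norm A = norm ?c * norm ((- of_real pi * \<i> * origin_residue (2 * n + 1)) - (\<Sum>m<M. ?t m))"
    unfolding norm_mult .
  also have "\<dots> \<le> norm ?c * norm (?t M)"
    using M by (intro mult_left_mono residue_enveloped) auto
  also have "\<dots> = norm ?P * norm (debye_term n M)"
    unfolding norm_mult[symmetric] prefactor_term[OF M] ..
  finally have "norm A \<le> norm (debye_term n M)" using P by simp
  moreover have "?L = ?P * ((\<Sum>m<M. debye_term n m) + A)" using P by (simp add: A_def)
  ultimately show ?thesis by blast
qed

end

theorem mainTheorem7:
  fixes \<beta> :: real and n M :: nat
  assumes "0 < \<beta>" and "\<beta> < pi / 2" and "n \<ge> 1" and "M \<le> 2 * n"
  shows "\<exists>A :: complex.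
    - fact (2 * n) * anger_weber_coeff n (- complex_of_real (1 / cos \<beta>)) =
      complex_of_real
        (sqrt (2 * cot \<beta> / (pi * (tan \<beta> - \<beta>))) *
         ((-1) ^ n * Gamma (2 * real n + 1 / 2) / (tan \<beta> - \<beta>) ^ (2 * n))) *
      ((\<Sum>m<M. (\<i> * complex_of_real (tan \<beta> - \<beta>)) ^ m *
                debye_U m (\<i> * complex_of_real (cot \<beta>)) *
                complex_of_real
                  (Gamma (2 * real n - real m + 1 / 2) / Gamma (2 * real n + 1 / 2))) + A) \<and>
    cmod A \<le> (tan \<beta> - \<beta>) ^ M *
      cmod (debye_U M (\<i> * complex_of_real (cot \<beta>))) *
      (Gamma (2 * real n - real M + 1 / 2) / Gamma (2 * real n + 1 / 2))"
proof -
  interpret debye \<beta> using assms by unfold_locales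
  \<comment> \<open>From \<open>M \<le> 2 * n\<close> both arguments are at least
    \<open>1 / 2\<close>; positivity lets the Gamma quotient come out of the norm unchanged.\<close>
  have "Gamma (2 * real n - real M + 1 / 2) > 0" "Gamma (2 * real n + 1 / 2) > 0"
    using assms(4) by (auto intro!: Gamma_real_pos)
  hence "norm (debye_term n M) = (tan \<beta> - \<beta>) ^ M * cmod (debye_U M (\<i> * complex_of_real (cot \<beta>))) *
      (Gamma (2 * real n - real M + 1 / 2) / Gamma (2 * real n + 1 / 2))"
    using sigma_pos by (simp add: debye_term_def norm_mult norm_power norm_divide sigma_def[symmetric])
  with expansion_enveloped[OF assms(4)] show ?thesis
    unfolding prefactor_def debye_term_def sigma_def by simp
qed

end
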